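(* Consider a discrete-time multi-agent system of $N$ identical agents $x_i(t+1)=Ax_i(t)+Bu_i(t)$, $y_i(t)=Cx_i(t)$ ($i=1,\dots,N$), with $x_i\in\mathbb{R}^n$, $u_i\in\mathbb{R}$, $y_i\in\mathbb{R}$. Each agent receives $$\zeta_i(t)=\sum_{j\ne i}d_{ij}(y_i(t)-y_j(t)),\qquad \hat\zeta_i(t)=\sum_{j\ne i}d_{ij}H_c(x_{i,c}(t)-x_{j,c}(t)),\qquad d_{ij}=\frac{a_{ij}}{1+q_i},$$ where $q_i\ge\sum_j a_{ij}$ is an upper bound on the weighted in-degree of node $i$, and uses a collaborative linear protocol $$x_{i,c}(t+1)=A_cx_{i,c}(t)+B_c\zeta_i(t)+E_c\hat\zeta_i(t),\qquad u_i(t)=F_cx_{i,c}(t)+G^1_c\zeta_i(t)+G^2_c\hat\zeta_i(t).$$ The scale-free collaborative state synchronization problem asks for fixed matrices $A_c,B_c,E_c,F_c,G_c^1,G_c^2,H_c$ (independent of $N$ and of the graph) such that for every number of agents $N$, every weighted directed graph on $N$ nodes containing a directed spanning tree, and all initial conditions of agents and protocols, $\lim_{t\to\infty}(x_i(t)-x_j(t))=0$ for all $i,j$. This problem is solvable if and only if either $A$ is asymptotically stable (Schur), or all of the following hold: $(A,B)$ is stabilizable, $(C,A)$ is detectable, and all eigenvalues of $A$ lie in the closed unit disc.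
   Context: The network is described by a weighted directed graph on nodes $\{1,\dots,N\}$ with weighted adjacency matrix $[a_{ij}]$, $a_{ij}\ge0$, $a_{ii}=0$, where $a_{ij}>0$ means an edge from node $j$ to node $i$. A directed spanning tree exists iff some node has a directed path to every other node. *)

theory Defs
  imports "Jordan_Normal_Form.Char_Poly" Complex_Main
begin

text \<open>Matrices and vectors are Jordan_Normal_Form matrices/vectors over the reals, with
explicit dimensions (the protocol dimensions are existentially quantified).
Agents are indexed by 0..N-1.\<close>

definition schur_stable :: "real mat \<Rightarrow> bool" where
  "schur_stable A \<longleftrightarrow> (\<forall>z. eigenvalue (map_mat complex_of_real A) z \<longrightarrow> cmod z < 1)"

definition stabilizable :: "real mat \<Rightarrow> real mat \<Rightarrow> bool" where
  "stabilizable A B \<longleftrightarrow>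
     (\<exists>F \<in> carrier_mat (dim_col B) (dim_row A). schur_stable (A + B * F))"

definition detectable :: "real mat \<Rightarrow> real mat \<Rightarrow> bool" where
  "detectable C A \<longleftrightarrow>
     (\<exists>K \<in> carrier_mat (dim_col A) (dim_row C). schur_stable (A + K * C))"

text \<open>Directed spanning tree: edge j -> i iff a i j > 0; some root reaches every node.\<close>
definition has_spanning_tree :: "nat \<Rightarrow> (nat \<Rightarrow> nat \<Rightarrow> real) \<Rightarrow> bool" where
  "has_spanning_tree N a \<longleftrightarrow>
     (\<exists>r<N. \<forall>k<N. (r, k) \<in> {(j, i). i < N \<and> j < N \<and> a i j > 0}\<^sup>*)"

definition weighted_graph :: "nat \<Rightarrow> (nat \<Rightarrow> nat \<Rightarrow> real) \<Rightarrow> bool" where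
  "weighted_graph N a \<longleftrightarrow> (\<forall>i<N. \<forall>j<N. a i j \<ge> 0) \<and> (\<forall>i<N. a i i = 0)"

text \<open>Diffusive coupling  sum_{j \<noteq> i} d_ij (w_i - w_j), as a vector of dimension k.\<close>
definition coupling :: "nat \<Rightarrow> (nat \<Rightarrow> nat \<Rightarrow> real) \<Rightarrow> nat \<Rightarrow> (nat \<Rightarrow> real vec) \<Rightarrow> nat \<Rightarrow> real vec" where
  "coupling N d i w k = vec k (\<lambda>l. \<Sum>j\<in>{j. j < N \<and> j \<noteq> i}. d i j * (w i $ l - w j $ l))"

definition scale_free_collab_solvable :: "nat \<Rightarrow> real mat \<Rightarrow> real mat \<Rightarrow> real mat \<Rightarrow> bool" where
  "scale_free_collab_solvable n A B C \<longleftrightarrow>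
   (\<exists>m p Ac Bc Ec Fc G1 G2 Hc.
      Ac \<in> carrier_mat m m \<and> Bc \<in> carrier_mat m 1 \<and> Ec \<in> carrier_mat m p \<and>
      Fc \<in> carrier_mat 1 m \<and> G1 \<in> carrier_mat 1 1 \<and> G2 \<in> carrier_mat 1 p \<and>
      Hc \<in> carrier_mat p m \<and>
      (\<forall>(N::nat) (a :: nat \<Rightarrow> nat \<Rightarrow> real) (q :: nat \<Rightarrow> real).
         weighted_graph N a \<and> has_spanning_tree N a \<and>
         (\<forall>i<N. q i \<ge> (\<Sum>j<N. a i j)) \<longrightarrow>
         (let d = (\<lambda>i j. a i j / (1 + q i)) in
          \<forall>(x :: nat \<Rightarrow> nat \<Rightarrow> real vec) (xc :: nat \<Rightarrow> nat \<Rightarrow> real vec).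
            (\<forall>i<N. x i 0 \<in> carrier_vec n \<and> xc i 0 \<in> carrier_vec m) \<and>
            (\<forall>i<N. \<forall>t.
               (let zeta = coupling N d i (\<lambda>j. C *\<^sub>v x j t) 1;
                    zh = coupling N d i (\<lambda>j. Hc *\<^sub>v xc j t) p;
                    u = Fc *\<^sub>v xc i t + G1 *\<^sub>v zeta + G2 *\<^sub>v zh
                in x i (Suc t) = A *\<^sub>v x i t + B *\<^sub>v u \<and>
                   xc i (Suc t) = Ac *\<^sub>v xc i t + Bc *\<^sub>v zeta + Ec *\<^sub>v zh))
            \<longrightarrow> (\<forall>i<N. \<forall>j<N. \<forall>k<n. (\<lambda>t. x i t $ k - x j t $ k) \<longlonglongrightarrow> 0))))"

end

theory Submission
  imports Defs "Jordan_Normal_Form.Spectral_Radius"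
begin

text \<open>
  Since a Schur matrix \<open>A\<close> is stabilizable and detectable, only the second alternative matters.

  Sufficiency. With \<open>A + BF\<close> and \<open>A + KC\<close> Schur, agent \<open>i\<close> runs an observer \<open>xh\<close> of the network
  signal \<open>\<xi>\<^sub>i = \<Sum>\<^sub>j d\<^sub>i\<^sub>j (x\<^sub>i - x\<^sub>j)\<close> and an estimate \<open>\<chi>\<close> of its own state, and applies
  \<open>u = F \<chi>\<close>. Then \<open>\<xi> - xh\<close> decays under \<open>A + KC\<close>, the error \<open>e = x - \<chi>\<close> obeys
  \<open>e\<^sub>i(t+1) = A (\<Sum>\<^sub>j D\<^sub>i\<^sub>j e\<^sub>j + (\<xi> - xh)\<^sub>i)\<close> with \<open>D\<close> row stochastic, and \<open>x\<close> is driven by \<open>A + BF\<close> and \<open>e\<close>.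
  The rows of \<open>D\<^sup>t\<close> merge geometrically because of the spanning tree, whereas \<open>A\<^sup>t\<close> grows at most
  polynomially, so the differences of the \<open>e\<^sub>i\<close>, and then those of the \<open>x\<^sub>i\<close>, vanish.

  Necessity. A leader with a single follower and coupling \<open>\<delta>\<close> yields a closed loop matrix \<open>M(\<delta>)\<close>
  whose upper left block satisfies \<open>(M(\<delta>)\<^sup>t)\<^sub>1\<^sub>1 \<rightarrow> 0\<close>. Read forwards, this gives open loop controls of finite
  quadratic cost for \<open>(A, B)\<close>, and value iteration turns them into a stabilizing feedback; read on the
  transposed matrix it does the same for \<open>(A\<^sup>T, C\<^sup>T)\<close>. Finally, the entries of \<open>(M(\<delta>)\<^sup>t)\<^sub>1\<^sub>1\<close> are null
  sequences satisfying a recurrence of bounded order, hence grow at most polynomially uniformly in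
  \<open>\<delta>\<close>; letting \<open>\<delta> \<rightarrow> 0\<close> the powers of \<open>A\<close> grow at most polynomially.
\<close>

section \<open>Linear recursions and powers of matrices\<close>

text \<open>\<open>M(\<delta>)\<close> need not be Schur: synchronization constrains the agent
  states only, and the protocol may carry modes that never decay. Continuity of eigenvalues
  therefore says nothing about \<open>A\<close>, and necessity has to work with entries of powers.
  The recurrences of these entries vary with \<delta> in an uncontrolled way, hence a growth bound
  whose constant ignores their roots. For the same reason the controls read off from
  \<open>M(\<delta>)\<close> are used up to a finite time and then restarted: until then the input
  has finite cost, whereas its decay is unknown. Arbitrarily small \<delta> are available because
  \<open>q i\<close> is any upper bound of the in-degree, so a unit edge can be weakened to
  \<open>1 / (1 + q i)\<close>. At \<delta> = 0 the follower is decoupled from the leader and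
  \<open>M(0)\<close> is block triangular with corner \<open>A\<close>. In the sufficiency proof the
  errors \<open>e\<close> themselves need not vanish, since \<open>A\<close> may have eigenvalues on
  the unit circle. Their differences do, and only these force the difference of two agents.\<close>

lemma null_sequence_of_contraction:
  fixes b w :: "nat \<Rightarrow> real"
  assumes step: "\<And>t. b (Suc t) \<le> \<sigma> * b t + w t"
    and nonneg: "\<And>t. 0 \<le> b t"
    and \<sigma>: "0 \<le> \<sigma>" "\<sigma> < 1"
    and w: "w \<longlonglongrightarrow> 0"
  shows "b \<longlonglongrightarrow> 0"
proof (rule LIMSEQ_I)
  fix r :: real assume r: "0 < r"
  \<comment> \<open>With forcing below this level the majorizing recursion has the fixed point
    \<open>r / 2\<close>, so from \<open>N\<close> on only the transient
    \<open>\<sigma> ^ k * b N\<close> remains to be made small.\<close>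
  have "0 < (1 - \<sigma>) * (r / 2)" using r \<sigma> by simp
  from LIMSEQ_D[OF w this] obtain N where N: "\<And>t. t \<ge> N \<Longrightarrow> \<bar>w t\<bar> < (1 - \<sigma>) * (r / 2)"
    by auto
  have bound: "b (N + k) \<le> r / 2 + \<sigma> ^ k * b N" for k
  proof (induction k)
    case 0
    then show ?case using r by simp
  next
    case (Suc k)
    have "b (N + Suc k) \<le> \<sigma> * b (N + k) + w (N + k)" using step[of "N + k"] by simp
    also have "\<dots> \<le> \<sigma> * (r / 2 + \<sigma> ^ k * b N) + (1 - \<sigma>) * (r / 2)"
      using Suc \<sigma>(1) N[of "N + k"] by (intro add_mono mult_left_mono) auto
    also have "\<dots> = r / 2 + \<sigma> ^ Suc k * b N" by (simp add: algebra_simps add_divide_distrib[symmetric])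
    finally show ?case .
  qed
  have "(\<lambda>k. \<sigma> ^ k * b N) \<longlonglongrightarrow> 0 * b N"
    using \<sigma> by (intro tendsto_mult LIMSEQ_realpow_zero tendsto_const)
  then obtain K where K: "\<And>k. k \<ge> K \<Longrightarrow> \<bar>\<sigma> ^ k * b N\<bar> < r / 2"
    using LIMSEQ_D[of "\<lambda>k. \<sigma> ^ k * b N" 0 "r / 2"] r by auto
  show "\<exists>no. \<forall>n\<ge>no. norm (b n - 0) < r"
  proof (intro exI[of _ "N + K"] allI impI)
    fix t assume "t \<ge> N + K"
    then obtain k where k: "t = N + k" "k \<ge> K" by (metis add.assoc le_Suc_ex le_add1)
    show "norm (b t - 0) < r" using bound[of k] K[OF k(2)] nonneg[of t] k(1) by auto
  qed
qed

text \<open>The second index absorbs the iterated kernel, so that a convolution sum never has to be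
  written down.\<close>

lemma null_sequence_of_shifted_recursion:
  fixes f :: "nat \<Rightarrow> nat \<Rightarrow> real" and w :: "nat \<Rightarrow> real"
  assumes step: "\<And>q t. f q (Suc t) \<le> f (Suc q) t + c * \<sigma> ^ q * w t"
    and init: "\<And>q. f q 0 \<le> c * \<sigma> ^ q"
    and nonneg: "\<And>t. 0 \<le> f 0 t" "\<And>t. 0 \<le> w t" "0 \<le> c"
    and \<sigma>: "0 \<le> \<sigma>" "\<sigma> < 1"
    and w: "w \<longlonglongrightarrow> 0"
  shows "f 0 \<longlonglongrightarrow> 0"
proof -
  \<comment> \<open>One scalar recursion dominates the whole family:
    \<open>f q t \<le> \<sigma> ^ q * b t\<close>. Trading a time step for a unit of
    \<open>q\<close> produces the contraction factor, so the induction must treat all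
    \<open>q\<close> at once.\<close>
  define b where "b = rec_nat c (\<lambda>t y. \<sigma> * y + c * w t)"
  have b0: "b 0 = c" and bS: "b (Suc t) = \<sigma> * b t + c * w t" for t by (simp_all add: b_def)
  have b_nonneg: "0 \<le> b t" for t
    by (induction t) (simp_all add: b0 bS nonneg(2,3) \<sigma>(1))
  have "(\<lambda>t. c * w t) \<longlonglongrightarrow> c * 0" by (intro tendsto_mult tendsto_const w)
  then have cw: "(\<lambda>t. c * w t) \<longlonglongrightarrow> 0" by simp
  have b: "b \<longlonglongrightarrow> 0"
    by (rule null_sequence_of_contraction[OF _ b_nonneg \<sigma> cw]) (simp add: bS)
  have le: "f q t \<le> \<sigma> ^ q * b t" for q t
  proof (induction t arbitrary: q)
    case 0
    then show ?case using init[of q] by (simp add: b0 mult.commute)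
  next
    case (Suc t)
    have "f q (Suc t) \<le> \<sigma> ^ Suc q * b t + c * \<sigma> ^ q * w t"
      using step[of q t] Suc[of "Suc q"] by linarith
    then show ?case by (simp add: bS algebra_simps)
  qed
  show ?thesis
  proof (rule tendsto_sandwich[OF _ _ tendsto_const b])
    show "\<forall>\<^sub>F t in sequentially. f 0 t \<le> b t"
      using le[of 0] by (intro always_eventually allI) simp
  qed (intro always_eventually allI nonneg)
qed

section \<open>Growth of matrix powers versus moduli of eigenvalues\<close>

lemma pow_mat_Suc_left:
  fixes A :: "'a :: semiring_1 mat"
  assumes "A \<in> carrier_mat n n"
  shows "A ^\<^sub>m Suc k = A * A ^\<^sub>m k"
  using assms
proof (induction k)
  case (Suc k)
  then have "A ^\<^sub>m Suc (Suc k) = A * A ^\<^sub>m k * A" by simp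
  also have "\<dots> = A * (A ^\<^sub>m k * A)" using Suc.prems by (intro assoc_mult_mat) auto
  finally show ?case by simp
qed simp

lemma smult_pow_mat:
  fixes A :: "'a :: comm_semiring_1 mat"
  assumes "A \<in> carrier_mat n n"
  shows "(c \<cdot>\<^sub>m A) ^\<^sub>m k = c ^ k \<cdot>\<^sub>m A ^\<^sub>m k"
  using assms
proof (induction k)
  case 0
  then show ?case by (intro eq_matI) auto
next
  case (Suc k)
  have Ak: "A ^\<^sub>m k \<in> carrier_mat n n" using Suc.prems by auto
  show ?case using Suc.prems Ak
    by (simp add: Suc.IH mult_smult_assoc_mat[of _ n n _ n] mult_smult_distrib[of _ n n _ n])
      (intro eq_matI; auto simp: algebra_simps)
qed

text \<open>Division by \<open>r\<close> moves the spectrum into the closed unit disc, where the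
  Jordan form bounds the powers by a polynomial; the gap \<open>r < s\<close> absorbs this
  polynomial into \<open>s ^ q\<close>.\<close>

lemma pow_mat_bound_of_eigenvalue_bound:
  fixes A :: "complex mat"
  assumes A: "A \<in> carrier_mat n n"
    and ev: "\<And>z. eigenvalue A z \<Longrightarrow> cmod z \<le> r"
    and r: "0 < r" "r < s"
  shows "\<exists>c\<ge>0. \<forall>q. \<forall>i<n. \<forall>j<n. cmod ((A ^\<^sub>m q) $$ (i, j)) \<le> c * s ^ q"
\<comment> \<open>For \<open>n = 0\<close> the spectrum is empty and its maximal modulus has no
  meaning.\<close>
proof (cases "n = 0")
  case True
  then show ?thesis by (intro exI[of _ 0]) auto
next
  case False
  define B where "B = complex_of_real (1 / r) \<cdot>\<^sub>m A"
  have B: "B \<in> carrier_mat n n" using A by (simp add: B_def)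
  have evB: "cmod z \<le> 1" if "eigenvalue B z" for z
  proof -
    from that obtain v where v: "v \<in> carrier_vec n" "v \<noteq> 0\<^sub>v n" "B *\<^sub>v v = z \<cdot>\<^sub>v v"
      using B unfolding eigenvalue_def eigenvector_def by auto
    have "A *\<^sub>v v = (of_real r * z) \<cdot>\<^sub>v v"
    proof -
      have "A *\<^sub>v v = of_real r \<cdot>\<^sub>v (B *\<^sub>v v)"
        using A v(1) r by (intro eq_vecI) (auto simp: B_def)
      then show ?thesis by (simp add: v(3) smult_smult_assoc)
    qed
    then have "eigenvalue A (of_real r * z)"
      using A v unfolding eigenvalue_def eigenvector_def by auto
    from ev[OF this] r show ?thesis by (simp add: norm_mult)
  qed
  have "spectral_radius B \<le> 1"
    using spectral_radius_mem_max(1)[OF B] False evB unfolding spectrum_def by auto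
  from spectral_radius_jnf_norm_bound_le_1_upper_triangular[OF B this]
  obtain c1 c2 where c: "\<And>k. norm_bound (B ^\<^sub>m k) (c1 + c2 * of_nat k ^ (n - 1))" by auto
  have rs: "0 < r / s" "r / s < 1" using r by auto
  from poly_exp_constant_bound[OF rs, of c2 "n - 1"] obtain p
    where p: "\<And>x. c2 * (r / s) ^ x * of_nat x ^ (n - 1) \<le> p" by auto
  have bound: "cmod ((A ^\<^sub>m q) $$ (i, j)) \<le> (\<bar>c1\<bar> + \<bar>p\<bar>) * s ^ q" if ij: "i < n" "j < n" for q i j
  proof -
    have "(B ^\<^sub>m q) $$ (i, j) = complex_of_real (1 / r) ^ q * (A ^\<^sub>m q) $$ (i, j)"
      using A ij unfolding B_def smult_pow_mat[OF A] by auto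
    moreover have "cmod ((B ^\<^sub>m q) $$ (i, j)) \<le> c1 + c2 * of_nat q ^ (n - 1)"
      using c[of q] ij B unfolding norm_bound_def by auto
    ultimately have "(1 / r) ^ q * cmod ((A ^\<^sub>m q) $$ (i, j)) \<le> c1 + c2 * of_nat q ^ (n - 1)"
      using r by (simp add: norm_mult norm_power norm_divide)
    then have "cmod ((A ^\<^sub>m q) $$ (i, j)) \<le> r ^ q * (c1 + c2 * of_nat q ^ (n - 1))"
      using r by (simp add: power_one_over field_simps)
    also have "\<dots> = s ^ q * ((r / s) ^ q * c1 + c2 * (r / s) ^ q * of_nat q ^ (n - 1))"
      using r by (simp add: power_divide field_simps)
    also have "\<dots> \<le> s ^ q * (\<bar>c1\<bar> + \<bar>p\<bar>)"
    proof (intro mult_left_mono add_mono)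
      have "(r / s) ^ q \<le> 1" using rs by (intro power_le_one) auto
      then have "(r / s) ^ q * \<bar>c1\<bar> \<le> 1 * \<bar>c1\<bar>" by (intro mult_right_mono) auto
      moreover have "(r / s) ^ q * c1 \<le> (r / s) ^ q * \<bar>c1\<bar>" using rs by (intro mult_left_mono) auto
      ultimately show "(r / s) ^ q * c1 \<le> \<bar>c1\<bar>" by linarith
      show "c2 * (r / s) ^ q * of_nat q ^ (n - 1) \<le> \<bar>p\<bar>" using p[of q] by linarith
      show "0 \<le> s ^ q" using r by simp
    qed
    finally show ?thesis by (simp add: mult.commute)
  qed
  show ?thesis by (intro exI[of _ "\<bar>c1\<bar> + \<bar>p\<bar>"]) (use bound in auto)
qed

lemma real_pow_mat_bound_of_eigenvalue_bound:
  assumes A: "A \<in> carrier_mat n n"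
    and ev: "\<And>z. eigenvalue (map_mat complex_of_real A) z \<Longrightarrow> cmod z \<le> r"
    and r: "0 < r" "r < s"
  shows "\<exists>c\<ge>0. \<forall>q. \<forall>i<n. \<forall>j<n. \<bar>(A ^\<^sub>m q) $$ (i, j)\<bar> \<le> c * s ^ q"
proof -
  have "map_mat complex_of_real A \<in> carrier_mat n n" using A by simp
  from pow_mat_bound_of_eigenvalue_bound[OF this ev r] obtain c where c: "c \<ge> 0"
    "\<And>q i j. i < n \<Longrightarrow> j < n \<Longrightarrow> cmod ((map_mat complex_of_real A ^\<^sub>m q) $$ (i, j)) \<le> c * s ^ q"
    by blast
  have "\<bar>(A ^\<^sub>m q) $$ (i, j)\<bar> \<le> c * s ^ q" if "i < n" "j < n" for q i j
    using c(2)[OF that, of q] that A by (simp add: of_real_hom.mat_hom_pow[OF A, symmetric])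
  with c(1) show ?thesis by blast
qed

lemma schur_stable_pow_bound:
  assumes A: "A \<in> carrier_mat n n" and "schur_stable A"
  shows "\<exists>c \<sigma>. 0 \<le> c \<and> 0 < \<sigma> \<and> \<sigma> < 1 \<and> (\<forall>q. \<forall>i<n. \<forall>j<n. \<bar>(A ^\<^sub>m q) $$ (i, j)\<bar> \<le> c * \<sigma> ^ q)"
proof -
  let ?A = "map_mat complex_of_real A"
  \<comment> \<open>\<open>1 / 2\<close> keeps the maximum defined and positive even if all
    eigenvalues vanish or there are none; \<open>(1 + r) / 2\<close> then lies strictly between
    \<open>r\<close> and 1.\<close>
  let ?S = "insert (1 / 2) (cmod ` spectrum ?A)"
  have fin: "finite ?S" using card_finite_spectrum(1)[of ?A n] A by auto
  define r where "r = Max ?S"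
  have "r \<in> ?S" unfolding r_def by (rule Max_in) (use fin in auto)
  then have r1: "r < 1" using assms(2) unfolding schur_stable_def spectrum_def by auto
  have r0: "1 / 2 \<le> r" unfolding r_def by (rule Max_ge) (use fin in auto)
  have ev: "cmod z \<le> r" if "eigenvalue ?A z" for z
    unfolding r_def by (rule Max_ge) (use fin that in \<open>auto simp: spectrum_def\<close>)
  from real_pow_mat_bound_of_eigenvalue_bound[OF A ev, of "(1 + r) / 2"] r0 r1
  obtain c where c: "c \<ge> 0" "\<forall>q. \<forall>i<n. \<forall>j<n. \<bar>(A ^\<^sub>m q) $$ (i, j)\<bar> \<le> c * ((1 + r) / 2) ^ q"
    by auto
  show ?thesis
    by (rule exI[of _ c], rule exI[of _ "(1 + r) / 2"]) (use c r0 r1 in auto)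
qed

text \<open>Row \<open>i\<close> of \<open>A ^ q v = z ^ q v\<close>, for a coordinate
  \<open>i\<close> where the eigenvector does not vanish. Through it, decay or slow growth of the
  powers limits the eigenvalues.\<close>

lemma eigenvalue_pow_le:
  assumes A: "A \<in> carrier_mat n n" and ev: "eigenvalue (map_mat complex_of_real A) z"
  shows "\<exists>c>0. \<forall>q. \<exists>i<n. cmod z ^ q \<le> c * (\<Sum>j<n. \<bar>(A ^\<^sub>m q) $$ (i, j)\<bar>)"
proof -
  let ?A = "map_mat complex_of_real A"
  have A': "?A \<in> carrier_mat n n" using A by simp
  from ev obtain v where v: "eigenvector ?A v z" unfolding eigenvalue_def by auto
  then have vc: "v \<in> carrier_vec n" and v0: "v \<noteq> 0\<^sub>v n" using A unfolding eigenvector_def by auto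
  from v0 vc obtain i where i: "i < n" "v $ i \<noteq> 0" by (metis carrier_vecD eq_vecI index_zero_vec)
  define S where "S = (\<Sum>j<n. cmod (v $ j))"
  have S: "cmod (v $ j) \<le> S" if "j < n" for j
    unfolding S_def by (rule member_le_sum) (use that in auto)
  have Spos: "S > 0" using S[OF i(1)] i(2) by (smt (verit) zero_less_norm_iff)
  have "cmod z ^ q \<le> S / cmod (v $ i) * (\<Sum>j<n. \<bar>(A ^\<^sub>m q) $$ (i, j)\<bar>)" for q
  proof -
    have "z ^ q * v $ i = (?A ^\<^sub>m q *\<^sub>v v) $ i"
      using eigenvector_pow[OF A' v, of q] i vc by simp
    also have "\<dots> = (\<Sum>j<n. of_real ((A ^\<^sub>m q) $$ (i, j)) * v $ j)"
      using A i vc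
      by (simp add: of_real_hom.mat_hom_pow[OF A, symmetric] scalar_prod_def lessThan_atLeast0)
    also have "cmod \<dots> \<le> (\<Sum>j<n. \<bar>(A ^\<^sub>m q) $$ (i, j)\<bar> * S)"
      by (intro sum_norm_le) (use S in \<open>auto simp: norm_mult intro!: mult_left_mono\<close>)
    finally have "cmod z ^ q * cmod (v $ i) \<le> S * (\<Sum>j<n. \<bar>(A ^\<^sub>m q) $$ (i, j)\<bar>)"
      by (simp add: norm_mult norm_power sum_distrib_left mult.commute)
    then show ?thesis using i by (simp add: field_simps)
  qed
  then show ?thesis using i Spos by (intro exI[of _ "S / cmod (v $ i)"]) auto
qed

lemma schur_stable_of_pow_tendsto_0:
  assumes A: "A \<in> carrier_mat n n"
    and lim: "\<And>i j. i < n \<Longrightarrow> j < n \<Longrightarrow> (\<lambda>q. (A ^\<^sub>m q) $$ (i, j)) \<longlonglongrightarrow> 0"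
  shows "schur_stable A"
  unfolding schur_stable_def
proof (intro allI impI)
  fix z assume ev: "eigenvalue (map_mat complex_of_real A) z"
  from eigenvalue_pow_le[OF A ev] obtain c where c: "c > 0"
    "\<And>q. \<exists>i<n. cmod z ^ q \<le> c * (\<Sum>j<n. \<bar>(A ^\<^sub>m q) $$ (i, j)\<bar>)" by blast
  have "(\<lambda>q. c * (\<Sum>i<n. \<Sum>j<n. \<bar>(A ^\<^sub>m q) $$ (i, j)\<bar>)) \<longlonglongrightarrow> c * (\<Sum>i<n. \<Sum>j<n. \<bar>0\<bar>)"
    by (intro tendsto_intros lim) auto
  then have "\<forall>\<^sub>F q in sequentially. c * (\<Sum>i<n. \<Sum>j<n. \<bar>(A ^\<^sub>m q) $$ (i, j)\<bar>) < 1"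
    by (intro order_tendstoD(2)[where y = 0]) auto
  then obtain q where q: "c * (\<Sum>i<n. \<Sum>j<n. \<bar>(A ^\<^sub>m q) $$ (i, j)\<bar>) < 1"
    unfolding eventually_sequentially by blast
  from c(2)[of q] obtain i where i: "i < n" "cmod z ^ q \<le> c * (\<Sum>j<n. \<bar>(A ^\<^sub>m q) $$ (i, j)\<bar>)" by blast
  have "(\<Sum>j<n. \<bar>(A ^\<^sub>m q) $$ (i, j)\<bar>) \<le> (\<Sum>i<n. \<Sum>j<n. \<bar>(A ^\<^sub>m q) $$ (i, j)\<bar>)"
    by (rule member_le_sum) (use i in \<open>auto intro: sum_nonneg\<close>)
  then have "cmod z ^ q < 1" using q i(2) c(1) by (smt (verit) mult_left_mono)
  then show "cmod z < 1" using one_le_power[of "cmod z" q] by linarith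
qed

lemma eigenvalue_le_1_of_pow_poly_bound:
  assumes A: "A \<in> carrier_mat n n"
    and bound: "\<And>q i j. i < n \<Longrightarrow> j < n \<Longrightarrow> \<bar>(A ^\<^sub>m q) $$ (i, j)\<bar> \<le> c * real (Suc q) ^ k"
    and ev: "eigenvalue (map_mat complex_of_real A) z"
  shows "cmod z \<le> 1"
proof (rule ccontr)
  assume "\<not> cmod z \<le> 1"
  then have z: "cmod z > 1" by simp
  then have z0: "z \<noteq> 0" by auto
  from eigenvalue_pow_le[OF A ev] obtain d where d: "d > 0"
    "\<And>q. \<exists>i<n. cmod z ^ q \<le> d * (\<Sum>j<n. \<bar>(A ^\<^sub>m q) $$ (i, j)\<bar>)" by blast
  define C where "C = d * (real n * c)"
  have le: "cmod z ^ q \<le> C * real (Suc q) ^ k" for q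
  proof -
    from d(2)[of q] obtain i where i: "i < n" "cmod z ^ q \<le> d * (\<Sum>j<n. \<bar>(A ^\<^sub>m q) $$ (i, j)\<bar>)" by blast
    have "(\<Sum>j<n. \<bar>(A ^\<^sub>m q) $$ (i, j)\<bar>) \<le> (\<Sum>j<n. c * real (Suc q) ^ k)"
      by (intro sum_mono bound) (use i in auto)
    then have "d * (\<Sum>j<n. \<bar>(A ^\<^sub>m q) $$ (i, j)\<bar>) \<le> d * (real n * (c * real (Suc q) ^ k))"
      using d(1) by (intro mult_left_mono) auto
    then show ?thesis using i(2) by (simp add: C_def mult.assoc)
  qed
  have b: "0 < 1 / cmod z" "1 / cmod z < 1" using z by (auto simp: divide_simps)
  \<comment> \<open>The exponential beats degree \<open>Suc k\<close>, one more than the assumed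
    growth; the surplus factor \<open>real (Suc q)\<close> is then bounded by a constant, which is
    absurd.\<close>
  from poly_exp_constant_bound[OF b, of "C * cmod z" "Suc k"] obtain p
    where p: "\<And>x. C * cmod z * (1 / cmod z) ^ x * of_nat x ^ Suc k \<le> p" by auto
  have le_p: "real (Suc q) \<le> p" for q
  proof -
    have "real (Suc q) * cmod z ^ q \<le> real (Suc q) * (C * real (Suc q) ^ k)"
      by (intro mult_left_mono le) auto
    also have "\<dots> = C * cmod z * (1 / cmod z) ^ Suc q * of_nat (Suc q) ^ Suc k * cmod z ^ q"
      using z0 by (simp add: power_one_over field_simps)
    also have "\<dots> \<le> p * cmod z ^ q" by (intro mult_right_mono p) auto
    finally show ?thesis by (rule mult_right_le_imp_le) (use z0 in simp)
  qed
  obtain m where "p < real m" using reals_Archimedean2 by blast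
  with le_p[of m] show False by simp
qed

section \<open>Rooted stochastic matrices\<close>

lemma pow_mat_add:
  fixes A :: "'a :: semiring_1 mat"
  assumes A: "A \<in> carrier_mat n n"
  shows "A ^\<^sub>m (k + l) = A ^\<^sub>m k * A ^\<^sub>m l"
proof (induction l)
  case 0
  then show ?case using A right_mult_one_mat[OF pow_carrier_mat[OF A, of k]] by simp
next
  case (Suc l)
  then show ?case
    using assoc_mult_mat[OF pow_carrier_mat[OF A, of k] pow_carrier_mat[OF A, of l] A] by simp
qed

lemma index_mult_mat_sum:
  assumes "A \<in> carrier_mat n m" "B \<in> carrier_mat m k" "i < n" "j < k"
  shows "(A * B) $$ (i, j) = (\<Sum>l<m. A $$ (i, l) * B $$ (l, j))"
  using assms by (auto simp: scalar_prod_def lessThan_atLeast0 intro!: sum.cong)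

lemma stochastic_pow:
  fixes D :: "real mat"
  assumes D: "D \<in> carrier_mat N N"
    and nonneg: "\<And>i j. i < N \<Longrightarrow> j < N \<Longrightarrow> 0 \<le> D $$ (i, j)"
    and sum1: "\<And>i. i < N \<Longrightarrow> (\<Sum>j<N. D $$ (i, j)) = 1"
  shows "\<And>i j. i < N \<Longrightarrow> j < N \<Longrightarrow> 0 \<le> (D ^\<^sub>m q) $$ (i, j)"
    and "\<And>i. i < N \<Longrightarrow> (\<Sum>j<N. (D ^\<^sub>m q) $$ (i, j)) = 1"
proof (induction q)
  case 0
  { case 1 then show ?case using D by simp }
  { case 2 then show ?case using D by (simp add: sum.delta if_distrib) }
next
  case (Suc q)
  have Dq: "D ^\<^sub>m q \<in> carrier_mat N N" using D by simp
  have eq: "(D ^\<^sub>m Suc q) $$ (i, j) = (\<Sum>l<N. (D ^\<^sub>m q) $$ (i, l) * D $$ (l, j))" if "i < N" "j < N" for i j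
    using index_mult_mat_sum[OF Dq D that] by simp
  { case 1 then show ?case unfolding eq[OF 1] using Suc(1) nonneg by (intro sum_nonneg) auto }
  { case 2
    have "(\<Sum>j<N. (D ^\<^sub>m Suc q) $$ (i, j)) = (\<Sum>j<N. \<Sum>l<N. (D ^\<^sub>m q) $$ (i, l) * D $$ (l, j))"
      using 2 by (intro sum.cong) (auto simp: eq simp del: pow_mat.simps)
    also have "\<dots> = (\<Sum>l<N. (D ^\<^sub>m q) $$ (i, l) * (\<Sum>j<N. D $$ (l, j)))"
      by (subst sum.swap) (simp add: sum_distrib_left)
    also have "\<dots> = 1" using Suc(2)[OF 2] sum1 by simp
    finally show ?case . }
qed

text \<open>Weight at least \<delta> on the index \<open>r\<close> draws every average towards
  \<open>v r\<close>. The two bounds depend on the weights only through \<delta> and are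
  \<open>(1 - \<delta>) * (hi - lo)\<close> apart, so averages with different weights share one
  shorter interval.\<close>

lemma stochastic_average_range:
  fixes p v :: "nat \<Rightarrow> real"
  assumes p: "\<And>j. j < N \<Longrightarrow> 0 \<le> p j" "(\<Sum>j<N. p j) = 1"
    and r: "r < N" "\<delta> \<le> p r"
    and v: "\<And>j. j < N \<Longrightarrow> lo \<le> v j" "\<And>j. j < N \<Longrightarrow> v j \<le> hi"
  shows "lo + \<delta> * (v r - lo) \<le> (\<Sum>j<N. p j * v j)"
    and "(\<Sum>j<N. p j * v j) \<le> hi - \<delta> * (hi - v r)"
proof -
  have "\<delta> * (v r - lo) \<le> p r * (v r - lo)" using r v(1)[OF r(1)] by (intro mult_right_mono) auto
  also have "\<dots> \<le> (\<Sum>j<N. p j * (v j - lo))"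
    by (rule member_le_sum) (use r p v in auto)
  also have "\<dots> = (\<Sum>j<N. p j * v j) - lo"
    using p(2) by (simp add: right_diff_distrib sum_subtractf sum_distrib_right[symmetric])
  finally show "lo + \<delta> * (v r - lo) \<le> (\<Sum>j<N. p j * v j)" by simp
  have "\<delta> * (hi - v r) \<le> p r * (hi - v r)" using r v(2)[OF r(1)] by (intro mult_right_mono) auto
  also have "\<dots> \<le> (\<Sum>j<N. p j * (hi - v j))"
    by (rule member_le_sum) (use r p v in auto)
  also have "\<dots> = hi - (\<Sum>j<N. p j * v j)"
    using p(2) by (simp add: right_diff_distrib sum_subtractf sum_distrib_right[symmetric])
  finally show "(\<Sum>j<N. p j * v j) \<le> hi - \<delta> * (hi - v r)" by simp
qed

text \<open>A path of length \<open>L\<close> from \<open>r\<close> to \<open>k\<close> makes the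
  entry at \<open>k\<close>, \<open>r\<close> of the \<open>L\<close>-th power positive. The
  positive diagonal lets a walk wait, so one exponent serves all \<open>k\<close> at once.\<close>

lemma stochastic_rooted_column_positive:
  fixes D :: "real mat"
  assumes D: "D \<in> carrier_mat N N"
    and nonneg: "\<And>i j. i < N \<Longrightarrow> j < N \<Longrightarrow> 0 \<le> D $$ (i, j)"
    and sum1: "\<And>i. i < N \<Longrightarrow> (\<Sum>j<N. D $$ (i, j)) = 1"
    and diag: "\<And>i. i < N \<Longrightarrow> 0 < D $$ (i, i)"
    and r: "r < N" "\<And>k. k < N \<Longrightarrow> (r, k) \<in> {(j, i). i < N \<and> j < N \<and> 0 < D $$ (i, j)}\<^sup>*"
  shows "\<exists>T>0. \<forall>k<N. 0 < (D ^\<^sub>m T) $$ (k, r)"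
proof -
  have Dq: "D ^\<^sub>m q \<in> carrier_mat N N" for q using D by simp
  have pow: "0 \<le> (D ^\<^sub>m q) $$ (i, j)" if "i < N" "j < N" for q i j
    by (rule stochastic_pow(1)[OF D]) (use nonneg sum1 that in auto)
  have column_step: "0 < (D ^\<^sub>m Suc q) $$ (i, r)" if "i < N" "j < N" "0 < D $$ (i, j)" "0 < (D ^\<^sub>m q) $$ (j, r)"
    for i j q
  proof -
    have "0 < D $$ (i, j) * (D ^\<^sub>m q) $$ (j, r)" using that by simp
    also have "\<dots> \<le> (\<Sum>l<N. D $$ (i, l) * (D ^\<^sub>m q) $$ (l, r))"
      by (rule member_le_sum)
        (use that nonneg pow r in \<open>auto intro!: mult_nonneg_nonneg\<close>)
    also have "\<dots> = (D ^\<^sub>m Suc q) $$ (i, r)"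
      unfolding pow_mat_Suc_left[OF D] using index_mult_mat_sum[OF D Dq that(1) r(1)] by simp
    finally show ?thesis .
  qed
  have ex: "k < N \<and> (\<exists>L. 0 < (D ^\<^sub>m L) $$ (k, r))"
    if "(r, k) \<in> {(j, i). i < N \<and> j < N \<and> 0 < D $$ (i, j)}\<^sup>*" for k
    using that
  proof (induction rule: rtrancl_induct)
    case base
    have "0 < (D ^\<^sub>m 0) $$ (r, r)" using r D by simp
    then show ?case using r by blast
  next
    case (step y z)
    then obtain L where "0 < (D ^\<^sub>m L) $$ (y, r)" by blast
    with column_step[of z y L] step.hyps(2) show ?case by blast
  qed
  have "\<forall>k\<in>{..<N}. \<exists>L. 0 < (D ^\<^sub>m L) $$ (k, r)"
  proof
    fix k assume "k \<in> {..<N}"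
    then have "k < N" by simp
    from conjunct2[OF ex[OF r(2)[OF this]]] show "\<exists>L. 0 < (D ^\<^sub>m L) $$ (k, r)" .
  qed
  from bchoice[OF this] obtain L where L: "\<And>k. k < N \<Longrightarrow> 0 < (D ^\<^sub>m L k) $$ (k, r)" by auto
  have mono: "0 < (D ^\<^sub>m (L k + d)) $$ (k, r)" if "k < N" for k d
  proof (induction d)
    case (Suc d)
    then show ?case using column_step[OF that that diag[OF that]] by simp
  qed (use L that in simp)
  \<comment> \<open>The sum dominates every \<open>L k\<close>; \<open>Suc\<close> excludes
    \<open>T = 0\<close>, as the contraction rate will be a \<open>T\<close>-th root.\<close>
  define T where "T = Suc (\<Sum>k<N. L k)"
  have "0 < (D ^\<^sub>m T) $$ (k, r)" if "k < N" for k
  proof -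
    have "L k \<le> (\<Sum>k<N. L k)" by (rule member_le_sum) (use that in auto)
    then have "T = L k + (T - L k)" by (simp add: T_def)
    then show ?thesis using mono[OF that, of "T - L k"] by simp
  qed
  then show ?thesis by (intro exI[of _ T]) (auto simp: T_def)
qed

text \<open>Doeblin's argument: all rows of the \<open>T\<close>-th power put weight at least
  \<delta> on the index \<open>r\<close>, so every \<open>T\<close> steps the spread of each column
  shrinks by the factor 1 - \<delta>.\<close>

lemma stochastic_pow_rows_merge:
  fixes D :: "real mat"
  assumes D: "D \<in> carrier_mat N N"
    and nonneg: "\<And>i j. i < N \<Longrightarrow> j < N \<Longrightarrow> 0 \<le> D $$ (i, j)"
    and sum1: "\<And>i. i < N \<Longrightarrow> (\<Sum>j<N. D $$ (i, j)) = 1"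
    and diag: "\<And>i. i < N \<Longrightarrow> 0 < D $$ (i, i)"
    and r: "r < N" "\<And>k. k < N \<Longrightarrow> (r, k) \<in> {(j, i). i < N \<and> j < N \<and> 0 < D $$ (i, j)}\<^sup>*"
  shows "\<exists>c \<sigma>. 0 \<le> c \<and> 0 < \<sigma> \<and> \<sigma> < 1 \<and>
    (\<forall>q. \<forall>i<N. \<forall>k<N. \<forall>j<N. \<bar>(D ^\<^sub>m q) $$ (i, j) - (D ^\<^sub>m q) $$ (k, j)\<bar> \<le> c * \<sigma> ^ q)"
proof -
  have pow: "0 \<le> (D ^\<^sub>m q) $$ (i, j)" "(\<Sum>j<N. (D ^\<^sub>m q) $$ (i, j)) = 1" if "i < N" "j < N" for q i j
    by (rule stochastic_pow[OF D]; use nonneg sum1 that in auto)+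
  have Dq: "D ^\<^sub>m q \<in> carrier_mat N N" for q using D by simp
  have "\<exists>T>0. \<forall>k<N. 0 < (D ^\<^sub>m T) $$ (k, r)"
    by (rule stochastic_rooted_column_positive[OF D]) (fact nonneg sum1 diag r)+
  then obtain T where T: "T > 0" "\<And>k. k < N \<Longrightarrow> 0 < (D ^\<^sub>m T) $$ (k, r)" by blast
  \<comment> \<open>\<open>1 / 2\<close> keeps \<open>\<gamma> = 1 - \<delta>\<close> positive, for
    instance when a single node carries all the weight.\<close>
  define \<delta> where "\<delta> = Min (insert (1 / 2) ((\<lambda>k. (D ^\<^sub>m T) $$ (k, r)) ` {..<N}))"
  have "\<delta> \<in> insert (1 / 2) ((\<lambda>k. (D ^\<^sub>m T) $$ (k, r)) ` {..<N})"
    unfolding \<delta>_def by (rule Min_in) auto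
  then have \<delta>0: "0 < \<delta>" using T(2) by auto
  have \<delta>1: "\<delta> \<le> 1 / 2" unfolding \<delta>_def by (rule Min_le) auto
  have \<delta>: "\<delta> \<le> (D ^\<^sub>m T) $$ (k, r)" if "k < N" for k
    unfolding \<delta>_def by (rule Min_le) (use that in auto)
  define \<gamma> where "\<gamma> = 1 - \<delta>"
  have \<gamma>: "0 < \<gamma>" "\<gamma> < 1" using \<delta>0 \<delta>1 by (auto simp: \<gamma>_def)
  define \<sigma> where "\<sigma> = root T \<gamma>"
  have \<sigma>: "0 < \<sigma>" "\<sigma> < 1" "\<sigma> ^ T = \<gamma>" using T(1) \<gamma> by (auto simp: \<sigma>_def)
  \<comment> \<open>Spread at most \<open>s\<close> of column \<open>j\<close> of the
    \<open>q\<close>-th power. Leaving the position of the interval open avoids minima and maxima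
    over rows.\<close>
  define S where "S j q s \<longleftrightarrow> (\<exists>lo. \<forall>i<N. lo \<le> (D ^\<^sub>m q) $$ (i, j) \<and> (D ^\<^sub>m q) $$ (i, j) \<le> lo + s)" for j q s
  have S_step: "S j (T + q) (\<gamma> * s)" if S: "S j q s" and j: "j < N" for j q s
  proof -
    from S obtain lo where lo: "\<And>i. i < N \<Longrightarrow> lo \<le> (D ^\<^sub>m q) $$ (i, j)"
      "\<And>i. i < N \<Longrightarrow> (D ^\<^sub>m q) $$ (i, j) \<le> lo + s" unfolding S_def by blast
    have "lo + \<delta> * ((D ^\<^sub>m q) $$ (r, j) - lo) \<le> (D ^\<^sub>m (T + q)) $$ (i, j) \<and>
       (D ^\<^sub>m (T + q)) $$ (i, j) \<le> lo + \<delta> * ((D ^\<^sub>m q) $$ (r, j) - lo) + \<gamma> * s" if i: "i < N" for i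
    proof -
      have eq: "(D ^\<^sub>m (T + q)) $$ (i, j) = (\<Sum>l<N. (D ^\<^sub>m T) $$ (i, l) * (D ^\<^sub>m q) $$ (l, j))"
        unfolding pow_mat_add[OF D] by (rule index_mult_mat_sum[OF Dq Dq i j])
      note range = stochastic_average_range[where p = "\<lambda>l. (D ^\<^sub>m T) $$ (i, l)"
          and v = "\<lambda>l. (D ^\<^sub>m q) $$ (l, j)" and lo = lo and hi = "lo + s", OF _ _ r(1) \<delta>[OF i]]
      have "lo + \<delta> * ((D ^\<^sub>m q) $$ (r, j) - lo) \<le> (\<Sum>l<N. (D ^\<^sub>m T) $$ (i, l) * (D ^\<^sub>m q) $$ (l, j))"
        by (rule range(1)) (use pow i lo in auto)
      moreover have "(\<Sum>l<N. (D ^\<^sub>m T) $$ (i, l) * (D ^\<^sub>m q) $$ (l, j))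
          \<le> (lo + s) - \<delta> * ((lo + s) - (D ^\<^sub>m q) $$ (r, j))"
        by (rule range(2)) (use pow i lo in auto)
      ultimately show ?thesis unfolding eq by (simp add: \<gamma>_def algebra_simps)
    qed
    then show ?thesis unfolding S_def by blast
  qed
  have S_mono: "S j q s'" if "S j q s" "s \<le> s'" for j q s s'
    using that unfolding S_def by (meson add_left_mono order_trans)
  \<comment> \<open>Induction in blocks of \<open>T\<close>. The factor \<open>1 / \<gamma>\<close>
    pays for the incomplete block \<open>q < T\<close>, where
    \<open>\<gamma> \<le> \<sigma> ^ q\<close>.\<close>
  have S_all: "S j q (1 / \<gamma> * \<sigma> ^ q)" if j: "j < N" for j q
  proof (induction q rule: less_induct)
    case (less q)
    show ?case
    proof (cases "q < T")
      case True
      have le1: "(D ^\<^sub>m q) $$ (i, j) \<le> 1" if "i < N" for i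
      proof -
        have "(D ^\<^sub>m q) $$ (i, j) \<le> (\<Sum>j<N. (D ^\<^sub>m q) $$ (i, j))"
          by (rule member_le_sum) (use pow(1)[OF that] j in auto)
        then show ?thesis using pow(2)[OF that j] by simp
      qed
      have "S j q 1" unfolding S_def by (intro exI[of _ 0]) (use pow(1) le1 j in auto)
      moreover have "\<gamma> \<le> \<sigma> ^ q" unfolding \<sigma>(3)[symmetric]
        by (rule power_decreasing) (use True \<sigma> in auto)
      ultimately show ?thesis using \<gamma> by (auto intro!: S_mono[of j q 1] simp: field_simps)
    next
      case False
      then have "q = T + (q - T)" by simp
      moreover have "S j (T + (q - T)) (\<gamma> * (1 / \<gamma> * \<sigma> ^ (q - T)))"
        by (rule S_step[OF less j]) (use T False in auto)
      moreover have "\<sigma> ^ q = \<gamma> * \<sigma> ^ (q - T)"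
        unfolding \<sigma>(3)[symmetric] power_add[symmetric] using False by simp
      ultimately show ?thesis by simp
    qed
  qed
  have "\<bar>(D ^\<^sub>m q) $$ (i, j) - (D ^\<^sub>m q) $$ (k, j)\<bar> \<le> 1 / \<gamma> * \<sigma> ^ q" if "i < N" "k < N" "j < N" for q i k j
    using S_all[OF that(3), of q] that unfolding S_def by (smt (verit))
  then show ?thesis using \<sigma> \<gamma> by (intro exI[of _ "1 / \<gamma>"] exI[of _ \<sigma>]) auto
qed

section \<open>Stabilizing feedback by value iteration\<close>

definition psd_form :: "nat \<Rightarrow> (real vec \<Rightarrow> real vec \<Rightarrow> real) \<Rightarrow> bool" where
  "psd_form n \<beta> \<longleftrightarrow>
     (\<forall>x\<in>carrier_vec n. \<forall>y\<in>carrier_vec n. \<forall>z\<in>carrier_vec n. \<beta> (x + y) z = \<beta> x z + \<beta> y z) \<and>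
     (\<forall>x\<in>carrier_vec n. \<forall>y\<in>carrier_vec n. \<forall>c. \<beta> (c \<cdot>\<^sub>v x) y = c * \<beta> x y) \<and>
     (\<forall>x\<in>carrier_vec n. \<forall>y\<in>carrier_vec n. \<beta> x y = \<beta> y x) \<and>
     (\<forall>x\<in>carrier_vec n. 0 \<le> \<beta> x x)"

lemma psd_formD:
  assumes "psd_form n \<beta>"
  shows "\<And>x y z. x \<in> carrier_vec n \<Longrightarrow> y \<in> carrier_vec n \<Longrightarrow> z \<in> carrier_vec n \<Longrightarrow> \<beta> (x + y) z = \<beta> x z + \<beta> y z"
    and "\<And>x y c. x \<in> carrier_vec n \<Longrightarrow> y \<in> carrier_vec n \<Longrightarrow> \<beta> (c \<cdot>\<^sub>v x) y = c * \<beta> x y"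
    and "\<And>x y. x \<in> carrier_vec n \<Longrightarrow> y \<in> carrier_vec n \<Longrightarrow> \<beta> x y = \<beta> y x"
    and "\<And>x. x \<in> carrier_vec n \<Longrightarrow> 0 \<le> \<beta> x x"
  using assms unfolding psd_form_def by blast+

lemma psd_form_add_smult:
  assumes \<beta>: "psd_form n \<beta>" and p: "p \<in> carrier_vec n" and b: "b \<in> carrier_vec n"
  shows "\<beta> (p + u \<cdot>\<^sub>v b) (p + u \<cdot>\<^sub>v b) = \<beta> p p + 2 * u * \<beta> p b + u\<^sup>2 * \<beta> b b"
proof -
  note [simp] = psd_formD(1,2)[OF \<beta>]
  have ub: "u \<cdot>\<^sub>v b \<in> carrier_vec n" using b by simp
  have right: "\<beta> z (p + u \<cdot>\<^sub>v b) = \<beta> p z + u * \<beta> b z" if z: "z \<in> carrier_vec n" for z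
    using psd_formD(3)[OF \<beta> z, of "p + u \<cdot>\<^sub>v b"] p b ub z by simp
  have "\<beta> (p + u \<cdot>\<^sub>v b) (p + u \<cdot>\<^sub>v b) = \<beta> p p + u * \<beta> b p + (u * \<beta> p b + u * (u * \<beta> b b))"
    using right[of "p + u \<cdot>\<^sub>v b"] psd_formD(3)[OF \<beta>] right p b ub
    by (simp add: algebra_simps)
  also have "\<beta> b p = \<beta> p b" using psd_formD(3)[OF \<beta> b p] .
  finally show ?thesis by (simp add: power2_eq_square algebra_simps)
qed

lemma scalar_prod_psd_form: "psd_form n (\<bullet>)"
  unfolding psd_form_def
  by (auto simp: add_scalar_prod_distrib comm_scalar_prod) (auto simp: scalar_prod_def intro: sum_nonneg)

text \<open>Switching on one coordinate at a time allows induction over the coordinates inside the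
  fixed space \<open>carrier_vec n\<close>.\<close>

definition trunc_vec :: "nat \<Rightarrow> nat \<Rightarrow> real vec \<Rightarrow> real vec" where
  "trunc_vec n k x = vec n (\<lambda>i. if i < k then x $ i else 0)"

lemma trunc_vec_simps:
  shows "trunc_vec n k x \<in> carrier_vec n"
    and "trunc_vec n 0 x = 0\<^sub>v n"
    and "k < n \<Longrightarrow> trunc_vec n (Suc k) x = trunc_vec n k x + x $ k \<cdot>\<^sub>v unit_vec n k"
    and "x \<in> carrier_vec n \<Longrightarrow> trunc_vec n n x = x"
  by (auto simp: trunc_vec_def less_Suc_eq)

lemma linear_functional_eq_sum:
  fixes f :: "real vec \<Rightarrow> real"
  assumes add: "\<And>x y. x \<in> carrier_vec n \<Longrightarrow> y \<in> carrier_vec n \<Longrightarrow> f (x + y) = f x + f y"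
    and smult: "\<And>x c. x \<in> carrier_vec n \<Longrightarrow> f (c \<cdot>\<^sub>v x) = c * f x"
    and x: "x \<in> carrier_vec n"
  shows "f x = (\<Sum>j<n. f (unit_vec n j) * x $ j)"
proof -
  have "0 \<cdot>\<^sub>v 0\<^sub>v n = (0\<^sub>v n :: real vec)" by auto
  then have f0: "f (0\<^sub>v n) = 0" using smult[of "0\<^sub>v n" 0] by simp
  have "k \<le> n \<Longrightarrow> f (trunc_vec n k x) = (\<Sum>j<k. f (unit_vec n j) * x $ j)" for k
  proof (induction k)
    case (Suc k)
    then show ?case
      by (simp add: trunc_vec_simps(1,3) add smult)
  qed (simp add: trunc_vec_simps f0)
  from this[of n] show ?thesis using x by (simp add: trunc_vec_simps(4))
qed

lemma sq_index_le_scalar_prod: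
  fixes x :: "real vec"
  assumes "x \<in> carrier_vec n" "j < n"
  shows "(x $ j)\<^sup>2 \<le> x \<bullet> x"
proof -
  have "x $ j * x $ j \<le> (\<Sum>i\<in>{0..<n}. x $ i * x $ i)"
    by (rule member_le_sum) (use assms in auto)
  then show ?thesis using assms by (simp add: scalar_prod_def power2_eq_square)
qed

text \<open>A form is controlled by its trace. Each added coordinate costs a factor 2 by the
  parallelogram inequality, hence \<open>2 ^ n\<close>. What matters is linearity in the diagonal
  values: smallness of finitely many numbers makes the form small on all vectors.\<close>

lemma psd_form_le_scalar_prod:
  assumes \<beta>: "psd_form n \<beta>" and x: "x \<in> carrier_vec n"
  shows "\<beta> x x \<le> 2 ^ n * (\<Sum>j<n. \<beta> (unit_vec n j) (unit_vec n j)) * (x \<bullet> x)"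
proof -
  note D = psd_formD[OF \<beta>]
  have "0 \<cdot>\<^sub>v 0\<^sub>v n = (0\<^sub>v n :: real vec)" by auto
  then have zero: "\<beta> (0\<^sub>v n) (0\<^sub>v n) = 0" using D(2)[of "0\<^sub>v n" "0\<^sub>v n" 0] by simp
  have parallelogram: "\<beta> (p + q) (p + q) \<le> 2 * \<beta> p p + 2 * \<beta> q q"
    if p: "p \<in> carrier_vec n" and q: "q \<in> carrier_vec n" for p q
    using psd_form_add_smult[OF \<beta> p q, of 1] psd_form_add_smult[OF \<beta> p q, of "-1"]
      D(4)[of "p + (-1) \<cdot>\<^sub>v q"] p q by simp
  have "k \<le> n \<Longrightarrow> \<beta> (trunc_vec n k x) (trunc_vec n k x)
      \<le> 2 ^ k * (\<Sum>j<k. \<beta> (unit_vec n j) (unit_vec n j)) * (x \<bullet> x)" for k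
  proof (induction k)
    case 0
    then show ?case by (simp add: trunc_vec_simps zero)
  next
    case (Suc k)
    let ?e = "unit_vec n k" and ?s = "\<Sum>j<k. \<beta> (unit_vec n j) (unit_vec n j)"
    have e: "?e \<in> carrier_vec n" by simp
    have "\<beta> (x $ k \<cdot>\<^sub>v ?e) (x $ k \<cdot>\<^sub>v ?e) = (x $ k)\<^sup>2 * \<beta> ?e ?e"
      using D(2)[OF e, of "x $ k \<cdot>\<^sub>v ?e"] D(3)[OF e, of "x $ k \<cdot>\<^sub>v ?e"] D(2)[OF e e]
      by (simp add: power2_eq_square)
    also have "\<dots> \<le> (x \<bullet> x) * \<beta> ?e ?e"
      using sq_index_le_scalar_prod[OF x] D(4)[OF e] Suc.prems by (intro mult_right_mono) auto
    finally have 1: "\<beta> (x $ k \<cdot>\<^sub>v ?e) (x $ k \<cdot>\<^sub>v ?e) \<le> (x \<bullet> x) * \<beta> ?e ?e" .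
    have xx: "0 \<le> x \<bullet> x" using psd_formD(4)[OF scalar_prod_psd_form x] .
    have "\<beta> (trunc_vec n (Suc k) x) (trunc_vec n (Suc k) x)
        \<le> 2 * \<beta> (trunc_vec n k x) (trunc_vec n k x) + 2 * \<beta> (x $ k \<cdot>\<^sub>v ?e) (x $ k \<cdot>\<^sub>v ?e)"
      using parallelogram[of "trunc_vec n k x" "x $ k \<cdot>\<^sub>v ?e"] Suc.prems
      by (simp add: trunc_vec_simps(1,3))
    also have "\<dots> \<le> 2 * (2 ^ k * ?s * (x \<bullet> x)) + 2 * ((x \<bullet> x) * \<beta> ?e ?e)"
      using Suc 1 by simp
    also have "2 * ((x \<bullet> x) * \<beta> ?e ?e) \<le> 2 ^ Suc k * ((x \<bullet> x) * \<beta> ?e ?e)"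
      using xx D(4)[OF e] by (intro mult_right_mono) auto
    finally show ?case by (simp add: algebra_simps)
  qed
  from this[of n] show ?thesis using x by (simp add: trunc_vec_simps(4))
qed

text \<open>The Bellman operator for the stage cost \<open>x \<bullet> x + u\<^sup>2\<close>,
  polarized to a bilinear form. Since the input is scalar, the matrix inverse of the Riccati formula
  is a division by \<open>1 + \<beta> b b\<close>.\<close>

definition riccati_step :: "real mat \<Rightarrow> real vec \<Rightarrow> (real vec \<Rightarrow> real vec \<Rightarrow> real) \<Rightarrow> real vec \<Rightarrow> real vec \<Rightarrow> real" where
  "riccati_step A b \<beta> x y =
     x \<bullet> y + \<beta> (A *\<^sub>v x) (A *\<^sub>v y) - \<beta> (A *\<^sub>v x) b * \<beta> (A *\<^sub>v y) b / (1 + \<beta> b b)"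

definition riccati_gain :: "real mat \<Rightarrow> real vec \<Rightarrow> (real vec \<Rightarrow> real vec \<Rightarrow> real) \<Rightarrow> real vec \<Rightarrow> real" where
  "riccati_gain A b \<beta> x = - \<beta> (A *\<^sub>v x) b / (1 + \<beta> b b)"

text \<open>The remainder is a nonnegative multiple of the squared distance of \<open>u\<close> from
  the gain. So the step is a lower bound for every input, and the gain attains it.\<close>

lemma riccati_complete_square:
  assumes A: "A \<in> carrier_mat n n" and b: "b \<in> carrier_vec n" and \<beta>: "psd_form n \<beta>"
    and x: "x \<in> carrier_vec n"
  shows "x \<bullet> x + u\<^sup>2 + \<beta> (A *\<^sub>v x + u \<cdot>\<^sub>v b) (A *\<^sub>v x + u \<cdot>\<^sub>v b) =
    riccati_step A b \<beta> x x + (1 + \<beta> b b) * (u - riccati_gain A b \<beta> x)\<^sup>2"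
proof -
  have Ax: "A *\<^sub>v x \<in> carrier_vec n" using A x by simp
  define g h where "g = 1 + \<beta> b b" and "h = \<beta> (A *\<^sub>v x) b"
  have g: "g > 0" using psd_formD(4)[OF \<beta> b] by (simp add: g_def)
  have "g * (u + h / g)\<^sup>2 = u\<^sup>2 * g + 2 * u * h + h * h / g"
    using g by (simp add: power2_eq_square field_simps)
  then show ?thesis
    unfolding psd_form_add_smult[OF \<beta> Ax b] riccati_step_def riccati_gain_def
    by (simp add: g_def[symmetric] h_def[symmetric]) (simp add: g_def algebra_simps)
qed

lemma psd_form_riccati_step:
  assumes A: "A \<in> carrier_mat n n" and b: "b \<in> carrier_vec n" and \<beta>: "psd_form n \<beta>"
  shows "psd_form n (riccati_step A b \<beta>)"
proof -
  note D = psd_formD[OF \<beta>]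
  have Ax: "A *\<^sub>v x \<in> carrier_vec n" if "x \<in> carrier_vec n" for x using A that by simp
  show ?thesis unfolding psd_form_def
  proof (intro conjI ballI allI)
    fix x y z :: "real vec" and c :: real
    assume x: "x \<in> carrier_vec n" and y: "y \<in> carrier_vec n"
    show "riccati_step A b \<beta> x y = riccati_step A b \<beta> y x"
      unfolding riccati_step_def using D(3)[OF Ax[OF x] Ax[OF y]] comm_scalar_prod[OF x y]
      by (simp add: mult.commute)
    show "riccati_step A b \<beta> (c \<cdot>\<^sub>v x) y = c * riccati_step A b \<beta> x y"
      using x y b A Ax by (simp add: riccati_step_def mult_mat_vec[OF A x] D(2) algebra_simps)
    assume z: "z \<in> carrier_vec n"
    show "riccati_step A b \<beta> (x + y) z = riccati_step A b \<beta> x z + riccati_step A b \<beta> y z"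
      using x y z b Ax
      by (simp add: riccati_step_def mult_add_distrib_mat_vec[OF A x y] D(1) add_scalar_prod_distrib[OF x y z]
          add_divide_distrib algebra_simps)
  next
    fix x :: "real vec" assume x: "x \<in> carrier_vec n"
    \<comment> \<open>The subtraction in the definition hides nonnegativity; at the minimizing input
      the value is a sum of nonnegative terms.\<close>
    define u where "u = riccati_gain A b \<beta> x"
    have "0 \<le> x \<bullet> x" using psd_formD(4)[OF scalar_prod_psd_form x] .
    moreover have "0 \<le> \<beta> (A *\<^sub>v x + u \<cdot>\<^sub>v b) (A *\<^sub>v x + u \<cdot>\<^sub>v b)"
      using Ax[OF x] b by (intro D(4)) simp
    moreover have "riccati_step A b \<beta> x x = x \<bullet> x + u\<^sup>2 + \<beta> (A *\<^sub>v x + u \<cdot>\<^sub>v b) (A *\<^sub>v x + u \<cdot>\<^sub>v b)"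
      using riccati_complete_square[OF A b \<beta> x, of u] by (simp add: u_def)
    ultimately show "0 \<le> riccati_step A b \<beta> x x"
      using zero_le_power2[of u] by linarith
  qed
qed

lemma riccati_step_le:
  assumes A: "A \<in> carrier_mat n n" and b: "b \<in> carrier_vec n" and \<beta>: "psd_form n \<beta>"
    and x: "x \<in> carrier_vec n"
  shows "riccati_step A b \<beta> x x \<le> x \<bullet> x + u\<^sup>2 + \<beta> (A *\<^sub>v x + u \<cdot>\<^sub>v b) (A *\<^sub>v x + u \<cdot>\<^sub>v b)"
  using riccati_complete_square[OF assms, of u] psd_formD(4)[OF \<beta> b]
  by (smt (verit) mult_nonneg_nonneg zero_le_power2)

lemma riccati_step_gain:
  assumes A: "A \<in> carrier_mat n n" and b: "b \<in> carrier_vec n" and \<beta>: "psd_form n \<beta>"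
    and x: "x \<in> carrier_vec n" and u: "u = riccati_gain A b \<beta> x"
  shows "riccati_step A b \<beta> x x = x \<bullet> x + u\<^sup>2 + \<beta> (A *\<^sub>v x + u \<cdot>\<^sub>v b) (A *\<^sub>v x + u \<cdot>\<^sub>v b)"
  using riccati_complete_square[OF A b \<beta> x, of u] u by simp

definition riccati_iter :: "real mat \<Rightarrow> real vec \<Rightarrow> nat \<Rightarrow> real vec \<Rightarrow> real vec \<Rightarrow> real" where
  "riccati_iter A b k = (riccati_step A b ^^ k) (\<lambda>x y. 0)"

lemma riccati_iter_simps:
  shows "riccati_iter A b 0 x y = 0"
    and "riccati_iter A b (Suc k) = riccati_step A b (riccati_iter A b k)"
  by (simp_all add: riccati_iter_def)

lemma psd_form_riccati_iter:
  assumes "A \<in> carrier_mat n n" and "b \<in> carrier_vec n"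
  shows "psd_form n (riccati_iter A b k)"
proof (induction k)
  case 0
  then show ?case by (simp add: psd_form_def riccati_iter_simps)
qed (simp add: riccati_iter_simps psd_form_riccati_step[OF assms])

text \<open>The input that is optimal for the longer horizon is merely admissible for the shorter
  one, and induction compares the costs that remain after it.\<close>

lemma riccati_iter_mono:
  assumes A: "A \<in> carrier_mat n n" and b: "b \<in> carrier_vec n" and x: "x \<in> carrier_vec n"
  shows "riccati_iter A b k x x \<le> riccati_iter A b (Suc k) x x"
  using x
proof (induction k arbitrary: x)
  case 0
  then show ?case using psd_formD(4)[OF psd_form_riccati_iter[OF A b]] by (simp add: riccati_iter_simps(1))
next
  case (Suc k)
  define u where "u = riccati_gain A b (riccati_iter A b (Suc k)) x"
  have y: "A *\<^sub>v x + u \<cdot>\<^sub>v b \<in> carrier_vec n" using A b Suc.prems by simp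
  show ?case
    using riccati_step_gain[OF A b psd_form_riccati_iter[OF A b] Suc.prems u_def] Suc.IH[OF y]
      riccati_step_le[OF A b psd_form_riccati_iter[OF A b] Suc.prems, of k u]
    by (simp add: riccati_iter_simps(2))
qed

text \<open>Dynamic programming: an admissible trajectory costs at least the value. The terminal
  horizon \<open>l\<close> stays general because following the trajectory one step further consumes
  one iteration at its end.\<close>

lemma riccati_iter_le_cost:
  assumes A: "A \<in> carrier_mat n n" and b: "b \<in> carrier_vec n"
    and x: "\<And>t. x t \<in> carrier_vec n" "\<And>t. x (Suc t) = A *\<^sub>v x t + u t \<cdot>\<^sub>v b"
  shows "riccati_iter A b (j + l) (x 0) (x 0) \<le> (\<Sum>t<j. x t \<bullet> x t + (u t)\<^sup>2) + riccati_iter A b l (x j) (x j)"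
proof (induction j arbitrary: l)
  case (Suc j)
  have "riccati_iter A b (Suc l) (x j) (x j) \<le> x j \<bullet> x j + (u j)\<^sup>2 + riccati_iter A b l (x (Suc j)) (x (Suc j))"
    using riccati_step_le[OF A b psd_form_riccati_iter[OF A b] x(1)] by (simp add: riccati_iter_simps(2) x(2))
  then show ?case using Suc[of "Suc l"] by simp
qed simp

text \<open>Value iteration for the quadratic cost converges because a control with finite cost exists; an
  iterate close enough to its successor already yields a Lyapunov function for its own gain.\<close>

lemma stabilizing_gain_exists:
  assumes A: "A \<in> carrier_mat n n" and b: "b \<in> carrier_vec n" and T: "T > 0" and c: "c \<ge> 0"
    and ctrl: "\<And>x0. x0 \<in> carrier_vec n \<Longrightarrow> \<exists>x u. x 0 = x0 \<and> (\<forall>t. x t \<in> carrier_vec n) \<and>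
      (\<forall>t. x (Suc t) = A *\<^sub>v x t + u t \<cdot>\<^sub>v b) \<and> x T \<bullet> x T \<le> (x0 \<bullet> x0) / 2 \<and>
      (\<Sum>t<T. x t \<bullet> x t + (u t)\<^sup>2) \<le> c * (x0 \<bullet> x0)"
  shows "\<exists>\<beta>. psd_form n \<beta> \<and> (\<forall>x\<in>carrier_vec n. \<forall>u. u = riccati_gain A b \<beta> x \<longrightarrow>
     \<beta> (A *\<^sub>v x + u \<cdot>\<^sub>v b) (A *\<^sub>v x + u \<cdot>\<^sub>v b) \<le> \<beta> x x - (x \<bullet> x) / 2)"
proof -
  let ?V = "riccati_iter A b"
  note psd = psd_form_riccati_iter[OF A b]
  \<comment> \<open>The constant solves \<open>2 * c = c + 2 * c / 2\<close>: the first
    \<open>T\<close> steps cost at most \<open>c\<close> and halve \<open>x \<bullet> x\<close>,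
    after which the control is restarted for the remaining horizon.\<close>
  have bound: "?V k x x \<le> 2 * c * (x \<bullet> x)" if "x \<in> carrier_vec n" for k x
    using that
  proof (induction k arbitrary: x rule: less_induct)
    case (less k)
    from ctrl[OF less.prems] obtain z u where z: "z 0 = x" "\<And>t. z t \<in> carrier_vec n"
      "\<And>t. z (Suc t) = A *\<^sub>v z t + u t \<cdot>\<^sub>v b" "z T \<bullet> z T \<le> (x \<bullet> x) / 2"
      "(\<Sum>t<T. z t \<bullet> z t + (u t)\<^sup>2) \<le> c * (x \<bullet> x)" by blast
    have xx: "0 \<le> y \<bullet> y" if "y \<in> carrier_vec n" for y :: "real vec"
      using psd_formD(4)[OF scalar_prod_psd_form that] .
    show ?case
    proof (cases "k < T")
      case True
      have "?V k x x \<le> (\<Sum>t<k. z t \<bullet> z t + (u t)\<^sup>2)"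
        using riccati_iter_le_cost[where x = z and u = u, OF A b z(2,3), of k 0] by (simp add: riccati_iter_simps(1) z(1))
      also have "\<dots> \<le> (\<Sum>t<T. z t \<bullet> z t + (u t)\<^sup>2)"
        by (rule sum_mono2) (use True xx[OF z(2)] in auto)
      also have "\<dots> \<le> c * (x \<bullet> x)" by (fact z(5))
      also have "\<dots> \<le> 2 * c * (x \<bullet> x)" using c xx[OF less.prems] by simp
      finally show ?thesis .
    next
      case False
      then have k: "k = T + (k - T)" by simp
      have "?V (k - T) (z T) (z T) \<le> 2 * c * (z T \<bullet> z T)"
        by (rule less.IH) (use T False z in auto)
      also have "\<dots> \<le> 2 * c * ((x \<bullet> x) / 2)" by (rule mult_left_mono) (use z c in auto)
      finally have "?V (k - T) (z T) (z T) \<le> c * (x \<bullet> x)" by simp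
      moreover have "?V k x x \<le> (\<Sum>t<T. z t \<bullet> z t + (u t)\<^sup>2) + ?V (k - T) (z T) (z T)"
        using riccati_iter_le_cost[where x = z and u = u, OF A b z(2,3), of T "k - T"] k z(1) by simp
      ultimately show ?thesis using z(5) by simp
    qed
  qed
  \<comment> \<open>The traces increase and are bounded, so they converge. No limit form is formed;
    one \<open>k\<close> with two consecutive traces close together is enough.\<close>
  define s where "s k = (\<Sum>j<n. ?V k (unit_vec n j) (unit_vec n j))" for k
  have "incseq s" unfolding s_def by (intro incseq_SucI sum_mono riccati_iter_mono[OF A b]) simp
  moreover have "\<forall>k. s k \<le> (\<Sum>j<n. 2 * c * (unit_vec n j \<bullet> unit_vec n j))"
    unfolding s_def by (intro allI sum_mono bound) simp
  ultimately obtain L where L: "s \<longlonglongrightarrow> L" by (rule incseq_convergent)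
  have "(\<lambda>k. s (Suc k) - s k) \<longlonglongrightarrow> L - L" by (intro tendsto_diff LIMSEQ_Suc L)
  then have "\<forall>\<^sub>F k in sequentially. s (Suc k) - s k < 1 / (2 * 2 ^ n)"
    by (intro order_tendstoD(2)[where y = 0]) auto
  then obtain k where k: "s (Suc k) - s k < 1 / (2 * 2 ^ n)"
    unfolding eventually_sequentially by blast
  \<comment> \<open>Monotonicity of the iterates makes their difference semidefinite, so its trace
    bounds it; the threshold \<open>1 / (2 * 2 ^ n)\<close> cancels the \<open>2 ^ n\<close> of that
    bound.\<close>
  define \<Delta> where "\<Delta> x y = ?V (Suc k) x y - ?V k x y" for x y
  have \<Delta>: "psd_form n \<Delta>"
    unfolding psd_form_def \<Delta>_def
    using psd_formD[OF psd] riccati_iter_mono[OF A b]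
    by (simp add: algebra_simps)
  have decrease: "?V (Suc k) x x - ?V k x x \<le> (x \<bullet> x) / 2" if x: "x \<in> carrier_vec n" for x
  proof -
    have "\<Delta> x x \<le> 2 ^ n * (s (Suc k) - s k) * (x \<bullet> x)"
      using psd_form_le_scalar_prod[OF \<Delta> x] by (simp add: \<Delta>_def s_def sum_subtractf)
    also have "\<dots> \<le> 1 / 2 * (x \<bullet> x)"
      using k psd_formD(4)[OF scalar_prod_psd_form x] by (intro mult_right_mono) (auto simp: field_simps)
    finally show ?thesis by (simp add: \<Delta>_def)
  qed
  show ?thesis
  proof (intro exI[of _ "?V k"] conjI ballI allI impI psd)
    fix x u assume x: "x \<in> carrier_vec n" and u: "u = riccati_gain A b (?V k) x"
    show "?V k (A *\<^sub>v x + u \<cdot>\<^sub>v b) (A *\<^sub>v x + u \<cdot>\<^sub>v b) \<le> ?V k x x - (x \<bullet> x) / 2"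
      \<comment> \<open>The next iterate is the stage cost plus the current iterate at the successor
        state. It exceeds the current iterate at \<open>x\<close> by at most half of
        \<open>x \<bullet> x\<close>, so half of the state cost is left as decrease.\<close>
      using riccati_step_gain[OF A b psd x u] decrease[OF x] by (simp add: riccati_iter_simps(2))
        (smt (verit) zero_le_power2 field_sum_of_halves)
  qed
qed

text \<open>Telescoping the decrease along an orbit makes the sum of \<open>x \<bullet> x\<close>
  finite, so the orbit tends to 0 without any lower bound on \<beta>; orbits of unit vectors are the
  columns of the powers.\<close>

lemma schur_stable_of_lyapunov:
  assumes M: "M \<in> carrier_mat n n" and \<beta>: "psd_form n \<beta>"
    and dec: "\<And>x. x \<in> carrier_vec n \<Longrightarrow> \<beta> (M *\<^sub>v x) (M *\<^sub>v x) \<le> \<beta> x x - (x \<bullet> x) / 2"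
  shows "schur_stable M"
proof (rule schur_stable_of_pow_tendsto_0[OF M])
  fix i j assume ij: "i < n" "j < n"
  define x where "x q = M ^\<^sub>m q *\<^sub>v unit_vec n j" for q
  have x: "x q \<in> carrier_vec n" for q using mult_mat_vec_carrier[OF pow_carrier_mat[OF M]] by (simp add: x_def)
  have xS: "x (Suc q) = M *\<^sub>v x q" for q
    unfolding x_def pow_mat_Suc_left[OF M] using M by (intro assoc_mult_mat_vec) auto
  have xx: "0 \<le> x q \<bullet> x q" for q using psd_formD(4)[OF scalar_prod_psd_form x] .
  have partial: "(\<Sum>q<m. (x q \<bullet> x q) / 2) \<le> \<beta> (x 0) (x 0) - \<beta> (x m) (x m)" for m
  proof (induction m)
    case (Suc m)
    then show ?case using dec[OF x, of m] by (simp add: xS)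
  qed simp
  have "summable (\<lambda>q. (x q \<bullet> x q) / 2)"
  proof (rule summableI_nonneg_bounded)
    show "0 \<le> (x q \<bullet> x q) / 2" for q using xx by simp
    show "(\<Sum>q<m. (x q \<bullet> x q) / 2) \<le> \<beta> (x 0) (x 0)" for m
      using partial[of m] psd_formD(4)[OF \<beta> x[of m]] by linarith
  qed
  then have "(\<lambda>q. 2 * ((x q \<bullet> x q) / 2)) \<longlonglongrightarrow> 2 * 0"
    by (intro tendsto_mult tendsto_const summable_LIMSEQ_zero)
  then have lim: "(\<lambda>q. x q \<bullet> x q) \<longlonglongrightarrow> 0" by simp
  have entry: "(M ^\<^sub>m q) $$ (i, j) = x q $ i" for q
    using M ij by (simp add: x_def)
  have "(\<lambda>q. (x q $ i)\<^sup>2) \<longlonglongrightarrow> 0"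
    by (rule tendsto_sandwich[OF _ _ tendsto_const lim])
      (use sq_index_le_scalar_prod[OF x] ij in auto)
  then show "(\<lambda>q. (M ^\<^sub>m q) $$ (i, j)) \<longlonglongrightarrow> 0"
    unfolding entry by (simp add: tendsto_null_power power_tendsto_0_iff)
qed

lemma psd_form_mat:
  assumes K: "(K :: real mat) \<in> carrier_mat k n"
  shows "psd_form n (\<lambda>x y. (K *\<^sub>v x) \<bullet> (K *\<^sub>v y))"
proof -
  note D = psd_formD[OF scalar_prod_psd_form[of k]]
  have Kx: "K *\<^sub>v x \<in> carrier_vec k" if "x \<in> carrier_vec n" for x using K that by simp
  show ?thesis unfolding psd_form_def
    using Kx D by (auto simp: mult_add_distrib_mat_vec[OF K] mult_mat_vec[OF K] D)
qed

lemma psd_form_add: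
  "psd_form n \<beta> \<Longrightarrow> psd_form n \<gamma> \<Longrightarrow> psd_form n (\<lambda>x y. \<beta> x y + \<gamma> x y)"
  unfolding psd_form_def by (auto simp: algebra_simps)

lemma mult_mat_vec_single_col:
  fixes B :: "real mat"
  assumes "B \<in> carrier_mat n 1" "u \<in> carrier_vec 1"
  shows "B *\<^sub>v u = u $ 0 \<cdot>\<^sub>v col B 0"
  using assms by (intro eq_vecI) (auto simp: scalar_prod_def)

lemma stabilizable_of_finite_cost:
  assumes A: "A \<in> carrier_mat n n" and B: "B \<in> carrier_mat n 1" and T: "T > 0" and c: "c \<ge> 0"
    and ctrl: "\<And>x0. x0 \<in> carrier_vec n \<Longrightarrow> \<exists>x u. x 0 = x0 \<and> (\<forall>t. x t \<in> carrier_vec n) \<and>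
      (\<forall>t. x (Suc t) = A *\<^sub>v x t + u t \<cdot>\<^sub>v col B 0) \<and> x T \<bullet> x T \<le> (x0 \<bullet> x0) / 2 \<and>
      (\<Sum>t<T. x t \<bullet> x t + (u t)\<^sup>2) \<le> c * (x0 \<bullet> x0)"
  shows "stabilizable A B"
proof -
  let ?b = "col B 0"
  have b: "?b \<in> carrier_vec n" using B by auto
  obtain \<beta> where \<beta>: "psd_form n \<beta>" and dec: "\<And>x u. x \<in> carrier_vec n \<Longrightarrow> u = riccati_gain A ?b \<beta> x \<Longrightarrow>
     \<beta> (A *\<^sub>v x + u \<cdot>\<^sub>v ?b) (A *\<^sub>v x + u \<cdot>\<^sub>v ?b) \<le> \<beta> x x - (x \<bullet> x) / 2"
    using stabilizing_gain_exists[OF A b T c ctrl] by blast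
  \<comment> \<open>The gain is a linear functional of the state, so its values on the unit vectors
    form the feedback row.\<close>
  define F where "F = mat 1 n (\<lambda>(i, j). riccati_gain A ?b \<beta> (unit_vec n j))"
  have F: "F \<in> carrier_mat 1 n" by (simp add: F_def)
  have gain: "(F *\<^sub>v x) $ 0 = riccati_gain A ?b \<beta> x" if x: "x \<in> carrier_vec n" for x
  proof -
    note D = psd_formD[OF \<beta>]
    have Ax: "A *\<^sub>v x \<in> carrier_vec n" if "x \<in> carrier_vec n" for x using A that by simp
    have "riccati_gain A ?b \<beta> x = (\<Sum>j<n. riccati_gain A ?b \<beta> (unit_vec n j) * x $ j)"
    proof (rule linear_functional_eq_sum[OF _ _ x])
      fix x y :: "real vec" assume "x \<in> carrier_vec n" "y \<in> carrier_vec n"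
      then show "riccati_gain A ?b \<beta> (x + y) = riccati_gain A ?b \<beta> x + riccati_gain A ?b \<beta> y"
        using Ax b by (simp add: riccati_gain_def mult_add_distrib_mat_vec[OF A] D(1) add_divide_distrib
            diff_divide_distrib)
    next
      fix x :: "real vec" and c :: real assume "x \<in> carrier_vec n"
      then show "riccati_gain A ?b \<beta> (c \<cdot>\<^sub>v x) = c * riccati_gain A ?b \<beta> x"
        using Ax b by (simp add: riccati_gain_def mult_mat_vec[OF A] D(2))
    qed
    then show ?thesis using x by (simp add: F_def scalar_prod_def lessThan_atLeast0)
  qed
  have "schur_stable (A + B * F)"
  proof (rule schur_stable_of_lyapunov[OF _ \<beta>])
    show "A + B * F \<in> carrier_mat n n" using A B F by simp
    fix x :: "real vec" assume x: "x \<in> carrier_vec n"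
    have Fx: "F *\<^sub>v x \<in> carrier_vec 1" using F x by simp
    have "(A + B * F) *\<^sub>v x = A *\<^sub>v x + B *\<^sub>v (F *\<^sub>v x)"
      using A B F x by (simp add: add_mult_distrib_mat_vec[of _ n n])
    also have "\<dots> = A *\<^sub>v x + riccati_gain A ?b \<beta> x \<cdot>\<^sub>v ?b"
      using mult_mat_vec_single_col[OF B Fx] gain[OF x] by simp
    finally show "\<beta> ((A + B * F) *\<^sub>v x) ((A + B * F) *\<^sub>v x) \<le> \<beta> x x - (x \<bullet> x) / 2"
      using dec[OF x refl] by simp
  qed
  then show ?thesis unfolding stabilizable_def using A B F by (intro bexI[of _ F]) auto
qed

section \<open>Feedback from a decaying block of a closed loop\<close>

lemma sum_lessThan_add:
  fixes f :: "nat \<Rightarrow> 'a :: comm_monoid_add"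
  shows "(\<Sum>l<n + m. f l) = (\<Sum>l<n. f l) + (\<Sum>l<m. f (n + l))"
  by (induction m) (simp_all add: add.assoc)

text \<open>The first \<open>n\<close> columns of the powers of \<open>M\<close> are closed-loop
  trajectories: the upper part \<open>X\<close> is a state of \<open>(A, B)\<close> under the input
  \<open>U = G X + F Y\<close>, while \<open>Y\<close> belongs to a dynamic compensator whose decay
  is not assumed. Hence the finite time \<open>T\<close>: by then \<open>X\<close> has lost half of
  its energy, and \<open>U\<close>, whatever its size, has caused a finite cost.\<close>

lemma stabilizable_of_block_decay:
  fixes A :: "real mat"
  assumes A: "A \<in> carrier_mat n n" and B: "B \<in> carrier_mat n 1"
    and G: "G \<in> carrier_mat 1 n" and F: "F \<in> carrier_mat 1 m"
    and H: "H \<in> carrier_mat m n" and J: "J \<in> carrier_mat m m"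
    and M: "M = four_block_mat (A + B * G) (B * F) H J"
    and lim: "\<And>i j. i < n \<Longrightarrow> j < n \<Longrightarrow> (\<lambda>t. (M ^\<^sub>m t) $$ (i, j)) \<longlonglongrightarrow> 0"
  shows "stabilizable A B"
proof -
  have AG: "A + B * G \<in> carrier_mat n n" and BF: "B * F \<in> carrier_mat n m"
    using A B G F by auto
  have Mc: "M \<in> carrier_mat (n + m) (n + m)" unfolding M by (rule four_block_carrier_mat[OF AG J])
  have top: "M $$ (i, l) = (A + B * G) $$ (i, l)" "k < m \<Longrightarrow> M $$ (i, n + k) = (B * F) $$ (i, k)"
    if "i < n" "l < n" for i l k
    using that carrier_matD[OF AG] carrier_matD[OF BF] carrier_matD[OF J] unfolding M
    by (simp_all del: index_add_mat index_mult_mat)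
  define X where "X t = mat n n (\<lambda>(i, j). (M ^\<^sub>m t) $$ (i, j))" for t
  define Y where "Y t = mat m n (\<lambda>(i, j). (M ^\<^sub>m t) $$ (n + i, j))" for t
  define U where "U t = G * X t + F * Y t" for t
  have X: "X t \<in> carrier_mat n n" and Y: "Y t \<in> carrier_mat m n" for t by (auto simp: X_def Y_def)
  have U: "U t \<in> carrier_mat 1 n" for t using G F X Y by (auto simp: U_def)
  have X0: "X 0 = 1\<^sub>m n" using Mc by (intro eq_matI) (auto simp: X_def)
  have XS: "X (Suc t) = A * X t + B * U t" for t
  proof -
    have "X (Suc t) = (A + B * G) * X t + B * F * Y t"
    proof (rule eq_matI)
      fix i j assume "i < dim_row ((A + B * G) * X t + B * F * Y t)" "j < dim_col ((A + B * G) * X t + B * F * Y t)"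
      then have ij: "i < n" "j < n" using AG BF X[of t] Y[of t] by auto
      have "X (Suc t) $$ (i, j) = (M * M ^\<^sub>m t) $$ (i, j)"
        using ij pow_mat_Suc_left[OF Mc, of t] by (simp add: X_def)
      also have "\<dots> = (\<Sum>l<n + m. M $$ (i, l) * (M ^\<^sub>m t) $$ (l, j))"
        by (rule index_mult_mat_sum[OF Mc pow_carrier_mat[OF Mc]]) (use ij in auto)
      also have "\<dots> = (\<Sum>l<n. M $$ (i, l) * (M ^\<^sub>m t) $$ (l, j)) + (\<Sum>l<m. M $$ (i, n + l) * (M ^\<^sub>m t) $$ (n + l, j))"
        by (rule sum_lessThan_add)
      also have "\<dots> = (\<Sum>l<n. (A + B * G) $$ (i, l) * X t $$ (l, j)) + (\<Sum>l<m. (B * F) $$ (i, l) * Y t $$ (l, j))"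
        using ij top by (intro arg_cong2[of _ _ _ _ "(+)"] sum.cong) (auto simp: X_def Y_def)
      also have "\<dots> = ((A + B * G) * X t + B * F * Y t) $$ (i, j)"
        unfolding index_mult_mat_sum[OF AG X ij, symmetric] index_mult_mat_sum[OF BF Y ij, symmetric]
        by (rule index_add_mat(1)[symmetric]) (use ij B F Y[of t] in auto)
      finally show "X (Suc t) $$ (i, j) = ((A + B * G) * X t + B * F * Y t) $$ (i, j)" .
    qed (use B X[of "Suc t"] Y[of t] in auto)
    also have "(A + B * G) * X t = A * X t + B * (G * X t)"
      using A B G X[of t] by (simp add: add_mult_distrib_mat[of _ n n] assoc_mult_mat[of B n 1 G n])
    also have "B * F * Y t = B * (F * Y t)" using B F Y by (intro assoc_mult_mat) auto
    also have "A * X t + B * (G * X t) + B * (F * Y t) = A * X t + (B * (G * X t) + B * (F * Y t))"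
      using A B G F X[of t] Y[of t] by (intro assoc_add_mat) auto
    also have "B * (G * X t) + B * (F * Y t) = B * U t"
      unfolding U_def using B G F X[of t] Y[of t] by (intro mult_add_distrib_mat[symmetric]) auto
    finally show ?thesis .
  qed
  let ?e = "unit_vec n :: nat \<Rightarrow> real vec"
  \<comment> \<open>Energy and stage cost as forms in the initial state: the trace bound turns decay
    of single entries into estimates uniform in \<open>x0\<close>.\<close>
  define \<beta> where "\<beta> t x y = (X t *\<^sub>v x) \<bullet> (X t *\<^sub>v y)" for t x y
  define \<gamma> where "\<gamma> t x y = \<beta> t x y + (U t *\<^sub>v x) \<bullet> (U t *\<^sub>v y)" for t x y
  have \<beta>: "psd_form n (\<beta> t)" for t unfolding \<beta>_def using psd_form_mat[OF X] .
  have \<gamma>: "psd_form n (\<gamma> t)" for t unfolding \<gamma>_def by (rule psd_form_add[OF \<beta> psd_form_mat[OF U]])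
  have \<beta>_e: "\<beta> t (?e j) (?e j) = (\<Sum>i\<in>{0..<n}. (M ^\<^sub>m t) $$ (i, j) * (M ^\<^sub>m t) $$ (i, j))" if "j < n" for t j
  proof -
    have "(X t *\<^sub>v ?e j) $ i = (M ^\<^sub>m t) $$ (i, j)" if "i < n" for i
      using that \<open>j < n\<close> by (simp add: X_def)
    then show ?thesis
      unfolding \<beta>_def scalar_prod_def[of "X t *\<^sub>v ?e j"] using X[of t] by (intro sum.cong) auto
  qed
  have "(\<lambda>t. \<beta> t (?e j) (?e j)) \<longlonglongrightarrow> (\<Sum>i\<in>{0..<n}. 0 * 0)" if j: "j < n" for j
    unfolding \<beta>_e[OF j] by (intro tendsto_sum tendsto_mult lim) (use j in auto)
  then have "(\<lambda>t. 2 ^ n * (\<Sum>j<n. \<beta> t (?e j) (?e j))) \<longlonglongrightarrow> 2 ^ n * (\<Sum>j<n. (\<Sum>i\<in>{0..<n}. 0 * 0))"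
    by (intro tendsto_sum tendsto_mult tendsto_const) auto
  then have "\<forall>\<^sub>F t in sequentially. 2 ^ n * (\<Sum>j<n. \<beta> t (?e j) (?e j)) < 1 / 2"
    by (intro order_tendstoD(2)[where y = 0]) auto
  then obtain T0 where T0: "\<And>t. t \<ge> T0 \<Longrightarrow> 2 ^ n * (\<Sum>j<n. \<beta> t (?e j) (?e j)) < 1 / 2"
    unfolding eventually_sequentially by blast
  define T where "T = Suc T0"
  define c where "c = (\<Sum>t<T. 2 ^ n * (\<Sum>j<n. \<gamma> t (?e j) (?e j)))"
  show ?thesis
  proof (rule stabilizable_of_finite_cost[OF A B, of T c])
    show "T > 0" by (simp add: T_def)
    show "c \<ge> 0" unfolding c_def
      by (intro sum_nonneg mult_nonneg_nonneg psd_formD(4)[OF \<gamma>]) auto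
    fix x0 :: "real vec" assume x0: "x0 \<in> carrier_vec n"
    define x where "x t = X t *\<^sub>v x0" for t
    define u where "u t = (U t *\<^sub>v x0) $ 0" for t
    have xx: "0 \<le> x0 \<bullet> x0" using psd_formD(4)[OF scalar_prod_psd_form x0] .
    have Ux: "U t *\<^sub>v x0 \<in> carrier_vec 1" for t by (rule mult_mat_vec_carrier[OF U x0])
    have cost: "x t \<bullet> x t + (u t)\<^sup>2 = \<gamma> t x0 x0" for t
    proof -
      have "v \<bullet> v = (v $ 0)\<^sup>2" if "v \<in> carrier_vec 1" for v :: "real vec"
        using that by (auto simp: scalar_prod_def power2_eq_square)
      from this[OF Ux] show ?thesis by (simp only: \<gamma>_def \<beta>_def x_def u_def)
    qed
    show "\<exists>x u. x 0 = x0 \<and> (\<forall>t. x t \<in> carrier_vec n) \<and>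
      (\<forall>t. x (Suc t) = A *\<^sub>v x t + u t \<cdot>\<^sub>v col B 0) \<and> x T \<bullet> x T \<le> (x0 \<bullet> x0) / 2 \<and>
      (\<Sum>t<T. x t \<bullet> x t + (u t)\<^sup>2) \<le> c * (x0 \<bullet> x0)"
    proof (rule exI[of _ x], rule exI[of _ u], intro conjI allI)
      show "x 0 = x0" using x0 by (simp add: x_def X0)
      show "x t \<in> carrier_vec n" for t unfolding x_def by (rule mult_mat_vec_carrier[OF X x0])
      show "x (Suc t) = A *\<^sub>v x t + u t \<cdot>\<^sub>v col B 0" for t
      proof -
        have "x (Suc t) = A * X t *\<^sub>v x0 + B * U t *\<^sub>v x0"
          unfolding x_def XS using A B X[of t] U[of t] x0 by (intro add_mult_distrib_mat_vec) auto
        also have "\<dots> = A *\<^sub>v x t + B *\<^sub>v (U t *\<^sub>v x0)"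
          using assoc_mult_mat_vec[OF A X x0] assoc_mult_mat_vec[OF B U x0] by (simp add: x_def)
        also have "B *\<^sub>v (U t *\<^sub>v x0) = u t \<cdot>\<^sub>v col B 0"
          using mult_mat_vec_single_col[OF B Ux] by (simp add: u_def)
        finally show ?thesis .
      qed
      have "x T \<bullet> x T \<le> 2 ^ n * (\<Sum>j<n. \<beta> T (?e j) (?e j)) * (x0 \<bullet> x0)"
        using psd_form_le_scalar_prod[OF \<beta> x0, of T] by (simp add: \<beta>_def x_def)
      also have "\<dots> \<le> 1 / 2 * (x0 \<bullet> x0)"
        using T0[of T] xx by (intro mult_right_mono) (auto simp: T_def)
      finally show "x T \<bullet> x T \<le> (x0 \<bullet> x0) / 2" by simp
      show "(\<Sum>t<T. x t \<bullet> x t + (u t)\<^sup>2) \<le> c * (x0 \<bullet> x0)"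
        unfolding cost c_def sum_distrib_right by (intro sum_mono psd_form_le_scalar_prod[OF \<gamma> x0])
    qed
  qed
qed

section \<open>Null sequences satisfying a linear recurrence\<close>

text \<open>The composition of the operators \<open>S - a\<close> over the listed roots
  \<open>a\<close>, with \<open>S\<close> the shift of sequences.\<close>

fun shift_prod :: "complex list \<Rightarrow> (nat \<Rightarrow> complex) \<Rightarrow> nat \<Rightarrow> complex" where
  "shift_prod [] s = s"
| "shift_prod (a # as) s = shift_prod as (\<lambda>t. s (Suc t) - a * s t)"

text \<open>The recursion applies the head first. The operators commute, so it may as well come
  last, which is the form in which a root can be discarded.\<close>

lemma shift_prod_Cons:
  "shift_prod (a # as) s t = shift_prod as s (Suc t) - a * shift_prod as s t"
proof (induction as arbitrary: s)
  case (Cons b bs)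
  have "(\<lambda>t. s (Suc (Suc t)) - a * s (Suc t) - b * (s (Suc t) - a * s t)) =
    (\<lambda>t. s (Suc (Suc t)) - b * s (Suc t) - a * (s (Suc t) - b * s t))"
    by (simp add: algebra_simps)
  then have "shift_prod (a # b # bs) s t = shift_prod (a # bs) (\<lambda>t. s (Suc t) - b * s t) t" by simp
  then show ?case unfolding Cons by simp
qed simp

lemma shift_prod_tendsto_0: "s \<longlonglongrightarrow> 0 \<Longrightarrow> shift_prod as s \<longlonglongrightarrow> 0"
proof (induction as arbitrary: s)
  case (Cons a as)
  have "(\<lambda>t. s (Suc t) - a * s t) \<longlonglongrightarrow> 0 - a * 0"
    by (intro tendsto_diff tendsto_mult tendsto_const LIMSEQ_Suc Cons.prems)
  then show ?case using Cons.IH by simp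
qed simp

text \<open>The roots of modulus at least one cannot contribute to a null sequence, and the remaining
  ones only allow polynomial growth, with a constant that does not depend on the roots.\<close>

lemma shift_prod_null_sequence_growth:
  assumes "\<And>t. shift_prod as s t = 0" and "s \<longlonglongrightarrow> 0"
    and "\<And>t. t < length as \<Longrightarrow> cmod (s t) \<le> c" and c: "0 \<le> c"
  shows "cmod (s t) \<le> c * 2 ^ length as * real (Suc t) ^ length as"
  using assms
proof (induction as arbitrary: s c t)
  case Nil
  then show ?case by simp
next
  case (Cons a as)
  let ?L = "length as"
  show ?case
  proof (cases "cmod a \<ge> 1")
    case True
    define g where "g = shift_prod as s"
    have gS: "g (Suc t) = a * g t" for t
      using Cons.prems(1)[of t] unfolding shift_prod_Cons g_def by simp
    have grow: "cmod (g t) \<le> cmod (g (t + k))" for t k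
    proof (induction k)
      case (Suc k)
      have "1 * cmod (g (t + k)) \<le> cmod a * cmod (g (t + k))" using True by (intro mult_right_mono) auto
      then show ?case using Suc by (simp add: gS norm_mult)
    qed simp
    have "(\<lambda>k. cmod (g (t + k))) \<longlonglongrightarrow> 0" for t
      using LIMSEQ_ignore_initial_segment[OF shift_prod_tendsto_0[OF Cons.prems(2)], of as t]
      by (auto simp: g_def add.commute intro: tendsto_norm_zero)
    then have "cmod (g t) \<le> 0" for t
      by (rule LIMSEQ_le_const) (use grow in auto)
    then have ann: "shift_prod as s t = 0" for t by (simp add: g_def)
    have "cmod (s t) \<le> c * 2 ^ ?L * real (Suc t) ^ ?L"
      by (rule Cons.IH[OF ann]) (use Cons.prems in auto)
    also have "\<dots> \<le> c * 2 ^ length (a # as) * real (Suc t) ^ length (a # as)"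
      using Cons.prems(4) by (intro mult_mono mult_left_mono power_increasing) auto
    finally show ?thesis .
  next
    case False
    \<comment> \<open>Here the factor of \<open>a\<close> is applied first. The new initial values
      are at most \<open>2 * c\<close>, the source of the powers of 2, and undoing the factor sums
      the bound over time, which costs one degree.\<close>
    define g where "g = (\<lambda>t. s (Suc t) - a * s t)"
    have s0: "cmod (s 0) \<le> c" using Cons.prems(3)[of 0] by simp
    have contract: "cmod (a * y) \<le> cmod y" for y
      using False mult_right_mono[of "cmod a" 1 "cmod y"] by (simp add: norm_mult)
    have g: "cmod (g t) \<le> (2 * c) * 2 ^ ?L * real (Suc t) ^ ?L" for t
    proof (rule Cons.IH)
      show "shift_prod as g t = 0" for t using Cons.prems(1)[of t] by (simp add: g_def)
      have "(\<lambda>t. s (Suc t) - a * s t) \<longlonglongrightarrow> 0 - a * 0"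
        by (intro tendsto_diff tendsto_mult tendsto_const LIMSEQ_Suc Cons.prems)
      then show "g \<longlonglongrightarrow> 0" by (simp add: g_def)
      fix t assume t: "t < ?L"
      have "cmod (g t) \<le> cmod (s (Suc t)) + cmod (a * s t)" unfolding g_def by (rule norm_triangle_ineq4)
      then show "cmod (g t) \<le> 2 * c"
        using Cons.prems(3)[of "Suc t"] Cons.prems(3)[of t] contract[of "s t"] t by simp
    qed (use c Cons.prems in simp)
    have "cmod (s t) \<le> c * 2 ^ Suc ?L * real (Suc t) ^ Suc ?L"
    proof (induction t)
      case 0
      have "c * 1 \<le> c * 2 ^ Suc ?L" using Cons.prems(4) by (intro mult_left_mono one_le_power) auto
      then show ?case using s0 by simp
    next
      case (Suc t)
      have "cmod (s (Suc t)) = cmod (g t + a * s t)" by (simp add: g_def)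
      also have "\<dots> \<le> cmod (g t) + cmod (s t)"
        using norm_triangle_ineq[of "g t" "a * s t"] contract[of "s t"] by linarith
      also have "\<dots> \<le> c * 2 ^ Suc ?L * real (Suc t) ^ ?L + c * 2 ^ Suc ?L * real (Suc t) ^ Suc ?L"
        using g[of t] Suc by simp
      also have "\<dots> = c * 2 ^ Suc ?L * (real (Suc t) ^ ?L * real (Suc (Suc t)))"
        by (simp add: algebra_simps)
      also have "\<dots> \<le> c * 2 ^ Suc ?L * (real (Suc (Suc t)) ^ ?L * real (Suc (Suc t)))"
        using Cons.prems(4) by (intro mult_left_mono mult_right_mono power_mono) auto
      finally show ?case by (simp add: mult_ac)
    qed
    then show ?thesis by simp
  qed
qed

section \<open>Annihilating polynomials of entries of matrix powers\<close>

definition shift_poly :: "complex poly \<Rightarrow> (nat \<Rightarrow> complex) \<Rightarrow> nat \<Rightarrow> complex" where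
  "shift_poly p s t = (\<Sum>i\<le>degree p. coeff p i * s (t + i))"

lemma shift_poly_eq: "degree p \<le> k \<Longrightarrow> shift_poly p s t = (\<Sum>i\<le>k. coeff p i * s (t + i))"
  unfolding shift_poly_def by (rule sum.mono_neutral_left) (auto simp: coeff_eq_0)

lemma shift_poly_linear_factor_mult:
  "shift_poly ([:- a, 1:] * q) s t = shift_poly q s (Suc t) - a * shift_poly q s t"
proof -
  have "shift_poly ([:- a, 1:] * q) s t = (\<Sum>i\<le>Suc (degree q). coeff ([:- a, 1:] * q) i * s (t + i))"
    by (rule shift_poly_eq) (use degree_mult_le[of "[:- a, 1:]" q] in auto)
  also have "\<dots> = (\<Sum>i\<le>Suc (degree q). coeff (pCons 0 q) i * s (t + i)) - (\<Sum>i\<le>Suc (degree q). a * (coeff q i * s (t + i)))"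
    unfolding sum_subtractf[symmetric] by (rule sum.cong) (auto simp: algebra_simps)
  also have "(\<Sum>i\<le>Suc (degree q). coeff (pCons 0 q) i * s (t + i)) = shift_poly q s (Suc t)"
    by (subst sum.atMost_Suc_shift) (simp add: shift_poly_def)
  also have "(\<Sum>i\<le>Suc (degree q). a * (coeff q i * s (t + i))) = a * shift_poly q s t"
    by (simp add: shift_poly_eq[of q "Suc (degree q)"] sum_distrib_left distrib_left)
  finally show ?thesis .
qed

lemma shift_poly_prod_list: "shift_poly (\<Prod>a\<leftarrow>as. [:- a, 1:]) s t = shift_prod as s t"
proof (induction as arbitrary: t)
  case Nil
  then show ?case by (simp add: shift_poly_def)
next
  case (Cons a as)
  then show ?case unfolding shift_prod_Cons by (simp add: shift_poly_linear_factor_mult del: mult_pCons_left)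
qed

text \<open>The \<open>K + 1\<close> columns \<open>M ^ t e_j\<close> with \<open>t \<le> K\<close>
  are linearly dependent. A dependence, read as a polynomial in the shift, annihilates the entry
  sequence and splits into linear factors over the complex numbers.\<close>

lemma pow_mat_entry_recurrence:
  fixes M :: "complex mat"
  assumes M: "M \<in> carrier_mat K K" and ij: "i < K" "j < K"
  shows "\<exists>as. length as \<le> K \<and> (\<forall>t. shift_prod as (\<lambda>t. (M ^\<^sub>m t) $$ (i, j)) t = 0)"
proof -
  have Mt: "M ^\<^sub>m t \<in> carrier_mat K K" for t using M by simp
  \<comment> \<open>The columns \<open>M ^ t e_j\<close>, padded by a zero row to a square matrix.
    The zero row makes it singular, and a kernel vector is the dependence.\<close>
  define Z where "Z = mat (Suc K) (Suc K) (\<lambda>(r, t). if r < K then (M ^\<^sub>m t) $$ (r, j) else 0)"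
  have Z: "Z \<in> carrier_mat (Suc K) (Suc K)" by (simp add: Z_def)
  have "Z\<^sup>T *\<^sub>v unit_vec (Suc K) K = 0\<^sub>v (Suc K)" by (intro eq_vecI) (auto simp: Z_def)
  moreover have "unit_vec (Suc K) K \<noteq> (0\<^sub>v (Suc K) :: complex vec)" by simp
  ultimately have "det Z\<^sup>T = 0"
    using det_0_iff_vec_prod_zero[of "Z\<^sup>T" "Suc K"] Z by (metis transpose_carrier_mat unit_vec_carrier)
  then have "det Z = 0" using det_transpose[OF Z] by simp
  then obtain v where v: "v \<in> carrier_vec (Suc K)" "v \<noteq> 0\<^sub>v (Suc K)" "Z *\<^sub>v v = 0\<^sub>v (Suc K)"
    using det_0_iff_vec_prod_zero[OF Z] by blast
  have dep: "(\<Sum>t\<le>K. v $ t * (M ^\<^sub>m t) $$ (r, j)) = 0" if r: "r < K" for r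
  proof -
    have "(Z *\<^sub>v v) $ r = (\<Sum>t\<in>{0..<Suc K}. (M ^\<^sub>m t) $$ (r, j) * v $ t)"
      using r v(1) by (simp add: Z_def scalar_prod_def del: sum.op_ivl_Suc)
    then show ?thesis using v(3) r
      by (simp add: mult.commute atLeast0LessThan lessThan_Suc_atMost del: sum.op_ivl_Suc)
  qed
  define s where "s t = (M ^\<^sub>m t) $$ (i, j)" for t
  \<comment> \<open>Multiplying the dependence by the \<open>q\<close>-th power of \<open>M\<close>
    shifts it in time.\<close>
  have rec: "(\<Sum>t\<le>K. v $ t * s (q + t)) = 0" for q
  proof -
    have "s (q + t) = (\<Sum>r<K. (M ^\<^sub>m q) $$ (i, r) * (M ^\<^sub>m t) $$ (r, j))" for t
      unfolding s_def pow_mat_add[OF M] by (rule index_mult_mat_sum[OF Mt Mt ij])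
    then have "(\<Sum>t\<le>K. v $ t * s (q + t)) = (\<Sum>t\<le>K. \<Sum>r<K. (M ^\<^sub>m q) $$ (i, r) * (v $ t * (M ^\<^sub>m t) $$ (r, j)))"
      by (simp add: sum_distrib_left mult_ac)
    also have "\<dots> = (\<Sum>r<K. (M ^\<^sub>m q) $$ (i, r) * (\<Sum>t\<le>K. v $ t * (M ^\<^sub>m t) $$ (r, j)))"
      by (subst sum.swap) (simp add: sum_distrib_left)
    finally show ?thesis using dep by simp
  qed
  define p where "p = (\<Sum>t\<le>K. monom (v $ t) t)"
  have coeff_p: "coeff p k = (if k \<le> K then v $ k else 0)" for k
    by (simp add: p_def coeff_sum)
  have deg: "degree p \<le> K" by (rule degree_le) (simp add: coeff_p)
  have p0: "p \<noteq> 0"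
  proof
    assume "p = 0"
    then have "v $ k = 0" if "k \<le> K" for k using coeff_p[of k] that by simp
    then have "v = 0\<^sub>v (Suc K)" using v(1) by (intro eq_vecI) auto
    with v(2) show False by simp
  qed
  obtain l as where as: "Polynomial.smult l (\<Prod>a\<leftarrow>as. [:- a, 1:]) = p" "length as = degree p"
    using fundamental_theorem_algebra_factorized[of p] by blast
  have l0: "l \<noteq> 0" using as(1) p0 by auto
  have "shift_prod as s q = 0" for q
  proof -
    let ?P = "\<Prod>a\<leftarrow>as. [:- a, 1:]"
    have degP: "degree ?P = degree p" using arg_cong[OF as(1), of degree] l0 by simp
    have cf: "coeff p k = l * coeff ?P k" for k using arg_cong[OF as(1), of "\<lambda>r. coeff r k"] by simp
    have "0 = (\<Sum>t\<le>K. coeff p t * s (q + t))" using rec[of q] by (simp add: coeff_p)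
    also have "\<dots> = l * (\<Sum>t\<le>K. coeff ?P t * s (q + t))"
      unfolding sum_distrib_left by (rule sum.cong) (simp_all add: cf mult.assoc)
    also have "(\<Sum>t\<le>K. coeff ?P t * s (q + t)) = shift_prod as s q"
      unfolding shift_poly_prod_list[symmetric] using shift_poly_eq[of ?P K] degP deg by simp
    finally show ?thesis using l0 by simp
  qed
  then show ?thesis using as(2) deg unfolding s_def by (intro exI[of _ as]) auto
qed

text \<open>The first \<open>K\<close> values of the entry sequences converge in \<open>k\<close>,
  hence are bounded uniformly in \<open>k\<close>. They and \<open>K\<close> determine the growth
  constant, although the roots of the recurrences depend on \<open>k\<close>; so the polynomial
  bound survives the limit.\<close>

lemma pow_mat_limit_poly_growth:
  fixes M :: "nat \<Rightarrow> real mat"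
  assumes M: "\<And>k. M k \<in> carrier_mat K K" and M0: "M0 \<in> carrier_mat K K"
    and conv: "\<And>i j. i < K \<Longrightarrow> j < K \<Longrightarrow> (\<lambda>k. M k $$ (i, j)) \<longlonglongrightarrow> M0 $$ (i, j)"
    and ij: "i < K" "j < K"
    and decay: "\<And>k. (\<lambda>t. (M k ^\<^sub>m t) $$ (i, j)) \<longlonglongrightarrow> 0"
  shows "\<exists>C. \<forall>t. \<bar>(M0 ^\<^sub>m t) $$ (i, j)\<bar> \<le> C * real (Suc t) ^ K"
proof -
  have conv_pow: "(\<lambda>k. (M k ^\<^sub>m t) $$ (i, j)) \<longlonglongrightarrow> (M0 ^\<^sub>m t) $$ (i, j)" if "i < K" "j < K" for t i j
    using that
  proof (induction t arbitrary: i j)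
    case 0
    have "(M k ^\<^sub>m 0) $$ (i, j) = (M0 ^\<^sub>m 0) $$ (i, j)" for k using M[of k] M0 0 by simp
    then show ?case by simp
  next
    case (Suc t)
    have "(\<lambda>k. \<Sum>l<K. (M k ^\<^sub>m t) $$ (i, l) * M k $$ (l, j)) \<longlonglongrightarrow> (\<Sum>l<K. (M0 ^\<^sub>m t) $$ (i, l) * M0 $$ (l, j))"
      by (intro tendsto_sum tendsto_mult Suc.IH conv) (use Suc.prems in auto)
    then show ?case
      using index_mult_mat_sum[OF pow_carrier_mat[OF M] M Suc.prems]
        index_mult_mat_sum[OF pow_carrier_mat[OF M0] M0 Suc.prems] by simp
  qed
  have "\<forall>t. \<exists>b. \<forall>k. \<bar>(M k ^\<^sub>m t) $$ (i, j)\<bar> \<le> b"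
  proof
    fix t
    have "Bseq (\<lambda>k. (M k ^\<^sub>m t) $$ (i, j))" using conv_pow[OF ij] convergent_imp_Bseq convergentI by blast
    then show "\<exists>b. \<forall>k. \<bar>(M k ^\<^sub>m t) $$ (i, j)\<bar> \<le> b" unfolding Bseq_def by auto
  qed
  then obtain b where b: "\<And>t k. \<bar>(M k ^\<^sub>m t) $$ (i, j)\<bar> \<le> b t" by metis
  define c where "c = (\<Sum>t<K. b t)"
  have b0: "0 \<le> b t" for t using b[of 0 t] by linarith
  have c: "0 \<le> c" unfolding c_def by (intro sum_nonneg b0)
  have bound: "\<bar>(M k ^\<^sub>m t) $$ (i, j)\<bar> \<le> c * 2 ^ K * real (Suc t) ^ K" for k t
  proof -
    let ?M = "map_mat complex_of_real (M k)"
    define s where "s = (\<lambda>t. (?M ^\<^sub>m t) $$ (i, j))"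
    have s_eq: "s t = complex_of_real ((M k ^\<^sub>m t) $$ (i, j))" for t
      using M[of k] ij by (simp add: s_def of_real_hom.mat_hom_pow[OF M, symmetric])
    obtain as where as: "length as \<le> K" "\<And>t. shift_prod as s t = 0"
      using pow_mat_entry_recurrence[of ?M K i j] M[of k] ij unfolding s_def by auto
    have "cmod (s t) \<le> c * 2 ^ length as * real (Suc t) ^ length as"
    proof (rule shift_prod_null_sequence_growth[OF as(2) _ _ c])
      show "s \<longlonglongrightarrow> 0" unfolding s_eq using tendsto_of_real[OF decay[of k]] by simp
      fix t assume "t < length as"
      then have "b t \<le> c" unfolding c_def using as(1) b0 by (intro member_le_sum) auto
      then show "cmod (s t) \<le> c" using b[of k t] by (simp add: s_eq)
    qed
    also have "\<dots> \<le> c * 2 ^ K * real (Suc t) ^ K"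
      using as(1) c by (intro mult_mono mult_left_mono power_increasing) auto
    finally show ?thesis by (simp add: s_eq)
  qed
  have "\<bar>(M0 ^\<^sub>m t) $$ (i, j)\<bar> \<le> c * 2 ^ K * real (Suc t) ^ K" for t
    by (rule LIMSEQ_le_const2[OF tendsto_rabs[OF conv_pow[OF ij]]]) (use bound in auto)
  then show ?thesis by blast
qed

section \<open>Necessity\<close>

lemma transpose_pow_mat:
  fixes M :: "'a :: comm_semiring_1 mat"
  assumes M: "M \<in> carrier_mat n n"
  shows "(M\<^sup>T) ^\<^sub>m t = (M ^\<^sub>m t)\<^sup>T"
proof (induction t)
  case (Suc t)
  have "(M ^\<^sub>m Suc t)\<^sup>T = (M * M ^\<^sub>m t)\<^sup>T" by (simp only: pow_mat_Suc_left[OF M])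
  also have "\<dots> = (M ^\<^sub>m t)\<^sup>T * M\<^sup>T" using M by (intro transpose_mult) auto
  finally show ?case using Suc by simp
qed (use M in simp)

lemma eigenvalue_transpose:
  fixes M :: "'a :: field mat"
  assumes M: "M \<in> carrier_mat n n"
  shows "eigenvalue M\<^sup>T z \<longleftrightarrow> eigenvalue M z"
  using eigenvalue_root_char_poly[OF M] eigenvalue_root_char_poly[of "M\<^sup>T" n] char_poly_transpose_mat[OF M] M
  by simp

lemma detectable_of_stabilizable_transpose:
  assumes A: "A \<in> carrier_mat n n" and C: "C \<in> carrier_mat 1 n" and st: "stabilizable A\<^sup>T C\<^sup>T"
  shows "detectable C A"
proof -
  from st obtain F where F: "F \<in> carrier_mat 1 n" and schur: "schur_stable (A\<^sup>T + C\<^sup>T * F)"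
    unfolding stabilizable_def using A C by auto
  have K: "F\<^sup>T \<in> carrier_mat n 1" using F by simp
  have AK: "A + F\<^sup>T * C \<in> carrier_mat n n" using A K C by simp
  have "A\<^sup>T + C\<^sup>T * F = (A + F\<^sup>T * C)\<^sup>T"
    using transpose_add[of A n n "F\<^sup>T * C"] transpose_mult[OF K C] A K C by simp
  then have "schur_stable (A + F\<^sup>T * C)"
    using schur eigenvalue_transpose[of "map_mat complex_of_real (A + F\<^sup>T * C)" n] AK
    unfolding schur_stable_def by (simp add: map_mat_transpose[symmetric])
  then show ?thesis unfolding detectable_def using K A C by (intro bexI[of _ "F\<^sup>T"]) auto
qed

lemma pow_block_upper_triangular:
  fixes A :: "'a :: comm_semiring_1 mat"
  assumes A: "A \<in> carrier_mat n n" and B: "B \<in> carrier_mat n m" and D: "D \<in> carrier_mat m m"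
    and ij: "i < n" "j < n"
  shows "(four_block_mat A B (0\<^sub>m m n) D ^\<^sub>m t) $$ (i, j) = (A ^\<^sub>m t) $$ (i, j)"
proof -
  let ?M = "four_block_mat A B (0\<^sub>m m n) D"
  have M: "?M \<in> carrier_mat (n + m) (n + m)" by (rule four_block_carrier_mat[OF A D])
  have "\<exists>P Q. P \<in> carrier_mat n m \<and> Q \<in> carrier_mat m m \<and> ?M ^\<^sub>m t = four_block_mat (A ^\<^sub>m t) P (0\<^sub>m m n) Q"
  proof (induction t)
    case 0
    have "?M ^\<^sub>m 0 = four_block_mat (A ^\<^sub>m 0) (0\<^sub>m n m) (0\<^sub>m m n) (1\<^sub>m m)"
      using A D by (simp add: four_block_one_mat)
    then show ?case by (metis one_carrier_mat zero_carrier_mat)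
  next
    case (Suc t)
    then obtain P Q where P: "P \<in> carrier_mat n m" and Q: "Q \<in> carrier_mat m m"
      and eq: "?M ^\<^sub>m t = four_block_mat (A ^\<^sub>m t) P (0\<^sub>m m n) Q" by blast
    have At: "A ^\<^sub>m t \<in> carrier_mat n n" using A by simp
    have "?M ^\<^sub>m Suc t = four_block_mat (A ^\<^sub>m t) P (0\<^sub>m m n) Q * ?M" using eq by simp
    also have "\<dots> = four_block_mat (A ^\<^sub>m t * A + P * 0\<^sub>m m n) (A ^\<^sub>m t * B + P * D)
        (0\<^sub>m m n * A + Q * 0\<^sub>m m n) (0\<^sub>m m n * B + Q * D)"
      by (rule mult_four_block_mat[OF At P zero_carrier_mat Q A B zero_carrier_mat D])
    also have "\<dots> = four_block_mat (A ^\<^sub>m Suc t) (A ^\<^sub>m t * B + P * D) (0\<^sub>m m n) (Q * D)"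
      using right_add_zero_mat[OF mult_carrier_mat[OF At A]] P Q B D A by simp
    finally show ?case using At B P Q D by (intro exI[of _ "A ^\<^sub>m t * B + P * D"] exI[of _ "Q * D"]) auto
  qed
  then obtain P Q where "P \<in> carrier_mat n m" "Q \<in> carrier_mat m m"
    "?M ^\<^sub>m t = four_block_mat (A ^\<^sub>m t) P (0\<^sub>m m n) Q" by blast
  then show ?thesis using A ij by simp
qed

section \<open>The two-agent network\<close>

lemma mult_mat_zero_vec:
  fixes K :: "'a :: semiring_0 mat"
  shows "K \<in> carrier_mat k l \<Longrightarrow> K *\<^sub>v 0\<^sub>v l = 0\<^sub>v k"
  by (intro eq_vecI) auto

lemma smult_mat_mult_vec:
  fixes K :: "'a :: comm_semiring_0 mat"
  assumes "K \<in> carrier_mat k l" "v \<in> carrier_vec l"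
  shows "(c \<cdot>\<^sub>m K) *\<^sub>v v = c \<cdot>\<^sub>v (K *\<^sub>v v)"
  using assms by (intro eq_vecI) auto

lemma smult_mult_mat_mult_vec:
  fixes K :: "'a :: field mat"
  assumes "K \<in> carrier_mat k l" "L \<in> carrier_mat l r" "v \<in> carrier_vec r"
  shows "(c \<cdot>\<^sub>m (K * L)) *\<^sub>v v = K *\<^sub>v (c \<cdot>\<^sub>v (L *\<^sub>v v))"
  using smult_mat_mult_vec[OF mult_carrier_mat[OF assms(1,2)] assms(3), of c]
    assoc_mult_mat_vec[OF assms] mult_mat_vec[OF assms(1) mult_mat_vec_carrier[OF assms(2,3)], of c]
  by simp

text \<open>Agent 1 is the root and rests at 0 together with its protocol. Agent 0 then receives its
  own signals scaled by \<delta>, and its joint state evolves under \<open>M\<close>.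
  Synchronization forces the plant part to 0 from every initial state, in particular from the
  \<open>j\<close>-th unit vector, which may also excite the protocol.\<close>

lemma two_agent_decay:
  fixes A B C :: "real mat" and \<delta> :: real
  assumes A: "A \<in> carrier_mat n n" and B: "B \<in> carrier_mat n 1" and C: "C \<in> carrier_mat 1 n"
    and Ac: "Ac \<in> carrier_mat m m" and Bc: "Bc \<in> carrier_mat m 1" and Ec: "Ec \<in> carrier_mat m p"
    and Fc: "Fc \<in> carrier_mat 1 m" and G1: "G1 \<in> carrier_mat 1 1" and G2: "G2 \<in> carrier_mat 1 p"
    and Hc: "Hc \<in> carrier_mat p m"
    and \<delta>: "0 < \<delta>" "\<delta> \<le> 1 / 2"
    and sync: "\<And>(N::nat) (a :: nat \<Rightarrow> nat \<Rightarrow> real) (q :: nat \<Rightarrow> real) d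
         (x :: nat \<Rightarrow> nat \<Rightarrow> real vec) (xc :: nat \<Rightarrow> nat \<Rightarrow> real vec) i j k.
         weighted_graph N a \<Longrightarrow> has_spanning_tree N a \<Longrightarrow> \<forall>i<N. q i \<ge> (\<Sum>j<N. a i j) \<Longrightarrow>
         d = (\<lambda>i j. a i j / (1 + q i)) \<Longrightarrow>
         \<forall>i<N. x i 0 \<in> carrier_vec n \<and> xc i 0 \<in> carrier_vec m \<Longrightarrow>
         \<forall>i<N. \<forall>t. (let zeta = coupling N d i (\<lambda>j. C *\<^sub>v x j t) 1;
                    zh = coupling N d i (\<lambda>j. Hc *\<^sub>v xc j t) p;
                    u = Fc *\<^sub>v xc i t + G1 *\<^sub>v zeta + G2 *\<^sub>v zh
                in x i (Suc t) = A *\<^sub>v x i t + B *\<^sub>v u \<and>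
                   xc i (Suc t) = Ac *\<^sub>v xc i t + Bc *\<^sub>v zeta + Ec *\<^sub>v zh) \<Longrightarrow>
         i < N \<Longrightarrow> j < N \<Longrightarrow> k < n \<Longrightarrow> (\<lambda>t. x i t $ k - x j t $ k) \<longlonglongrightarrow> 0"
    and M: "M = four_block_mat (A + B * (\<delta> \<cdot>\<^sub>m (G1 * C))) (B * (Fc + \<delta> \<cdot>\<^sub>m (G2 * Hc)))
      (\<delta> \<cdot>\<^sub>m (Bc * C)) (Ac + \<delta> \<cdot>\<^sub>m (Ec * Hc))"
    and i: "i < n" and j: "j < n + m"
  shows "(\<lambda>t. (M ^\<^sub>m t) $$ (i, j)) \<longlonglongrightarrow> 0"
proof -
  have M1: "A + B * (\<delta> \<cdot>\<^sub>m (G1 * C)) \<in> carrier_mat n n"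
    and M2: "B * (Fc + \<delta> \<cdot>\<^sub>m (G2 * Hc)) \<in> carrier_mat n m"
    and M3: "\<delta> \<cdot>\<^sub>m (Bc * C) \<in> carrier_mat m n"
    and M4: "Ac + \<delta> \<cdot>\<^sub>m (Ec * Hc) \<in> carrier_mat m m"
    using A B C Ac Bc Ec Fc G1 G2 Hc by auto
  have DG: "\<delta> \<cdot>\<^sub>m (G1 * C) \<in> carrier_mat 1 n" and GH: "\<delta> \<cdot>\<^sub>m (G2 * Hc) \<in> carrier_mat 1 m"
    and EH: "\<delta> \<cdot>\<^sub>m (Ec * Hc) \<in> carrier_mat m m"
    using G1 C G2 Ec Hc by auto
  have Mc: "M \<in> carrier_mat (n + m) (n + m)" unfolding M by (rule four_block_carrier_mat[OF M1 M4])
  define z where "z t = M ^\<^sub>m t *\<^sub>v unit_vec (n + m) j" for t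
  have z: "z t \<in> carrier_vec (n + m)" for t
    unfolding z_def by (rule mult_mat_vec_carrier[OF pow_carrier_mat[OF Mc]]) simp
  have zS: "z (Suc t) = M *\<^sub>v z t" for t
    unfolding z_def pow_mat_Suc_left[OF Mc] by (rule assoc_mult_mat_vec[OF Mc pow_carrier_mat[OF Mc]]) simp
  define y where "y t = vec_first (z t) n" for t
  define yc where "yc t = vec_last (z t) m" for t
  have y: "y t \<in> carrier_vec n" and yc: "yc t \<in> carrier_vec m" for t by (auto simp: y_def yc_def)
  have z_eq: "z t = y t @\<^sub>v yc t" for t using z[of t] by (simp add: y_def yc_def)
  have yS: "y (Suc t) = (A + B * (\<delta> \<cdot>\<^sub>m (G1 * C))) *\<^sub>v y t + (B * (Fc + \<delta> \<cdot>\<^sub>m (G2 * Hc))) *\<^sub>v yc t"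
    and ycS: "yc (Suc t) = (\<delta> \<cdot>\<^sub>m (Bc * C)) *\<^sub>v y t + (Ac + \<delta> \<cdot>\<^sub>m (Ec * Hc)) *\<^sub>v yc t" for t
  proof -
    have rhs: "(A + B * (\<delta> \<cdot>\<^sub>m (G1 * C))) *\<^sub>v y t + (B * (Fc + \<delta> \<cdot>\<^sub>m (G2 * Hc))) *\<^sub>v yc t \<in> carrier_vec n"
      by (intro add_carrier_vec mult_mat_vec_carrier[OF M1 y] mult_mat_vec_carrier[OF M2 yc])
    have "y (Suc t) @\<^sub>v yc (Suc t) = M *\<^sub>v (y t @\<^sub>v yc t)" using zS[of t] by (simp add: z_eq)
    also have "\<dots> = ((A + B * (\<delta> \<cdot>\<^sub>m (G1 * C))) *\<^sub>v y t + (B * (Fc + \<delta> \<cdot>\<^sub>m (G2 * Hc))) *\<^sub>v yc t) @\<^sub>v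
      ((\<delta> \<cdot>\<^sub>m (Bc * C)) *\<^sub>v y t + (Ac + \<delta> \<cdot>\<^sub>m (Ec * Hc)) *\<^sub>v yc t)"
      unfolding M by (rule four_block_mat_mult_vec[OF M1 M2 M3 M4 y yc])
    finally have "y (Suc t) = (A + B * (\<delta> \<cdot>\<^sub>m (G1 * C))) *\<^sub>v y t + (B * (Fc + \<delta> \<cdot>\<^sub>m (G2 * Hc))) *\<^sub>v yc t \<and>
      yc (Suc t) = (\<delta> \<cdot>\<^sub>m (Bc * C)) *\<^sub>v y t + (Ac + \<delta> \<cdot>\<^sub>m (Ec * Hc)) *\<^sub>v yc t"
      by (simp only: append_vec_eq[OF y rhs])
    then show "y (Suc t) = (A + B * (\<delta> \<cdot>\<^sub>m (G1 * C))) *\<^sub>v y t + (B * (Fc + \<delta> \<cdot>\<^sub>m (G2 * Hc))) *\<^sub>v yc t"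
      "yc (Suc t) = (\<delta> \<cdot>\<^sub>m (Bc * C)) *\<^sub>v y t + (Ac + \<delta> \<cdot>\<^sub>m (Ec * Hc)) *\<^sub>v yc t" by auto
  qed
  \<comment> \<open>One unit edge from 1 to 0. With \<open>q 0 = 1 / \<delta> - 1\<close> its
    normalized weight is exactly \<delta>, and \<open>\<delta> \<le> 1 / 2\<close> is the in-degree
    condition \<open>q 0 \<ge> 1\<close>.\<close>
  define a :: "nat \<Rightarrow> nat \<Rightarrow> real" where "a i j = (if i = 0 \<and> j = 1 then 1 else 0)" for i j
  define q :: "nat \<Rightarrow> real" where "q i = (if i = 0 then 1 / \<delta> - 1 else 0)" for i
  define d where "d = (\<lambda>i j. a i j / (1 + q i))"
  have d01: "d 0 (Suc 0) = \<delta>" and d10: "d (Suc 0) 0 = 0" using \<delta> by (auto simp: d_def a_def q_def)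
  define x where "x i t = (if i = 0 then y t else 0\<^sub>v n)" for i :: nat and t
  define xc where "xc i t = (if i = 0 then yc t else 0\<^sub>v m)" for i :: nat and t
  have nb: "{j. j < 2 \<and> j \<noteq> (0::nat)} = {1}" "{j. j < 2 \<and> (0::nat) < j} = {1}" "{j. j < 2 \<and> j \<noteq> Suc 0} = {0}" by auto
  have coupling0: "coupling 2 d 0 w k = \<delta> \<cdot>\<^sub>v w 0" if "w 0 \<in> carrier_vec k" "w 1 = 0\<^sub>v k" for w k
    using that by (intro eq_vecI) (auto simp: coupling_def nb d01)
  have coupling1: "coupling 2 d (Suc 0) w k = 0\<^sub>v k" for w k
    by (intro eq_vecI) (auto simp: coupling_def nb d10)
  have "(\<lambda>t. x 0 t $ i - x 1 t $ i) \<longlonglongrightarrow> 0"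
  proof (rule sync[of 2 a q d x xc])
    show "weighted_graph 2 a" by (auto simp: weighted_graph_def a_def)
    have "(1, k) \<in> {(j, i). i < 2 \<and> j < 2 \<and> 0 < a i j}\<^sup>*" if "k < 2" for k
    proof (cases "k = 0")
      case True
      then show ?thesis by (intro r_into_rtrancl) (auto simp: a_def)
    next
      case False
      then have "k = 1" using that by simp
      then show ?thesis by simp
    qed
    then show "has_spanning_tree 2 a" unfolding has_spanning_tree_def by (intro exI[of _ 1]) auto
    have "1 \<le> 1 / \<delta> - 1" using \<delta> by (simp add: field_simps)
    then show "\<forall>i<2. q i \<ge> (\<Sum>j<2. a i j)"
      by (auto simp: q_def a_def numeral_2_eq_2 less_Suc_eq)
    show "d = (\<lambda>i j. a i j / (1 + q i))" by (simp add: d_def)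
    show "\<forall>i<2. x i 0 \<in> carrier_vec n \<and> xc i 0 \<in> carrier_vec m" using y yc by (auto simp: x_def xc_def)
    show "\<forall>i<2. \<forall>t. (let zeta = coupling 2 d i (\<lambda>j. C *\<^sub>v x j t) 1;
                    zh = coupling 2 d i (\<lambda>j. Hc *\<^sub>v xc j t) p;
                    u = Fc *\<^sub>v xc i t + G1 *\<^sub>v zeta + G2 *\<^sub>v zh
                in x i (Suc t) = A *\<^sub>v x i t + B *\<^sub>v u \<and>
                   xc i (Suc t) = Ac *\<^sub>v xc i t + Bc *\<^sub>v zeta + Ec *\<^sub>v zh)"
    proof (intro allI impI)
      fix i t :: nat assume "i < 2"
      then consider "i = 0" | "i = Suc 0" by linarith
      then show "let zeta = coupling 2 d i (\<lambda>j. C *\<^sub>v x j t) 1;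
                    zh = coupling 2 d i (\<lambda>j. Hc *\<^sub>v xc j t) p;
                    u = Fc *\<^sub>v xc i t + G1 *\<^sub>v zeta + G2 *\<^sub>v zh
                in x i (Suc t) = A *\<^sub>v x i t + B *\<^sub>v u \<and>
                   xc i (Suc t) = Ac *\<^sub>v xc i t + Bc *\<^sub>v zeta + Ec *\<^sub>v zh"
      proof cases
        case 1
        have Cy: "C *\<^sub>v y t \<in> carrier_vec 1" and Hy: "Hc *\<^sub>v yc t \<in> carrier_vec p"
          using C Hc y yc by auto
        have zeta: "coupling 2 d 0 (\<lambda>j. C *\<^sub>v x j t) 1 = \<delta> \<cdot>\<^sub>v (C *\<^sub>v y t)"
          using coupling0[of "\<lambda>j. C *\<^sub>v x j t" 1] Cy mult_mat_zero_vec[OF C] by (simp add: x_def)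
        have zh: "coupling 2 d 0 (\<lambda>j. Hc *\<^sub>v xc j t) p = \<delta> \<cdot>\<^sub>v (Hc *\<^sub>v yc t)"
          using coupling0[of "\<lambda>j. Hc *\<^sub>v xc j t" p] Hy mult_mat_zero_vec[OF Hc] by (simp add: xc_def)
        have g1: "(\<delta> \<cdot>\<^sub>m (G1 * C)) *\<^sub>v y t = G1 *\<^sub>v (\<delta> \<cdot>\<^sub>v (C *\<^sub>v y t))"
          by (rule smult_mult_mat_mult_vec[OF G1 C y])
        have g2: "(\<delta> \<cdot>\<^sub>m (G2 * Hc)) *\<^sub>v yc t = G2 *\<^sub>v (\<delta> \<cdot>\<^sub>v (Hc *\<^sub>v yc t))"
          by (rule smult_mult_mat_mult_vec[OF G2 Hc yc])
        have g3: "(\<delta> \<cdot>\<^sub>m (Bc * C)) *\<^sub>v y t = Bc *\<^sub>v (\<delta> \<cdot>\<^sub>v (C *\<^sub>v y t))"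
          by (rule smult_mult_mat_mult_vec[OF Bc C y])
        have g4: "(\<delta> \<cdot>\<^sub>m (Ec * Hc)) *\<^sub>v yc t = Ec *\<^sub>v (\<delta> \<cdot>\<^sub>v (Hc *\<^sub>v yc t))"
          by (rule smult_mult_mat_mult_vec[OF Ec Hc yc])
        let ?v1 = "G1 *\<^sub>v (\<delta> \<cdot>\<^sub>v (C *\<^sub>v y t))" and ?v2 = "G2 *\<^sub>v (\<delta> \<cdot>\<^sub>v (Hc *\<^sub>v yc t))"
        have v: "?v1 \<in> carrier_vec 1" "?v2 \<in> carrier_vec 1" "Fc *\<^sub>v yc t \<in> carrier_vec 1"
          using G1 G2 Cy Hy Fc yc by auto
        have "y (Suc t) = A *\<^sub>v y t + B *\<^sub>v ?v1 + B *\<^sub>v (Fc *\<^sub>v yc t + ?v2)"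
        proof -
          have "(A + B * (\<delta> \<cdot>\<^sub>m (G1 * C))) *\<^sub>v y t = A *\<^sub>v y t + B *\<^sub>v ?v1"
            unfolding g1[symmetric] assoc_mult_mat_vec[OF B DG y, symmetric]
            by (rule add_mult_distrib_mat_vec[OF A mult_carrier_mat[OF B DG] y])
          moreover have "(B * (Fc + \<delta> \<cdot>\<^sub>m (G2 * Hc))) *\<^sub>v yc t = B *\<^sub>v (Fc *\<^sub>v yc t + ?v2)"
            unfolding g2[symmetric] add_mult_distrib_mat_vec[OF Fc GH yc, symmetric]
            by (rule assoc_mult_mat_vec[OF B add_carrier_mat[OF GH] yc])
          ultimately show ?thesis using yS[of t] by simp
        qed
        also have "\<dots> = A *\<^sub>v y t + (B *\<^sub>v ?v1 + B *\<^sub>v (Fc *\<^sub>v yc t + ?v2))"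
          by (rule assoc_add_vec[OF mult_mat_vec_carrier[OF A y] mult_mat_vec_carrier[OF B v(1)]
                mult_mat_vec_carrier[OF B add_carrier_vec[OF v(3,2)]]])
        also have "B *\<^sub>v ?v1 + B *\<^sub>v (Fc *\<^sub>v yc t + ?v2) = B *\<^sub>v (?v1 + (Fc *\<^sub>v yc t + ?v2))"
          by (rule mult_add_distrib_mat_vec[symmetric, OF B v(1) add_carrier_vec[OF v(3,2)]])
        also have "?v1 + (Fc *\<^sub>v yc t + ?v2) = Fc *\<^sub>v yc t + ?v1 + ?v2"
          using v by (intro eq_vecI) auto
        finally have 1: "y (Suc t) = A *\<^sub>v y t + B *\<^sub>v (Fc *\<^sub>v yc t + ?v1 + ?v2)" .
        have "yc (Suc t) = Bc *\<^sub>v (\<delta> \<cdot>\<^sub>v (C *\<^sub>v y t)) + (Ac *\<^sub>v yc t + Ec *\<^sub>v (\<delta> \<cdot>\<^sub>v (Hc *\<^sub>v yc t)))"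
          unfolding ycS g3 g4[symmetric] add_mult_distrib_mat_vec[OF Ac EH yc] by (rule refl)
        also have "\<dots> = Ac *\<^sub>v yc t + Bc *\<^sub>v (\<delta> \<cdot>\<^sub>v (C *\<^sub>v y t)) + Ec *\<^sub>v (\<delta> \<cdot>\<^sub>v (Hc *\<^sub>v yc t))"
          using Ac Bc Ec yc[of t] by (intro eq_vecI) auto
        finally show ?thesis using 1 unfolding \<open>i = 0\<close> zeta zh Let_def by (simp add: x_def xc_def)
      next
        case 2
        show ?thesis unfolding 2 coupling1 Let_def
          using A B Ac Bc Ec Fc G1 G2 by (simp add: x_def xc_def mult_mat_zero_vec[of _ _ n]
            mult_mat_zero_vec[of _ _ m] mult_mat_zero_vec[of _ _ p] mult_mat_zero_vec[of _ _ "Suc 0"])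
      qed
    qed
  qed (use i in auto)
  moreover have "x 0 t $ i - x 1 t $ i = (M ^\<^sub>m t) $$ (i, j)" for t
  proof -
    have "x 0 t $ i = z t $ i" using i carrier_vecD[OF y, of t] carrier_vecD[OF yc, of t] by (simp add: x_def z_eq)
    also have "\<dots> = (M ^\<^sub>m t) $$ (i, j)" using Mc i j by (simp add: z_def)
    finally show ?thesis using i by (simp add: x_def)
  qed
  ultimately show ?thesis by simp
qed

lemma solvable_imp_conditions:
  fixes A B C :: "real mat"
  assumes A: "A \<in> carrier_mat n n" and B: "B \<in> carrier_mat n 1" and C: "C \<in> carrier_mat 1 n"
    and solvable: "scale_free_collab_solvable n A B C"
  shows "stabilizable A B" and "detectable C A"
    and "eigenvalue (map_mat complex_of_real A) z \<Longrightarrow> cmod z \<le> 1"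
proof -
  from solvable obtain m p Ac Bc Ec Fc G1 G2 Hc where
    Ac: "Ac \<in> carrier_mat m m" and Bc: "Bc \<in> carrier_mat m 1" and Ec: "Ec \<in> carrier_mat m p"
    and Fc: "Fc \<in> carrier_mat 1 m" and G1: "G1 \<in> carrier_mat 1 1" and G2: "G2 \<in> carrier_mat 1 p"
    and Hc: "Hc \<in> carrier_mat p m"
    and sync: "\<forall>(N::nat) (a :: nat \<Rightarrow> nat \<Rightarrow> real) (q :: nat \<Rightarrow> real).
         weighted_graph N a \<and> has_spanning_tree N a \<and>
         (\<forall>i<N. q i \<ge> (\<Sum>j<N. a i j)) \<longrightarrow>
         (let d = (\<lambda>i j. a i j / (1 + q i)) in
          \<forall>(x :: nat \<Rightarrow> nat \<Rightarrow> real vec) (xc :: nat \<Rightarrow> nat \<Rightarrow> real vec).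
            (\<forall>i<N. x i 0 \<in> carrier_vec n \<and> xc i 0 \<in> carrier_vec m) \<and>
            (\<forall>i<N. \<forall>t.
               (let zeta = coupling N d i (\<lambda>j. C *\<^sub>v x j t) 1;
                    zh = coupling N d i (\<lambda>j. Hc *\<^sub>v xc j t) p;
                    u = Fc *\<^sub>v xc i t + G1 *\<^sub>v zeta + G2 *\<^sub>v zh
                in x i (Suc t) = A *\<^sub>v x i t + B *\<^sub>v u \<and>
                   xc i (Suc t) = Ac *\<^sub>v xc i t + Bc *\<^sub>v zeta + Ec *\<^sub>v zh))
            \<longrightarrow> (\<forall>i<N. \<forall>j<N. \<forall>k<n. (\<lambda>t. x i t $ k - x j t $ k) \<longlonglongrightarrow> 0))"
    unfolding scale_free_collab_solvable_def by blast
  define M where "M \<delta> = four_block_mat (A + B * (\<delta> \<cdot>\<^sub>m (G1 * C))) (B * (Fc + \<delta> \<cdot>\<^sub>m (G2 * Hc)))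
      (\<delta> \<cdot>\<^sub>m (Bc * C)) (Ac + \<delta> \<cdot>\<^sub>m (Ec * Hc))" for \<delta>
  have decay: "(\<lambda>t. (M \<delta> ^\<^sub>m t) $$ (i, j)) \<longlonglongrightarrow> 0" if "0 < \<delta>" "\<delta> \<le> 1 / 2" "i < n" "j < n + m" for \<delta> i j
  proof (rule two_agent_decay[OF A B C Ac Bc Ec Fc G1 G2 Hc that(1,2) _ M_def that(3,4)])
    fix N :: nat and a :: "nat \<Rightarrow> nat \<Rightarrow> real" and q :: "nat \<Rightarrow> real" and d
      and x xc :: "nat \<Rightarrow> nat \<Rightarrow> real vec" and i j k
    assume h: "weighted_graph N a" "has_spanning_tree N a" "\<forall>i<N. q i \<ge> (\<Sum>j<N. a i j)"
      and d: "d = (\<lambda>i j. a i j / (1 + q i))"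
      and tr: "\<forall>i<N. x i 0 \<in> carrier_vec n \<and> xc i 0 \<in> carrier_vec m"
        "\<forall>i<N. \<forall>t. (let zeta = coupling N d i (\<lambda>j. C *\<^sub>v x j t) 1;
                    zh = coupling N d i (\<lambda>j. Hc *\<^sub>v xc j t) p;
                    u = Fc *\<^sub>v xc i t + G1 *\<^sub>v zeta + G2 *\<^sub>v zh
                in x i (Suc t) = A *\<^sub>v x i t + B *\<^sub>v u \<and>
                   xc i (Suc t) = Ac *\<^sub>v xc i t + Bc *\<^sub>v zeta + Ec *\<^sub>v zh)"
      and ijk: "i < N" "j < N" "k < n"
    from h have "weighted_graph N a \<and> has_spanning_tree N a \<and> (\<forall>i<N. q i \<ge> (\<Sum>j<N. a i j))" by (intro conjI)
    from sync[rule_format, OF this, unfolded Let_def[of "\<lambda>i j. a i j / (1 + q i)"], folded d, rule_format,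
        OF conjI[OF tr] ijk]
    show "(\<lambda>t. x i t $ k - x j t $ k) \<longlonglongrightarrow> 0" .
  qed
  \<comment> \<open>One admissible coupling suffices for stabilizability and detectability; only the
    eigenvalue bound lets the coupling tend to 0.\<close>
  let ?\<delta> = "1 / 2 :: real"
  have G: "\<delta> \<cdot>\<^sub>m (G1 * C) \<in> carrier_mat 1 n" and F: "Fc + \<delta> \<cdot>\<^sub>m (G2 * Hc) \<in> carrier_mat 1 m"
    and H: "\<delta> \<cdot>\<^sub>m (Bc * C) \<in> carrier_mat m n" and J: "Ac + \<delta> \<cdot>\<^sub>m (Ec * Hc) \<in> carrier_mat m m" for \<delta>
    using G1 C Fc G2 Hc Bc Ac Ec by auto
  have AG: "A + B * (\<delta> \<cdot>\<^sub>m (G1 * C)) \<in> carrier_mat n n" and BF: "B * (Fc + \<delta> \<cdot>\<^sub>m (G2 * Hc)) \<in> carrier_mat n m" for \<delta>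
    using mult_carrier_mat[OF B G] mult_carrier_mat[OF B F] by auto
  have Mc: "M \<delta> \<in> carrier_mat (n + m) (n + m)" for \<delta>
    unfolding M_def by (rule four_block_carrier_mat[OF AG J])

  show "stabilizable A B"
    by (rule stabilizable_of_block_decay[OF A B G F H J M_def[of ?\<delta>]]) (auto intro: decay)

  show "detectable C A"
  proof (rule detectable_of_stabilizable_transpose[OF A C])
    have At: "A\<^sup>T \<in> carrier_mat n n" and Ct: "C\<^sup>T \<in> carrier_mat n 1" using A C by auto
    have Gt: "(?\<delta> \<cdot>\<^sub>m (B * G1))\<^sup>T \<in> carrier_mat 1 n" and Ft: "(?\<delta> \<cdot>\<^sub>m Bc)\<^sup>T \<in> carrier_mat 1 m"
      and Ht: "(B * (Fc + ?\<delta> \<cdot>\<^sub>m (G2 * Hc)))\<^sup>T \<in> carrier_mat m n"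
      and Jt: "(Ac + ?\<delta> \<cdot>\<^sub>m (Ec * Hc))\<^sup>T \<in> carrier_mat m m"
      using B G1 Bc BF J by auto
    have BG1: "B * G1 \<in> carrier_mat n 1" using B G1 by simp
    \<comment> \<open>\<open>C\<close> enters the first block column of \<open>M\<close> only as a
      right factor. Pulled out there, it gives the first block row of the transpose the shape of a
      closed loop for \<open>(A\<^sup>T, C\<^sup>T)\<close>.\<close>
    have "B * (?\<delta> \<cdot>\<^sub>m (G1 * C)) = (?\<delta> \<cdot>\<^sub>m (B * G1)) * C"
      using mult_smult_distrib[OF B mult_carrier_mat[OF G1 C], of ?\<delta>] assoc_mult_mat[OF B G1 C]
        mult_smult_assoc_mat[OF BG1 C, of ?\<delta>] by simp
    then have 1: "(A + B * (?\<delta> \<cdot>\<^sub>m (G1 * C)))\<^sup>T = A\<^sup>T + C\<^sup>T * (?\<delta> \<cdot>\<^sub>m (B * G1))\<^sup>T"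
      using transpose_add[OF A mult_carrier_mat[OF B G], of ?\<delta>] transpose_mult[of "?\<delta> \<cdot>\<^sub>m (B * G1)" n 1 C n] BG1 C by simp
    have 2: "(?\<delta> \<cdot>\<^sub>m (Bc * C))\<^sup>T = C\<^sup>T * (?\<delta> \<cdot>\<^sub>m Bc)\<^sup>T"
      using mult_smult_assoc_mat[OF Bc C, of ?\<delta>] transpose_mult[of "?\<delta> \<cdot>\<^sub>m Bc" m 1 C n] Bc C by simp
    have Mt: "(M ?\<delta>)\<^sup>T = four_block_mat (A\<^sup>T + C\<^sup>T * (?\<delta> \<cdot>\<^sub>m (B * G1))\<^sup>T) (C\<^sup>T * (?\<delta> \<cdot>\<^sub>m Bc)\<^sup>T)
       (B * (Fc + ?\<delta> \<cdot>\<^sub>m (G2 * Hc)))\<^sup>T (Ac + ?\<delta> \<cdot>\<^sub>m (Ec * Hc))\<^sup>T"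
      unfolding M_def 1[symmetric] 2[symmetric] by (rule transpose_four_block_mat[OF AG BF H J])
    show "stabilizable A\<^sup>T C\<^sup>T"
    proof (rule stabilizable_of_block_decay[OF At Ct Gt Ft Ht Jt Mt])
      fix i j assume ij: "i < n" "j < n"
      have "((M ?\<delta>)\<^sup>T ^\<^sub>m t) $$ (i, j) = (M ?\<delta> ^\<^sub>m t) $$ (j, i)" for t
        unfolding transpose_pow_mat[OF Mc]
        by (rule index_transpose_mat(1)) (use carrier_matD[OF pow_carrier_mat[OF Mc, of ?\<delta> t]] ij in auto)
      then show "(\<lambda>t. ((M ?\<delta>)\<^sup>T ^\<^sub>m t) $$ (i, j)) \<longlonglongrightarrow> 0" using decay[of ?\<delta> j i] ij by simp
    qed
  qed

  assume ev: "eigenvalue (map_mat complex_of_real A) z"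
  \<comment> \<open>Starting at \<open>1 / 2\<close> keeps every member of the sequence
    admissible.\<close>
  define \<delta> where "\<delta> k = 1 / (real k + 2)" for k :: nat
  have \<delta>: "0 < \<delta> k" "\<delta> k \<le> 1 / 2" for k by (auto simp: \<delta>_def field_simps)
  have \<delta>_lim: "\<delta> \<longlonglongrightarrow> 0"
  proof -
    have "(\<lambda>k. 1 / real (Suc (k + 1))) \<longlonglongrightarrow> 0"
      using LIMSEQ_ignore_initial_segment[OF LIMSEQ_inverse_real_of_nat, of 1] by (simp add: inverse_eq_divide)
    moreover have "real (Suc (k + 1)) = real k + 2" for k by simp
    ultimately show ?thesis unfolding \<delta>_def by (simp only:)
  qed
  \<comment> \<open>The loop at coupling 0. Its lower left block vanishes, so the corners of its
    powers are the powers of \<open>A\<close>; \<open>E\<close> below collects what is linear in the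
    coupling.\<close>
  define M0 where "M0 = four_block_mat A (B * Fc) (0\<^sub>m m n) Ac"
  have BFc: "B * Fc \<in> carrier_mat n m" using B Fc by simp
  have M0: "M0 \<in> carrier_mat (n + m) (n + m)" unfolding M0_def by (rule four_block_carrier_mat[OF A Ac])
  define E where "E = four_block_mat (B * (G1 * C)) (B * (G2 * Hc)) (Bc * C) (Ec * Hc)"
  have M_eq: "M d = M0 + d \<cdot>\<^sub>m E" for d
  proof -
    have E1: "B * (G1 * C) \<in> carrier_mat n n" and E2: "B * (G2 * Hc) \<in> carrier_mat n m"
      and E3: "Bc * C \<in> carrier_mat m n" and E4: "Ec * Hc \<in> carrier_mat m m"
      using B G1 C G2 Hc Bc Ec by auto
    have "d \<cdot>\<^sub>m E = four_block_mat (d \<cdot>\<^sub>m (B * (G1 * C))) (d \<cdot>\<^sub>m (B * (G2 * Hc))) (d \<cdot>\<^sub>m (Bc * C)) (d \<cdot>\<^sub>m (Ec * Hc))"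
      unfolding E_def by (rule smult_four_block_mat[OF E1 E2 E3 E4])
    then have "M0 + d \<cdot>\<^sub>m E = four_block_mat (A + d \<cdot>\<^sub>m (B * (G1 * C))) (B * Fc + d \<cdot>\<^sub>m (B * (G2 * Hc)))
        (0\<^sub>m m n + d \<cdot>\<^sub>m (Bc * C)) (Ac + d \<cdot>\<^sub>m (Ec * Hc))"
      unfolding M0_def using add_four_block_mat[OF A BFc zero_carrier_mat Ac, of "d \<cdot>\<^sub>m (B * (G1 * C))"
        "d \<cdot>\<^sub>m (B * (G2 * Hc))" "d \<cdot>\<^sub>m (Bc * C)" "d \<cdot>\<^sub>m (Ec * Hc)"] E1 E2 E3 E4 by simp
    also have "d \<cdot>\<^sub>m (B * (G1 * C)) = B * (d \<cdot>\<^sub>m (G1 * C))"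
      by (rule mult_smult_distrib[OF B mult_carrier_mat[OF G1 C], symmetric])
    also have "B * Fc + d \<cdot>\<^sub>m (B * (G2 * Hc)) = B * (Fc + d \<cdot>\<^sub>m (G2 * Hc))"
      using mult_smult_distrib[OF B mult_carrier_mat[OF G2 Hc], of d]
        mult_add_distrib_mat[OF B Fc, of "d \<cdot>\<^sub>m (G2 * Hc)"] G2 Hc by simp
    also have "0\<^sub>m m n + d \<cdot>\<^sub>m (Bc * C) = d \<cdot>\<^sub>m (Bc * C)" using H by simp
    finally show ?thesis by (simp add: M_def)
  qed
  have E: "E \<in> carrier_mat (n + m) (n + m)"
    unfolding E_def using B G1 C Ec Hc by (intro four_block_carrier_mat) auto
  have conv: "(\<lambda>k. M (\<delta> k) $$ (i, j)) \<longlonglongrightarrow> M0 $$ (i, j)" if ij: "i < n + m" "j < n + m" for i j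
  proof -
    have "(\<lambda>k. M0 $$ (i, j) + \<delta> k * E $$ (i, j)) \<longlonglongrightarrow> M0 $$ (i, j) + 0 * E $$ (i, j)"
      by (intro tendsto_intros \<delta>_lim)
    then show ?thesis using ij E M0 by (simp add: M_eq)
  qed
  have "\<exists>K. \<forall>t. \<bar>(A ^\<^sub>m t) $$ (i, j)\<bar> \<le> K * real (Suc t) ^ (n + m)" if ij: "i < n" "j < n" for i j
  proof -
    have "\<exists>K. \<forall>t. \<bar>(M0 ^\<^sub>m t) $$ (i, j)\<bar> \<le> K * real (Suc t) ^ (n + m)"
      by (rule pow_mat_limit_poly_growth[OF Mc M0 conv _ _ decay[OF \<delta>]]) (use ij in auto)
    then show ?thesis unfolding M0_def using pow_block_upper_triangular[OF A BFc Ac ij] by simp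
  qed
  then obtain K where K: "\<And>i j t. i < n \<Longrightarrow> j < n \<Longrightarrow> \<bar>(A ^\<^sub>m t) $$ (i, j)\<bar> \<le> K i j * real (Suc t) ^ (n + m)"
    by metis
  \<comment> \<open>One constant for all entries, as the eigenvalue bound requires.\<close>
  define K' where "K' = (\<Sum>i<n. \<Sum>j<n. \<bar>K i j\<bar>)"
  have "\<bar>(A ^\<^sub>m t) $$ (i, j)\<bar> \<le> K' * real (Suc t) ^ (n + m)" if ij: "i < n" "j < n" for i j t
  proof -
    have "\<bar>K i j\<bar> \<le> (\<Sum>j<n. \<bar>K i j\<bar>)" by (rule member_le_sum) (use ij in auto)
    also have "\<dots> \<le> K'" unfolding K'_def
      by (rule member_le_sum[where f = "\<lambda>i. \<Sum>j<n. \<bar>K i j\<bar>"]) (use ij in \<open>auto intro: sum_nonneg\<close>)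
    finally have "K i j * real (Suc t) ^ (n + m) \<le> K' * real (Suc t) ^ (n + m)"
      by (intro mult_right_mono) auto
    with K[OF ij, of t] show ?thesis by linarith
  qed
  from eigenvalue_le_1_of_pow_poly_bound[OF A this ev] show "cmod z \<le> 1" .
qed

section \<open>Sufficiency\<close>

lemma sum_abs_mult_mat_vec_le:
  fixes K :: "real mat"
  assumes K: "K \<in> carrier_mat k n" and v: "v \<in> carrier_vec n"
    and b: "\<And>i j. i < k \<Longrightarrow> j < n \<Longrightarrow> \<bar>K $$ (i, j)\<bar> \<le> b"
  shows "(\<Sum>i<k. \<bar>(K *\<^sub>v v) $ i\<bar>) \<le> real k * (b * (\<Sum>j<n. \<bar>v $ j\<bar>))"
proof -
  have "\<bar>(K *\<^sub>v v) $ i\<bar> \<le> b * (\<Sum>j<n. \<bar>v $ j\<bar>)" if i: "i < k" for i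
  proof -
    have "(K *\<^sub>v v) $ i = (\<Sum>j<n. K $$ (i, j) * v $ j)"
      using K v i by (simp add: scalar_prod_def lessThan_atLeast0)
    also have "\<bar>\<dots>\<bar> \<le> (\<Sum>j<n. \<bar>K $$ (i, j) * v $ j\<bar>)" by (rule sum_abs)
    also have "\<dots> \<le> (\<Sum>j<n. b * \<bar>v $ j\<bar>)"
      by (intro sum_mono) (use b[OF i] in \<open>auto simp: abs_mult intro!: mult_right_mono\<close>)
    finally show ?thesis by (simp add: sum_distrib_left)
  qed
  then have "(\<Sum>i<k. \<bar>(K *\<^sub>v v) $ i\<bar>) \<le> (\<Sum>i<k. b * (\<Sum>j<n. \<bar>v $ j\<bar>))" by (intro sum_mono) auto
  then show ?thesis by simp
qed

lemma tendsto_of_sum_abs_tendsto_0: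
  fixes y :: "nat \<Rightarrow> nat \<Rightarrow> real"
  assumes "(\<lambda>t. \<Sum>k<n. \<bar>y t k\<bar>) \<longlonglongrightarrow> 0" and "k < n"
  shows "(\<lambda>t. y t k) \<longlonglongrightarrow> 0"
proof (rule tendsto_rabs_zero_cancel, rule tendsto_sandwich[OF _ _ tendsto_const assms(1)])
  show "\<forall>\<^sub>F t in sequentially. \<bar>y t k\<bar> \<le> (\<Sum>k<n. \<bar>y t k\<bar>)"
    by (intro always_eventually allI member_le_sum) (use assms(2) in auto)
qed simp

text \<open>\<open>P ^ q y(t + 1) = P ^ (q + 1) y(t) + P ^ q r(t)\<close> is the shifted recursion
  with a geometric kernel, so no variation-of-constants sum is needed.\<close>

lemma schur_stable_forced_tendsto_0:
  fixes y r :: "nat \<Rightarrow> real vec"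
  assumes P: "P \<in> carrier_mat n n" and schur: "schur_stable P"
    and y: "\<And>t. y t \<in> carrier_vec n" and r: "\<And>t. r t \<in> carrier_vec n"
    and step: "\<And>t. y (Suc t) = P *\<^sub>v y t + r t"
    and lim: "\<And>k. k < n \<Longrightarrow> (\<lambda>t. r t $ k) \<longlonglongrightarrow> 0"
    and k: "k < n"
  shows "(\<lambda>t. y t $ k) \<longlonglongrightarrow> 0"
proof -
  from schur_stable_pow_bound[OF P schur] obtain c \<sigma> where c: "0 \<le> c" and \<sigma>: "0 < \<sigma>" "\<sigma> < 1"
    and bound: "\<And>q i j. i < n \<Longrightarrow> j < n \<Longrightarrow> \<bar>(P ^\<^sub>m q) $$ (i, j)\<bar> \<le> c * \<sigma> ^ q" by blast
  have Pq: "P ^\<^sub>m q \<in> carrier_mat n n" for q using P by simp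
  define w where "w t = (\<Sum>l<n. \<bar>r t $ l\<bar>)" for t
  define y0 where "y0 = (\<Sum>l<n. \<bar>y 0 $ l\<bar>)"
  define f where "f q t = (\<Sum>k<n. \<bar>(P ^\<^sub>m q *\<^sub>v y t) $ k\<bar>)" for q t
  \<comment> \<open>The 1 covers the forcing kernel and \<open>y0\<close> the initial value, so that
    one constant serves both hypotheses of the shifted recursion.\<close>
  define c' where "c' = real n * c * (1 + y0)"
  have y0: "0 \<le> y0" and w: "0 \<le> w t" for t by (auto simp: y0_def w_def intro: sum_nonneg)
  have "f 0 \<longlonglongrightarrow> 0"
  proof (rule null_sequence_of_shifted_recursion[where c = c' and \<sigma> = \<sigma> and w = w])
    fix q t
    have eq: "P ^\<^sub>m q *\<^sub>v y (Suc t) = P ^\<^sub>m Suc q *\<^sub>v y t + P ^\<^sub>m q *\<^sub>v r t"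
      unfolding step mult_add_distrib_mat_vec[OF Pq mult_mat_vec_carrier[OF P y] r]
      using assoc_mult_mat_vec[OF Pq P y] by simp
    have "f q (Suc t) \<le> (\<Sum>k<n. \<bar>(P ^\<^sub>m Suc q *\<^sub>v y t) $ k\<bar> + \<bar>(P ^\<^sub>m q *\<^sub>v r t) $ k\<bar>)"
      unfolding f_def eq using carrier_matD(1)[OF Pq, of q] P by (intro sum_mono) auto
    also have "\<dots> = f (Suc q) t + (\<Sum>k<n. \<bar>(P ^\<^sub>m q *\<^sub>v r t) $ k\<bar>)"
      unfolding f_def by (rule sum.distrib)
    also have "(\<Sum>k<n. \<bar>(P ^\<^sub>m q *\<^sub>v r t) $ k\<bar>) \<le> real n * (c * \<sigma> ^ q * w t)"
      unfolding w_def by (rule sum_abs_mult_mat_vec_le[OF Pq r bound])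
    also have "real n * (c * \<sigma> ^ q * w t) \<le> c' * \<sigma> ^ q * w t"
    proof -
      have "real n * c * 1 \<le> c'" unfolding c'_def using c y0 by (intro mult_left_mono) auto
      then have "(real n * c * 1) * (\<sigma> ^ q * w t) \<le> c' * (\<sigma> ^ q * w t)"
        using \<sigma> w by (intro mult_right_mono) auto
      then show ?thesis by (simp add: mult.assoc)
    qed
    finally show "f q (Suc t) \<le> f (Suc q) t + c' * \<sigma> ^ q * w t" by simp
    have "f q 0 \<le> real n * (c * \<sigma> ^ q * y0)"
      unfolding f_def y0_def by (rule sum_abs_mult_mat_vec_le[OF Pq y bound])
    also have "\<dots> \<le> c' * \<sigma> ^ q"
      using c \<sigma> by (simp add: c'_def algebra_simps)
    finally show "f q 0 \<le> c' * \<sigma> ^ q" .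
  next
    have "w \<longlonglongrightarrow> (\<Sum>l<n. \<bar>0\<bar>)" unfolding w_def by (intro tendsto_sum tendsto_rabs lim) auto
    then show "w \<longlonglongrightarrow> 0" by simp
    show "0 \<le> c'" using c y0 by (simp add: c'_def)
  qed (use \<sigma> w in \<open>auto simp: f_def intro: sum_nonneg\<close>)
  moreover have "f 0 = (\<lambda>t. \<Sum>k<n. \<bar>y t $ k\<bar>)"
    using P one_mult_mat_vec[OF y] by (auto simp: f_def)
  ultimately have "(\<lambda>t. \<Sum>k<n. \<bar>y t $ k\<bar>) \<longlonglongrightarrow> 0" by simp
  then show ?thesis using k by (rule tendsto_of_sum_abs_tendsto_0)
qed

text \<open>The disagreement contracts geometrically under averaging, which beats every subexponential
  growth of the powers of \<open>A\<close>.\<close>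

lemma averaged_dynamics_agree:
  fixes A D :: "real mat" and X R :: "nat \<Rightarrow> real mat"
  assumes A: "A \<in> carrier_mat n n" and D: "D \<in> carrier_mat N N"
    and X: "\<And>t. X t \<in> carrier_mat n N" and R: "\<And>t. R t \<in> carrier_mat n N"
    and step: "\<And>t. X (Suc t) = A * (X t * D\<^sup>T + R t)"
    and ev: "\<And>z. eigenvalue (map_mat complex_of_real A) z \<Longrightarrow> cmod z \<le> 1"
    and \<sigma>: "0 < \<sigma>" "\<sigma> < 1" and c: "0 \<le> c"
    and merge: "\<And>q i j l. i < N \<Longrightarrow> j < N \<Longrightarrow> l < N \<Longrightarrow> \<bar>(D ^\<^sub>m q) $$ (i, l) - (D ^\<^sub>m q) $$ (j, l)\<bar> \<le> c * \<sigma> ^ q"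
    and lim: "\<And>k i. k < n \<Longrightarrow> i < N \<Longrightarrow> (\<lambda>t. R t $$ (k, i)) \<longlonglongrightarrow> 0"
    and ij: "i < N" "j < N" and k: "k < n"
  shows "(\<lambda>t. X t $$ (k, i) - X t $$ (k, j)) \<longlonglongrightarrow> 0"
proof -
  \<comment> \<open>The midpoint of 1 and \<open>1 / \<sigma>\<close>: it exceeds 1, so the powers
    of \<open>A\<close> are bounded by multiples of \<open>s ^ q\<close>, and still
    \<open>s * \<sigma> < 1\<close>.\<close>
  define s where "s = (1 + 1 / \<sigma>) / 2"
  have s: "1 < s" using \<sigma> by (simp add: s_def field_simps)
  have "s * \<sigma> = (\<sigma> + 1) / 2" using \<sigma> by (simp add: s_def field_simps)
  then have s\<sigma>: "0 < s * \<sigma>" "s * \<sigma> < 1" using \<sigma> by auto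
  from real_pow_mat_bound_of_eigenvalue_bound[OF A ev _ s] obtain a where a: "0 \<le> a"
    and bound: "\<And>q i j. i < n \<Longrightarrow> j < n \<Longrightarrow> \<bar>(A ^\<^sub>m q) $$ (i, j)\<bar> \<le> a * s ^ q" by auto
  have Aq: "A ^\<^sub>m q \<in> carrier_mat n n" for q using A by simp
  have Dt: "D\<^sup>T \<in> carrier_mat N N" using D by simp
  have Dtq: "(D\<^sup>T) ^\<^sub>m q \<in> carrier_mat N N" for q using Dt by simp
  \<comment> \<open>\<open>X h\<close> is the difference of columns \<open>i\<close> and
    \<open>j\<close>, and applying powers of \<open>D\<^sup>T\<close> to \<open>h\<close> produces
    the row differences of the powers of \<open>D\<close>, which shrink geometrically.\<close>
  define h :: "real vec" where "h = unit_vec N i - unit_vec N j"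
  have h: "h \<in> carrier_vec N" by (simp add: h_def)
  define g where "g q = (D\<^sup>T) ^\<^sub>m q *\<^sub>v h" for q
  have g: "g q \<in> carrier_vec N" for q unfolding g_def by (rule mult_mat_vec_carrier[OF Dtq h])
  have gS: "g (Suc q) = D\<^sup>T *\<^sub>v g q" for q
    unfolding g_def pow_mat_Suc_left[OF Dt] by (rule assoc_mult_mat_vec[OF Dt Dtq h])
  have g_entry: "g q $ l = (D ^\<^sub>m q) $$ (i, l) - (D ^\<^sub>m q) $$ (j, l)" if l: "l < N" for q l
  proof -
    have "g q = (D\<^sup>T) ^\<^sub>m q *\<^sub>v unit_vec N i - (D\<^sup>T) ^\<^sub>m q *\<^sub>v unit_vec N j"
      unfolding g_def h_def by (rule mult_minus_distrib_mat_vec[OF Dtq]) auto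
    then have "g q $ l = ((D\<^sup>T) ^\<^sub>m q) $$ (l, i) - ((D\<^sup>T) ^\<^sub>m q) $$ (l, j)"
      using l ij carrier_matD[OF Dtq, of q] by simp
    then show ?thesis
      using l ij carrier_matD[OF pow_carrier_mat[OF D], of q] unfolding transpose_pow_mat[OF D] by simp
  qed
  have gsum: "(\<Sum>l<n. \<bar>(Y *\<^sub>v g q) $ l\<bar>) \<le> c * \<sigma> ^ q * (\<Sum>l<n. \<Sum>m<N. \<bar>Y $$ (l, m)\<bar>)"
    if Y: "Y \<in> carrier_mat n N" for Y q
  proof -
    have "\<bar>(Y *\<^sub>v g q) $ l\<bar> \<le> (\<Sum>m<N. \<bar>Y $$ (l, m)\<bar> * (c * \<sigma> ^ q))" if l: "l < n" for l
    proof -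
      have "(Y *\<^sub>v g q) $ l = (\<Sum>m<N. Y $$ (l, m) * g q $ m)"
        using Y l carrier_vecD[OF g, of q] by (simp add: scalar_prod_def lessThan_atLeast0)
      also have "\<bar>\<dots>\<bar> \<le> (\<Sum>m<N. \<bar>Y $$ (l, m) * g q $ m\<bar>)" by (rule sum_abs)
      also have "\<dots> \<le> (\<Sum>m<N. \<bar>Y $$ (l, m)\<bar> * (c * \<sigma> ^ q))"
        by (intro sum_mono) (use merge[OF ij] g_entry in \<open>auto simp: abs_mult intro!: mult_left_mono\<close>)
      finally show ?thesis .
    qed
    then have "(\<Sum>l<n. \<bar>(Y *\<^sub>v g q) $ l\<bar>) \<le> (\<Sum>l<n. \<Sum>m<N. \<bar>Y $$ (l, m)\<bar> * (c * \<sigma> ^ q))"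
      by (intro sum_mono) auto
    then show ?thesis by (simp add: sum_distrib_left mult_ac)
  qed
  define W where "W Y = (\<Sum>l<n. \<Sum>m<N. \<bar>Y $$ (l, m)\<bar>)" for Y :: "real mat"
  have W: "0 \<le> W Y" for Y unfolding W_def by (intro sum_nonneg) auto
  \<comment> \<open>Each time step moves one factor \<open>A\<close> to the left and one factor
    \<open>D\<^sup>T\<close> to the right of \<open>X\<close>; a single index counts both, so growth
    is weighed against contraction.\<close>
  define f where "f q t = (\<Sum>k<n. \<bar>(A ^\<^sub>m q *\<^sub>v (X t *\<^sub>v g q)) $ k\<bar>)" for q t
  \<comment> \<open>\<open>s\<close> serves the forcing, which passes through one more
    \<open>A\<close> than \<open>D\<^sup>T\<close>; \<open>W (X 0)\<close> serves the initial
    value.\<close>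
  define c' where "c' = real n * a * c * (s + W (X 0))"
  have kernel: "(\<Sum>k<n. \<bar>(A ^\<^sub>m p *\<^sub>v (Y *\<^sub>v g q)) $ k\<bar>) \<le> real n * a * c * (s ^ p * \<sigma> ^ q * W Y)"
    if Y: "Y \<in> carrier_mat n N" for p q Y
  proof -
    have "(\<Sum>k<n. \<bar>(A ^\<^sub>m p *\<^sub>v (Y *\<^sub>v g q)) $ k\<bar>) \<le> real n * (a * s ^ p * (\<Sum>l<n. \<bar>(Y *\<^sub>v g q) $ l\<bar>))"
      by (rule sum_abs_mult_mat_vec_le[OF Aq mult_mat_vec_carrier[OF Y g] bound])
    also have "\<dots> \<le> real n * (a * s ^ p * (c * \<sigma> ^ q * W Y))"
      using gsum[OF Y, of q] a s unfolding W_def by (intro mult_left_mono) auto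
    finally show ?thesis by (simp add: mult_ac)
  qed
  have "f 0 \<longlonglongrightarrow> 0"
  proof (rule null_sequence_of_shifted_recursion[where c = c' and \<sigma> = "s * \<sigma>" and w = "\<lambda>t. W (R t)"])
    fix q t
    have XD: "X t * D\<^sup>T \<in> carrier_mat n N" by (rule mult_carrier_mat[OF X Dt])
    have "X (Suc t) *\<^sub>v g q = A *\<^sub>v ((X t * D\<^sup>T + R t) *\<^sub>v g q)"
      unfolding step by (rule assoc_mult_mat_vec[OF A add_carrier_mat[OF R] g])
    also have "(X t * D\<^sup>T + R t) *\<^sub>v g q = X t *\<^sub>v g (Suc q) + R t *\<^sub>v g q"
      unfolding add_mult_distrib_mat_vec[OF XD R g] gS assoc_mult_mat_vec[OF X Dt g] ..
    finally have "A ^\<^sub>m q *\<^sub>v (X (Suc t) *\<^sub>v g q) = A ^\<^sub>m Suc q *\<^sub>v (X t *\<^sub>v g (Suc q) + R t *\<^sub>v g q)"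
      using assoc_mult_mat_vec[OF Aq A add_carrier_vec[OF mult_mat_vec_carrier[OF X g] mult_mat_vec_carrier[OF R g]]]
      by simp
    also have "\<dots> = A ^\<^sub>m Suc q *\<^sub>v (X t *\<^sub>v g (Suc q)) + A ^\<^sub>m Suc q *\<^sub>v (R t *\<^sub>v g q)"
      by (rule mult_add_distrib_mat_vec[OF Aq mult_mat_vec_carrier[OF X g] mult_mat_vec_carrier[OF R g]])
    finally have eq: "A ^\<^sub>m q *\<^sub>v (X (Suc t) *\<^sub>v g q)
      = A ^\<^sub>m Suc q *\<^sub>v (X t *\<^sub>v g (Suc q)) + A ^\<^sub>m Suc q *\<^sub>v (R t *\<^sub>v g q)" .
    have "f q (Suc t) \<le> (\<Sum>k<n. \<bar>(A ^\<^sub>m Suc q *\<^sub>v (X t *\<^sub>v g (Suc q))) $ k\<bar> + \<bar>(A ^\<^sub>m Suc q *\<^sub>v (R t *\<^sub>v g q)) $ k\<bar>)"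
      unfolding f_def eq using carrier_matD(1)[OF Aq, of "Suc q"] by (intro sum_mono) auto
    also have "\<dots> = f (Suc q) t + (\<Sum>k<n. \<bar>(A ^\<^sub>m Suc q *\<^sub>v (R t *\<^sub>v g q)) $ k\<bar>)"
      unfolding f_def by (rule sum.distrib)
    also have "(\<Sum>k<n. \<bar>(A ^\<^sub>m Suc q *\<^sub>v (R t *\<^sub>v g q)) $ k\<bar>) \<le> real n * a * c * (s ^ Suc q * \<sigma> ^ q * W (R t))"
      by (rule kernel[OF R])
    also have "\<dots> = (real n * a * c * s) * ((s * \<sigma>) ^ q * W (R t))" by (simp add: power_mult_distrib mult_ac)
    also have "\<dots> \<le> c' * ((s * \<sigma>) ^ q * W (R t))"
      unfolding c'_def using a c s s\<sigma> W by (intro mult_right_mono mult_left_mono) auto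
    finally show "f q (Suc t) \<le> f (Suc q) t + c' * (s * \<sigma>) ^ q * W (R t)" by (simp add: mult.assoc)
    have "f q 0 \<le> real n * a * c * (s ^ q * \<sigma> ^ q * W (X 0))" unfolding f_def by (rule kernel[OF X])
    also have "\<dots> = (real n * a * c * W (X 0)) * (s * \<sigma>) ^ q" by (simp add: power_mult_distrib mult_ac)
    also have "\<dots> \<le> c' * (s * \<sigma>) ^ q"
      unfolding c'_def using a c s s\<sigma> by (intro mult_right_mono mult_left_mono) auto
    finally show "f q 0 \<le> c' * (s * \<sigma>) ^ q" .
  next
    have "(\<lambda>t. W (R t)) \<longlonglongrightarrow> (\<Sum>l<n. \<Sum>m<N. \<bar>0\<bar>)" unfolding W_def by (intro tendsto_sum tendsto_rabs lim) auto
    then show "(\<lambda>t. W (R t)) \<longlonglongrightarrow> 0" by simp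
    show "0 \<le> c'" using a c s W[of "X 0"] by (simp add: c'_def)
  qed (use s\<sigma> W in \<open>auto simp: f_def intro: sum_nonneg\<close>)
  moreover have "f 0 = (\<lambda>t. \<Sum>k<n. \<bar>X t $$ (k, i) - X t $$ (k, j)\<bar>)"
  proof
    fix t
    have g0: "g 0 = h" unfolding g_def using Dt h by simp
    have "A ^\<^sub>m 0 *\<^sub>v (X t *\<^sub>v h) = X t *\<^sub>v h" using A mult_mat_vec_carrier[OF X h, of t] by simp
    moreover have "X t *\<^sub>v h = X t *\<^sub>v unit_vec N i - X t *\<^sub>v unit_vec N j"
      unfolding h_def by (rule mult_minus_distrib_mat_vec[OF X]) auto
    ultimately show "f 0 t = (\<Sum>k<n. \<bar>X t $$ (k, i) - X t $$ (k, j)\<bar>)"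
      unfolding f_def g0 using carrier_matD[OF X, of t] ij by (intro sum.cong) auto
  qed
  ultimately have "(\<lambda>t. \<Sum>k<n. \<bar>X t $$ (k, i) - X t $$ (k, j)\<bar>) \<longlonglongrightarrow> 0" by simp
  then show ?thesis using k by (rule tendsto_of_sum_abs_tendsto_0)
qed

section \<open>The averaging matrix of the network\<close>

definition averaging_mat :: "nat \<Rightarrow> (nat \<Rightarrow> nat \<Rightarrow> real) \<Rightarrow> real mat" where
  "averaging_mat N d =
     mat N N (\<lambda>(i, j). if i = j then 1 - (\<Sum>k\<in>{k. k < N \<and> k \<noteq> i}. d i k) else d i j)"

lemma averaging_mat_carrier: "averaging_mat N d \<in> carrier_mat N N"
  by (simp add: averaging_mat_def)

text \<open>The matrix is the identity minus the weighted Laplacian of \<open>d\<close>. In this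
  form it meets the \<open>coupling\<close> terms of the error dynamics, and a constant
  \<open>v\<close> gives row sums 1.\<close>

lemma averaging_mat_row_sum:
  assumes i: "i < N"
  shows "(\<Sum>j<N. averaging_mat N d $$ (i, j) * v j) = v i - (\<Sum>j\<in>{j. j < N \<and> j \<noteq> i}. d i j * (v i - v j))"
proof -
  have set: "{..<N} = insert i {j. j < N \<and> j \<noteq> i}" using i by auto
  have "(\<Sum>j<N. averaging_mat N d $$ (i, j) * v j) =
    averaging_mat N d $$ (i, i) * v i + (\<Sum>j\<in>{j. j < N \<and> j \<noteq> i}. averaging_mat N d $$ (i, j) * v j)"
    unfolding set by (rule sum.insert) auto
  also have "(\<Sum>j\<in>{j. j < N \<and> j \<noteq> i}. averaging_mat N d $$ (i, j) * v j) = (\<Sum>j\<in>{j. j < N \<and> j \<noteq> i}. d i j * v j)"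
    using i by (intro sum.cong) (auto simp: averaging_mat_def)
  finally show ?thesis
    using i by (simp add: averaging_mat_def left_diff_distrib right_diff_distrib sum_subtractf sum_distrib_right)
qed

text \<open>The 1 in \<open>1 + q i\<close> keeps the off-diagonal row sums below 1, hence the
  diagonal positive. Edges of the graph are never loops, so they survive as positive off-diagonal
  entries.\<close>

lemma averaging_mat_rows_merge:
  assumes graph: "weighted_graph N a" and tree: "has_spanning_tree N a"
    and q: "\<forall>i<N. q i \<ge> (\<Sum>j<N. a i j)" and d: "d = (\<lambda>i j. a i j / (1 + q i))"
  shows "\<exists>c \<sigma>. 0 \<le> c \<and> 0 < \<sigma> \<and> \<sigma> < 1 \<and> (\<forall>t. \<forall>i<N. \<forall>k<N. \<forall>j<N.
    \<bar>(averaging_mat N d ^\<^sub>m t) $$ (i, j) - (averaging_mat N d ^\<^sub>m t) $$ (k, j)\<bar> \<le> c * \<sigma> ^ t)"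
proof -
  let ?D = "averaging_mat N d"
  have a: "0 \<le> a i j" "a i i = 0" if "i < N" "j < N" for i j
    using graph that unfolding weighted_graph_def by auto
  have sum_a: "(\<Sum>j\<in>{j. j < N \<and> j \<noteq> i}. a i j) \<le> q i" and q0: "0 \<le> q i" if i: "i < N" for i
  proof -
    have "(\<Sum>j\<in>{j. j < N \<and> j \<noteq> i}. a i j) \<le> (\<Sum>j<N. a i j)"
      by (rule sum_mono2) (use a i in auto)
    then show "(\<Sum>j\<in>{j. j < N \<and> j \<noteq> i}. a i j) \<le> q i" using q i by force
    have "0 \<le> (\<Sum>j<N. a i j)" by (rule sum_nonneg) (use a i in auto)
    then show "0 \<le> q i" using q i by force
  qed
  have diag: "0 < ?D $$ (i, i)" if i: "i < N" for i
  proof -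
    have "(\<Sum>k\<in>{k. k < N \<and> k \<noteq> i}. d i k) = (\<Sum>k\<in>{k. k < N \<and> k \<noteq> i}. a i k) / (1 + q i)"
      by (simp add: d sum_divide_distrib)
    also have "\<dots> < 1" using sum_a[OF i] q0[OF i] by (simp add: divide_simps)
    finally show ?thesis using i by (simp add: averaging_mat_def)
  qed
  have off: "?D $$ (i, j) = d i j" if "i < N" "j < N" "i \<noteq> j" for i j
    using that by (simp add: averaging_mat_def)
  from tree obtain r where r: "r < N" "\<And>k. k < N \<Longrightarrow> (r, k) \<in> {(j, i). i < N \<and> j < N \<and> a i j > 0}\<^sup>*"
    unfolding has_spanning_tree_def by blast
  have sub: "{(j, i). i < N \<and> j < N \<and> a i j > 0} \<subseteq> {(j, i). i < N \<and> j < N \<and> 0 < ?D $$ (i, j)}"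
  proof clarify
    fix j i assume h: "i < N" "j < N" "a i j > 0"
    then have "i \<noteq> j" using a(2) by force
    from off[OF h(1,2) this] show "0 < ?D $$ (i, j)" using h q0[OF h(1)] by (simp only: d) simp
  qed
  show ?thesis
  proof (rule stochastic_pow_rows_merge[OF averaging_mat_carrier _ _ diag r(1)])
    fix i j assume ij: "i < N" "j < N"
    show "0 \<le> ?D $$ (i, j)"
    proof (cases "i = j")
      case True
      then show ?thesis using diag[OF ij(1)] by simp
    next
      case False
      from off[OF ij this] show ?thesis using a(1)[OF ij] q0[OF ij(1)] by (simp only: d) simp
    qed
  next
    fix i assume "i < N"
    from averaging_mat_row_sum[OF this, of d "\<lambda>_. 1"] show "(\<Sum>j<N. ?D $$ (i, j)) = 1" by simp
  next
    fix k assume "k < N"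
    from rtrancl_mono[OF sub] r(2)[OF this]
    show "(r, k) \<in> {(j, i). i < N \<and> j < N \<and> 0 < ?D $$ (i, j)}\<^sup>*" by (rule subsetD)
  qed
qed

section \<open>Coupling commutes with linear maps\<close>

lemma coupling_carrier: "coupling N d i w k \<in> carrier_vec k"
  by (simp add: coupling_def)

lemma coupling_index: "l < k \<Longrightarrow> coupling N d i w k $ l = (\<Sum>j\<in>{j. j < N \<and> j \<noteq> i}. d i j * (w i $ l - w j $ l))"
  by (simp add: coupling_def)

lemma coupling_cong:
  assumes "i < N" and "\<And>j. j < N \<Longrightarrow> v j = w j"
  shows "coupling N d i v k = coupling N d i w k"
  using assms unfolding coupling_def by (intro arg_cong[of _ _ "vec k"] ext sum.cong) auto

lemma coupling_add:
  assumes "i < N" and "\<And>j. j < N \<Longrightarrow> v j \<in> carrier_vec k" and "\<And>j. j < N \<Longrightarrow> w j \<in> carrier_vec k"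
  shows "coupling N d i (\<lambda>j. v j + w j) k = coupling N d i v k + coupling N d i w k"
proof (rule eq_vecI)
  fix l assume "l < dim_vec (coupling N d i v k + coupling N d i w k)"
  then have l: "l < k" by (simp add: coupling_def)
  have "(\<Sum>j\<in>{j. j < N \<and> j \<noteq> i}. d i j * ((v i + w i) $ l - (v j + w j) $ l)) =
    (\<Sum>j\<in>{j. j < N \<and> j \<noteq> i}. d i j * (v i $ l - v j $ l) + d i j * (w i $ l - w j $ l))"
    by (rule sum.cong) (use l carrier_vecD[OF assms(2)] carrier_vecD[OF assms(3)] assms(1) in \<open>auto simp: algebra_simps\<close>)
  then show "coupling N d i (\<lambda>j. v j + w j) k $ l = (coupling N d i v k + coupling N d i w k) $ l"
    using l carrier_vecD[OF coupling_carrier, of N d i w k] by (simp add: coupling_index sum.distrib)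
qed (simp add: coupling_def)

lemma coupling_mult_mat_vec:
  assumes K: "K \<in> carrier_mat k n" and "i < N" and w: "\<And>j. j < N \<Longrightarrow> w j \<in> carrier_vec n"
  shows "coupling N d i (\<lambda>j. K *\<^sub>v w j) k = K *\<^sub>v coupling N d i w n"
proof (rule eq_vecI)
  fix l assume "l < dim_vec (K *\<^sub>v coupling N d i w n)"
  then have l: "l < k" using K by simp
  have Kw: "(K *\<^sub>v v) $ l = (\<Sum>r<n. K $$ (l, r) * v $ r)" if "v \<in> carrier_vec n" for v
    using that K l by (simp add: scalar_prod_def lessThan_atLeast0)
  have "coupling N d i (\<lambda>j. K *\<^sub>v w j) k $ l
    = (\<Sum>j\<in>{j. j < N \<and> j \<noteq> i}. \<Sum>r<n. K $$ (l, r) * (d i j * (w i $ r - w j $ r)))"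
    unfolding coupling_index[OF l]
    by (rule sum.cong) (use w assms(2) in \<open>auto simp: Kw sum_distrib_left sum_subtractf[symmetric] algebra_simps\<close>)
  also have "\<dots> = (\<Sum>r<n. K $$ (l, r) * coupling N d i w n $ r)"
    by (subst sum.swap) (simp add: coupling_index sum_distrib_left)
  finally show "coupling N d i (\<lambda>j. K *\<^sub>v w j) k $ l = (K *\<^sub>v coupling N d i w n) $ l"
    by (simp add: Kw[OF coupling_carrier])
qed (use K in \<open>simp add: coupling_def\<close>)

section \<open>The observer-based protocol\<close>

definition pad_cols :: "nat \<Rightarrow> real mat \<Rightarrow> real mat" where
  "pad_cols n K = mat (dim_row K) (n + dim_col K) (\<lambda>(i, j). if j < n then 0 else K $$ (i, j - n))"

lemma pad_cols_carrier: "K \<in> carrier_mat k m \<Longrightarrow> pad_cols n K \<in> carrier_mat k (n + m)"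
  by (auto simp: pad_cols_def)

text \<open>The padded matrix reads the second half \<chi> of the stacked protocol state
  \<open>(xh, \<chi>)\<close>.\<close>

lemma pad_cols_mult_append:
  assumes K: "K \<in> carrier_mat k m" and a: "a \<in> carrier_vec n" and b: "b \<in> carrier_vec m"
  shows "pad_cols n K *\<^sub>v (a @\<^sub>v b) = K *\<^sub>v b"
proof (rule eq_vecI)
  fix i assume "i < dim_vec (K *\<^sub>v b)"
  then have i: "i < k" using K by simp
  have row: "row (pad_cols n K) i = 0\<^sub>v n @\<^sub>v row K i"
    using K i by (intro eq_vecI) (auto simp: pad_cols_def)
  have "(pad_cols n K *\<^sub>v (a @\<^sub>v b)) $ i = (0\<^sub>v n @\<^sub>v row K i) \<bullet> (a @\<^sub>v b)"
    using row i pad_cols_carrier[OF K, of n] by simp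
  also have "\<dots> = 0\<^sub>v n \<bullet> a + row K i \<bullet> b"
    by (rule scalar_prod_append[OF zero_carrier_vec _ a b]) (use K i in auto)
  finally show "(pad_cols n K *\<^sub>v (a @\<^sub>v b)) $ i = (K *\<^sub>v b) $ i" using a K i by simp
qed (use K pad_cols_carrier[OF K, of n] in auto)

text \<open>\<open>xh\<close> is a Luenberger observer for \<xi>, whose dynamics have the known
  input \<eta>. The correction \<open>A (xh - \<eta>)\<close> in the update of \<chi> approximates
  \<open>A (\<xi> - \<eta>)\<close>, where \<open>\<xi> - \<eta>\<close> is the coupling of the
  errors \<open>e\<close>; subtracting a coupling from \<open>e\<close> is averaging.\<close>

lemma observer_protocol_synchronizes:
  fixes A B C :: "real mat"
  assumes A: "A \<in> carrier_mat n n" and B: "B \<in> carrier_mat n 1" and C: "C \<in> carrier_mat 1 n"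
    and F: "F \<in> carrier_mat 1 n" and schurF: "schur_stable (A + B * F)"
    and K: "K \<in> carrier_mat n 1" and schurK: "schur_stable (A + K * C)"
    and ev: "\<And>z. eigenvalue (map_mat complex_of_real A) z \<Longrightarrow> cmod z \<le> 1"
    and graph: "weighted_graph N a" and tree: "has_spanning_tree N a"
    and q: "\<forall>i<N. q i \<ge> (\<Sum>j<N. a i j)" and d: "d = (\<lambda>i j. a i j / (1 + q i))"
    and x: "\<And>i t. i < N \<Longrightarrow> x i t \<in> carrier_vec n"
    and xh: "\<And>i t. i < N \<Longrightarrow> xh i t \<in> carrier_vec n"
    and \<chi>: "\<And>i t. i < N \<Longrightarrow> \<chi> i t \<in> carrier_vec n"
    and \<xi>: "\<And>i t. \<xi> i t = coupling N d i (\<lambda>j. x j t) n"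
    and \<eta>: "\<And>i t. \<eta> i t = coupling N d i (\<lambda>j. \<chi> j t) n"
    and xS: "\<And>i t. i < N \<Longrightarrow> x i (Suc t) = A *\<^sub>v x i t + (B * F) *\<^sub>v \<chi> i t"
    and xhS: "\<And>i t. i < N \<Longrightarrow> xh i (Suc t) = (A + K * C) *\<^sub>v xh i t - (K * C) *\<^sub>v \<xi> i t + (B * F) *\<^sub>v \<eta> i t"
    and \<chi>S: "\<And>i t. i < N \<Longrightarrow> \<chi> i (Suc t) = A *\<^sub>v xh i t + (A + B * F) *\<^sub>v \<chi> i t - A *\<^sub>v \<eta> i t"
    and ij: "i < N" "j < N" and k: "k < n"
  shows "(\<lambda>t. x i t $ k - x j t $ k) \<longlonglongrightarrow> 0"
proof -
  let ?D = "averaging_mat N d"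
  have BF: "B * F \<in> carrier_mat n n" and KC: "K * C \<in> carrier_mat n n" using B F K C by auto
  have P: "A + K * C \<in> carrier_mat n n" and Q: "A + B * F \<in> carrier_mat n n" using A BF KC by auto
  have \<xi>c: "\<xi> i t \<in> carrier_vec n" and \<eta>c: "\<eta> i t \<in> carrier_vec n" for i t
    by (simp_all add: \<xi> \<eta> coupling_carrier)
  have \<xi>S: "\<xi> i (Suc t) = A *\<^sub>v \<xi> i t + (B * F) *\<^sub>v \<eta> i t" if i: "i < N" for i t
  proof -
    have "\<xi> i (Suc t) = coupling N d i (\<lambda>j. A *\<^sub>v x j t + (B * F) *\<^sub>v \<chi> j t) n"
      unfolding \<xi> by (rule coupling_cong[OF i xS])
    also have "\<dots> = coupling N d i (\<lambda>j. A *\<^sub>v x j t) n + coupling N d i (\<lambda>j. (B * F) *\<^sub>v \<chi> j t) n"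
      by (rule coupling_add[OF i mult_mat_vec_carrier[OF A x] mult_mat_vec_carrier[OF BF \<chi>]])
    also have "coupling N d i (\<lambda>j. A *\<^sub>v x j t) n = A *\<^sub>v \<xi> i t"
      unfolding \<xi> by (rule coupling_mult_mat_vec[OF A i x])
    also have "coupling N d i (\<lambda>j. (B * F) *\<^sub>v \<chi> j t) n = (B * F) *\<^sub>v \<eta> i t"
      unfolding \<eta> by (rule coupling_mult_mat_vec[OF BF i \<chi>])
    finally show ?thesis .
  qed
  define r where "r i t = \<xi> i t - xh i t" for i t
  have r: "r i t \<in> carrier_vec n" if "i < N" for i t using xh[OF that, of t] \<xi>c[of i t] by (simp add: r_def)
  have rS: "r i (Suc t) = (A + K * C) *\<^sub>v r i t + 0\<^sub>v n" if i: "i < N" for i t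
  proof -
    have "(A + K * C) *\<^sub>v r i t = (A + K * C) *\<^sub>v \<xi> i t - (A + K * C) *\<^sub>v xh i t"
      unfolding r_def by (rule mult_minus_distrib_mat_vec[OF P \<xi>c xh[OF i]])
    moreover have "(A + K * C) *\<^sub>v \<xi> i t = A *\<^sub>v \<xi> i t + (K * C) *\<^sub>v \<xi> i t"
      by (rule add_mult_distrib_mat_vec[OF A KC \<xi>c])
    moreover have "A *\<^sub>v \<xi> i t \<in> carrier_vec n" "(K * C) *\<^sub>v \<xi> i t \<in> carrier_vec n"
      "(A + K * C) *\<^sub>v xh i t \<in> carrier_vec n" "(B * F) *\<^sub>v \<eta> i t \<in> carrier_vec n"
      by (rule mult_mat_vec_carrier[OF A \<xi>c] mult_mat_vec_carrier[OF KC \<xi>c]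
          mult_mat_vec_carrier[OF P xh[OF i]] mult_mat_vec_carrier[OF BF \<eta>c])+
    ultimately show ?thesis
      unfolding r_def[of i "Suc t"] \<xi>S[OF i] xhS[OF i]
      by (intro eq_vecI) (auto simp del: index_mult_mat_vec dim_mult_mat_vec)
  qed
  have r_lim: "(\<lambda>t. r i t $ k) \<longlonglongrightarrow> 0" if i: "i < N" and k: "k < n" for i k
    by (rule schur_stable_forced_tendsto_0[where y = "r i" and r = "\<lambda>_. 0\<^sub>v n",
          OF P schurK r[OF i] zero_carrier_vec rS[OF i] _ k]) simp
  define e where "e i t = x i t - \<chi> i t" for i t
  have e: "e i t \<in> carrier_vec n" if "i < N" for i t using x[OF that, of t] \<chi>[OF that, of t] by (simp add: e_def)
  define E where "E t = mat n N (\<lambda>(k, i). e i t $ k)" for t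
  define R where "R t = mat n N (\<lambda>(k, i). r i t $ k)" for t
  have E: "E t \<in> carrier_mat n N" and R: "R t \<in> carrier_mat n N" for t by (auto simp: E_def R_def)
  have Dt: "?D\<^sup>T \<in> carrier_mat N N" using averaging_mat_carrier by simp
  have ES: "E (Suc t) = A * (E t * ?D\<^sup>T + R t)" for t
  proof (rule eq_matI)
    have W: "E t * ?D\<^sup>T + R t \<in> carrier_mat n N" by (rule add_carrier_mat[OF R])
    fix k i assume "k < dim_row (A * (E t * ?D\<^sup>T + R t))" "i < dim_col (A * (E t * ?D\<^sup>T + R t))"
    then have k: "k < n" and i: "i < N" using A R[of t] by auto
    \<comment> \<open>Column \<open>i\<close> of the averaged error plus the observer error,
      \<open>e - (\<xi> - \<eta>) + (\<xi> - xh)\<close>, in which \<xi> cancels.\<close>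
    define w where "w = x i t - xh i t - \<chi> i t + \<eta> i t"
    have w: "w \<in> carrier_vec n" using x[OF i] xh[OF i] \<chi>[OF i] \<eta>c by (simp add: w_def)
    have "col (E t * ?D\<^sup>T + R t) i = w"
    proof (rule eq_vecI)
      fix l assume "l < dim_vec w"
      then have l: "l < n" using w by simp
      have dims: "dim_vec (x j t) = n" "dim_vec (\<chi> j t) = n" "dim_vec (xh j t) = n" if "j < N" for j
        using x[OF that, of t] \<chi>[OF that, of t] xh[OF that, of t] by auto
      have "(E t * ?D\<^sup>T) $$ (l, i) = (\<Sum>j<N. E t $$ (l, j) * ?D\<^sup>T $$ (j, i))"
        by (rule index_mult_mat_sum[OF E Dt l i])
      also have "\<dots> = (\<Sum>j<N. ?D $$ (i, j) * e j t $ l)"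
        using l i carrier_matD[OF averaging_mat_carrier[of N d]] by (intro sum.cong) (auto simp: E_def)
      also have "\<dots> = e i t $ l - (\<Sum>j\<in>{j. j < N \<and> j \<noteq> i}. d i j * (e i t $ l - e j t $ l))"
        by (rule averaging_mat_row_sum[OF i])
      also have "(\<Sum>j\<in>{j. j < N \<and> j \<noteq> i}. d i j * (e i t $ l - e j t $ l)) = \<xi> i t $ l - \<eta> i t $ l"
        unfolding \<xi> \<eta> coupling_index[OF l] sum_subtractf[symmetric]
        by (rule sum.cong) (use l i dims in \<open>auto simp: e_def algebra_simps\<close>)
      finally have ED: "(E t * ?D\<^sup>T) $$ (l, i) = e i t $ l - (\<xi> i t $ l - \<eta> i t $ l)" .
      have "col (E t * ?D\<^sup>T + R t) i $ l = (E t * ?D\<^sup>T) $$ (l, i) + R t $$ (l, i)"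
        using l i R[of t] W by simp
      also have "\<dots> = w $ l"
        unfolding ED using l i dims[OF i] carrier_vecD[OF \<xi>c, of i t] carrier_vecD[OF \<eta>c, of i t]
        by (simp add: R_def r_def e_def w_def)
      finally show "col (E t * ?D\<^sup>T + R t) i $ l = w $ l" .
    qed (use w carrier_matD[OF W] in simp)
    then have rhs: "(A * (E t * ?D\<^sup>T + R t)) $$ (k, i) = (A *\<^sub>v w) $ k"
      using k i A carrier_matD[OF W] by simp
    have Aw: "A *\<^sub>v w = A *\<^sub>v x i t - A *\<^sub>v xh i t - A *\<^sub>v \<chi> i t + A *\<^sub>v \<eta> i t"
    proof -
      have 1: "x i t - xh i t \<in> carrier_vec n" and 2: "x i t - xh i t - \<chi> i t \<in> carrier_vec n"
        using x[OF i] xh[OF i] \<chi>[OF i] by auto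
      show ?thesis
        unfolding w_def mult_add_distrib_mat_vec[OF A 2 \<eta>c] mult_minus_distrib_mat_vec[OF A 1 \<chi>[OF i]]
          mult_minus_distrib_mat_vec[OF A x[OF i] xh[OF i]] ..
    qed
    have Q\<chi>: "(A + B * F) *\<^sub>v \<chi> i t = A *\<^sub>v \<chi> i t + (B * F) *\<^sub>v \<chi> i t"
      by (rule add_mult_distrib_mat_vec[OF A BF \<chi>[OF i]])
    have dimv: "dim_vec (A *\<^sub>v v) = n" "dim_vec ((B * F) *\<^sub>v v) = n" for v
      using A B by auto
    have "e i (Suc t) $ k = (A *\<^sub>v w) $ k"
      unfolding Aw e_def xS[OF i] \<chi>S[OF i] Q\<chi> using k dimv
      by (simp del: index_mult_mat_vec dim_mult_mat_vec)
    then show "E (Suc t) $$ (k, i) = (A * (E t * ?D\<^sup>T + R t)) $$ (k, i)"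
      unfolding rhs using k i by (simp add: E_def)
  qed (use A E[of "Suc t"] R[of t] in auto)
  from averaging_mat_rows_merge[OF graph tree q d] obtain c \<sigma> where c: "0 \<le> c" and \<sigma>: "0 < \<sigma>" "\<sigma> < 1"
    and merge: "\<And>t i j l. i < N \<Longrightarrow> j < N \<Longrightarrow> l < N \<Longrightarrow>
      \<bar>(?D ^\<^sub>m t) $$ (i, l) - (?D ^\<^sub>m t) $$ (j, l)\<bar> \<le> c * \<sigma> ^ t" by blast
  have e_lim: "(\<lambda>t. e i t $ k - e j t $ k) \<longlonglongrightarrow> 0" if k: "k < n" for k
  proof -
    have "(\<lambda>t. E t $$ (k, i) - E t $$ (k, j)) \<longlonglongrightarrow> 0"
    proof (rule averaged_dynamics_agree[where X = E and R = R, OF A averaging_mat_carrier E R ES ev \<sigma> c merge _ ij k])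
      show "(\<lambda>t. R t $$ (k, i)) \<longlonglongrightarrow> 0" if "k < n" "i < N" for k i
        using r_lim[OF that(2,1)] that by (simp add: R_def)
    qed
    then show ?thesis using k ij by (simp add: E_def)
  qed
  \<comment> \<open>Writing \<open>\<chi> = x - e\<close> splits the difference of the two inputs
    into the feedback \<open>F y\<close> and a forcing by the difference of the errors.\<close>
  define y where "y t = x i t - x j t" for t
  define v where "v t = (B * F) *\<^sub>v (e j t - e i t)" for t
  have y: "y t \<in> carrier_vec n" for t using x[OF ij(1), of t] x[OF ij(2), of t] by (simp add: y_def)
  have eji: "e j t - e i t \<in> carrier_vec n" for t using e[OF ij(1), of t] e[OF ij(2), of t] by simp
  have v: "v t \<in> carrier_vec n" for t unfolding v_def by (rule mult_mat_vec_carrier[OF BF eji])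
  have yS: "y (Suc t) = (A + B * F) *\<^sub>v y t + v t" for t
  proof -
    let ?L = "B * F"
    have 1: "(A + ?L) *\<^sub>v y t = A *\<^sub>v x i t - A *\<^sub>v x j t + (?L *\<^sub>v x i t - ?L *\<^sub>v x j t)"
      unfolding y_def add_mult_distrib_mat_vec[OF A BF y[unfolded y_def]]
        mult_minus_distrib_mat_vec[OF A x[OF ij(1)] x[OF ij(2)]]
        mult_minus_distrib_mat_vec[OF BF x[OF ij(1)] x[OF ij(2)]] ..
    have 2: "v t = (?L *\<^sub>v x j t - ?L *\<^sub>v \<chi> j t) - (?L *\<^sub>v x i t - ?L *\<^sub>v \<chi> i t)"
      unfolding v_def mult_minus_distrib_mat_vec[OF BF e[OF ij(2)] e[OF ij(1)]]
      unfolding e_def mult_minus_distrib_mat_vec[OF BF x[OF ij(1)] \<chi>[OF ij(1)]]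
        mult_minus_distrib_mat_vec[OF BF x[OF ij(2)] \<chi>[OF ij(2)]] ..
    have dimv: "dim_vec (A *\<^sub>v v) = n" "dim_vec (?L *\<^sub>v v) = n" for v
      using A B by auto
    show ?thesis
      unfolding 1 2 unfolding y_def xS[OF ij(1)] xS[OF ij(2)]
      by (intro eq_vecI) (use dimv in \<open>auto simp del: index_mult_mat_vec dim_mult_mat_vec\<close>)
  qed
  have "(\<lambda>t. y t $ k) \<longlonglongrightarrow> 0"
  proof (rule schur_stable_forced_tendsto_0[where y = y and r = v, OF Q schurF y v yS _ k])
    fix k assume k: "k < n"
    have "v t $ k = (\<Sum>l<n. (B * F) $$ (k, l) * - (e i t $ l - e j t $ l))" for t
    proof -
      have "v t $ k = (\<Sum>l<n. (B * F) $$ (k, l) * (e j t - e i t) $ l)"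
        unfolding v_def using k carrier_matD[OF BF] carrier_vecD[OF eji, of t]
        by (simp add: scalar_prod_def lessThan_atLeast0 del: index_mult_mat index_minus_vec)
      also have "\<dots> = (\<Sum>l<n. (B * F) $$ (k, l) * - (e i t $ l - e j t $ l))"
        using carrier_vecD[OF e[OF ij(1)], of t] by (intro sum.cong) auto
      finally show ?thesis .
    qed
    moreover have "(\<lambda>t. \<Sum>l<n. (B * F) $$ (k, l) * - (e i t $ l - e j t $ l)) \<longlonglongrightarrow> (\<Sum>l<n. (B * F) $$ (k, l) * - 0)"
      by (intro tendsto_sum tendsto_mult tendsto_const tendsto_minus e_lim) auto
    ultimately show "(\<lambda>t. v t $ k) \<longlonglongrightarrow> 0" by simp
  qed
  then show ?thesis using k carrier_vecD[OF x[OF ij(1)]] carrier_vecD[OF x[OF ij(2)]] by (simp add: y_def)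
qed

lemma zero_mat_mult_vec:
  fixes v :: "'a :: semiring_0 vec"
  shows "v \<in> carrier_vec l \<Longrightarrow> 0\<^sub>m k l *\<^sub>v v = 0\<^sub>v k"
  by (intro eq_vecI) auto

lemma conditions_imp_solvable:
  fixes A B C :: "real mat"
  assumes A: "A \<in> carrier_mat n n" and B: "B \<in> carrier_mat n 1" and C: "C \<in> carrier_mat 1 n"
    and stab: "stabilizable A B" and det: "detectable C A"
    and ev: "\<And>z. eigenvalue (map_mat complex_of_real A) z \<Longrightarrow> cmod z \<le> 1"
  shows "scale_free_collab_solvable n A B C"
proof -
  from stab obtain F where F: "F \<in> carrier_mat 1 n" and schurF: "schur_stable (A + B * F)"
    unfolding stabilizable_def using A B by auto
  from det obtain K where K: "K \<in> carrier_mat n 1" and schurK: "schur_stable (A + K * C)"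
    unfolding detectable_def using A C by auto
  have BF: "B * F \<in> carrier_mat n n" and KC: "K * C \<in> carrier_mat n n" using B F K C by auto
  have P: "A + K * C \<in> carrier_mat n n" and Q: "A + B * F \<in> carrier_mat n n" using A BF KC by auto
  \<comment> \<open>The protocol state stacks \<open>xh\<close> over \<chi>. \<open>Hc\<close>
    transmits \<chi>, so that \<open>zh\<close> becomes \<eta>, and the input is
    \<open>F \<chi>\<close> with both direct gains 0.\<close>
  define Ac where "Ac = four_block_mat (A + K * C) (0\<^sub>m n n) A (A + B * F)"
  define Bc where "Bc = (- K) @\<^sub>r 0\<^sub>m n 1"
  define Ec where "Ec = (B * F) @\<^sub>r (- A)"
  define Fc where "Fc = pad_cols n F"
  define Hc where "Hc = pad_cols n (1\<^sub>m n)"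
  have Kn: "- K \<in> carrier_mat n 1" and An: "- A \<in> carrier_mat n n" using K A by auto
  have carriers: "Ac \<in> carrier_mat (n + n) (n + n)" "Bc \<in> carrier_mat (n + n) 1" "Ec \<in> carrier_mat (n + n) n"
    "Fc \<in> carrier_mat 1 (n + n)" "Hc \<in> carrier_mat n (n + n)"
    unfolding Ac_def Bc_def Ec_def Fc_def Hc_def
    by (rule four_block_carrier_mat[OF P Q] carrier_append_rows[OF Kn zero_carrier_mat]
        carrier_append_rows[OF BF An] pad_cols_carrier[OF F] pad_cols_carrier[OF one_carrier_mat])+
  have sync: "(\<lambda>t. x i t $ k - x j t $ k) \<longlonglongrightarrow> 0"
    if graph: "weighted_graph N a" and tree: "has_spanning_tree N a"
      and q: "\<forall>i<N. q i \<ge> (\<Sum>j<N. a i j)" and d: "d = (\<lambda>i j. a i j / (1 + q i))"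
      and init: "\<forall>i<N. x i 0 \<in> carrier_vec n \<and> xc i 0 \<in> carrier_vec (n + n)"
      and dyn: "\<forall>i<N. \<forall>t.
         x i (Suc t) = A *\<^sub>v x i t + B *\<^sub>v (Fc *\<^sub>v xc i t + 0\<^sub>m 1 1 *\<^sub>v coupling N d i (\<lambda>j. C *\<^sub>v x j t) 1
           + 0\<^sub>m 1 n *\<^sub>v coupling N d i (\<lambda>j. Hc *\<^sub>v xc j t) n) \<and>
         xc i (Suc t) = Ac *\<^sub>v xc i t + Bc *\<^sub>v coupling N d i (\<lambda>j. C *\<^sub>v x j t) 1
           + Ec *\<^sub>v coupling N d i (\<lambda>j. Hc *\<^sub>v xc j t) n"
      and ijk: "i < N" "j < N" "k < n"
    for N :: nat and a :: "nat \<Rightarrow> nat \<Rightarrow> real" and q d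
      and x xc :: "nat \<Rightarrow> nat \<Rightarrow> real vec" and i j k
  proof -
    \<comment> \<open>Dimensions are assumed at time 0 only; later ones come from the last summand
      of the dynamics.\<close>
    have x: "x i t \<in> carrier_vec n" and xc: "xc i t \<in> carrier_vec (n + n)" if i: "i < N" for i t
      using init dyn i A B carriers carrier_matD[OF carriers(3)]
      by (cases t; auto simp del: dim_mult_mat_vec intro!: carrier_vecI; simp)+
    define xh where "xh i t = vec_first (xc i t) n" for i t
    define \<chi> where "\<chi> i t = vec_last (xc i t) n" for i t
    have xh: "xh i t \<in> carrier_vec n" and \<chi>: "\<chi> i t \<in> carrier_vec n" for i t
      by (auto simp: xh_def \<chi>_def)
    have split: "xc i t = xh i t @\<^sub>v \<chi> i t" if "i < N" for i t
      using xc[OF that, of t] by (simp add: xh_def \<chi>_def)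
    define \<xi> where "\<xi> i t = coupling N d i (\<lambda>j. x j t) n" for i t
    define \<eta> where "\<eta> i t = coupling N d i (\<lambda>j. \<chi> j t) n" for i t
    have \<xi>c: "\<xi> i t \<in> carrier_vec n" and \<eta>c: "\<eta> i t \<in> carrier_vec n" for i t
      by (simp_all add: \<xi>_def \<eta>_def coupling_carrier)
    have zeta: "coupling N d i (\<lambda>j. C *\<^sub>v x j t) 1 = C *\<^sub>v \<xi> i t" if i: "i < N" for i t
      unfolding \<xi>_def by (rule coupling_mult_mat_vec[OF C i x])
    have zh: "coupling N d i (\<lambda>j. Hc *\<^sub>v xc j t) n = \<eta> i t" if i: "i < N" for i t
      unfolding \<eta>_def
    proof (rule coupling_cong[OF i])
      fix j assume j: "j < N"
      show "Hc *\<^sub>v xc j t = \<chi> j t"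
        unfolding split[OF j] Hc_def pad_cols_mult_append[OF one_carrier_mat xh \<chi>] by (rule one_mult_mat_vec[OF \<chi>])
    qed
    have xS: "x i (Suc t) = A *\<^sub>v x i t + (B * F) *\<^sub>v \<chi> i t" if i: "i < N" for i t
    proof -
      have F\<chi>: "F *\<^sub>v \<chi> i t \<in> carrier_vec 1" by (rule mult_mat_vec_carrier[OF F \<chi>])
      have z1: "0\<^sub>m 1 1 *\<^sub>v (C *\<^sub>v \<xi> i t) = (0\<^sub>v 1 :: real vec)" and z2: "0\<^sub>m 1 n *\<^sub>v \<eta> i t = (0\<^sub>v 1 :: real vec)"
        by (rule zero_mat_mult_vec[OF mult_mat_vec_carrier[OF C \<xi>c]] zero_mat_mult_vec[OF \<eta>c])+
      have Fc\<chi>: "Fc *\<^sub>v xc i t = F *\<^sub>v \<chi> i t"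
        unfolding split[OF i] Fc_def by (rule pad_cols_mult_append[OF F xh \<chi>])
      have F0: "F *\<^sub>v \<chi> i t + 0\<^sub>v 1 + 0\<^sub>v 1 = F *\<^sub>v \<chi> i t" using F\<chi> by simp
      have "x i (Suc t) = A *\<^sub>v x i t + B *\<^sub>v (Fc *\<^sub>v xc i t + 0\<^sub>v 1 + 0\<^sub>v 1)"
        by (rule dyn[rule_format, OF i, of t, THEN conjunct1, unfolded zeta[OF i] zh[OF i] z1 z2])
      then show ?thesis by (simp only: Fc\<chi> F0 assoc_mult_mat_vec[OF B F \<chi>])
    qed
    have xcS: "xh i (Suc t) = (A + K * C) *\<^sub>v xh i t - (K * C) *\<^sub>v \<xi> i t + (B * F) *\<^sub>v \<eta> i t \<and>
      \<chi> i (Suc t) = A *\<^sub>v xh i t + (A + B * F) *\<^sub>v \<chi> i t - A *\<^sub>v \<eta> i t" if i: "i < N" for i t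
    proof -
      have C\<xi>: "C *\<^sub>v \<xi> i t \<in> carrier_vec 1" by (rule mult_mat_vec_carrier[OF C \<xi>c])
      let ?p = "(A + K * C) *\<^sub>v xh i t" and ?kc = "(K * C) *\<^sub>v \<xi> i t" and ?b = "(B * F) *\<^sub>v \<eta> i t"
        and ?a = "A *\<^sub>v xh i t" and ?q = "(A + B * F) *\<^sub>v \<chi> i t" and ?ae = "A *\<^sub>v \<eta> i t"
      have v: "?p \<in> carrier_vec n" "?kc \<in> carrier_vec n" "?b \<in> carrier_vec n"
        "?a \<in> carrier_vec n" "?q \<in> carrier_vec n" "?ae \<in> carrier_vec n"
        by (rule mult_mat_vec_carrier[OF P xh] mult_mat_vec_carrier[OF KC \<xi>c] mult_mat_vec_carrier[OF BF \<eta>c]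
          mult_mat_vec_carrier[OF A xh] mult_mat_vec_carrier[OF Q \<chi>] mult_mat_vec_carrier[OF A \<eta>c])+
      have "Ac *\<^sub>v xc i t = (?p + 0\<^sub>m n n *\<^sub>v \<chi> i t) @\<^sub>v (?a + ?q)"
        unfolding Ac_def split[OF i] by (rule four_block_mat_mult_vec[OF P zero_carrier_mat A Q xh \<chi>])
      moreover have "0\<^sub>m n n *\<^sub>v \<chi> i t = 0\<^sub>v n" by (rule zero_mat_mult_vec[OF \<chi>])
      ultimately have 1: "Ac *\<^sub>v xc i t = ?p @\<^sub>v (?a + ?q)" using v(1) by simp
      have "Bc *\<^sub>v (C *\<^sub>v \<xi> i t) = (- K *\<^sub>v (C *\<^sub>v \<xi> i t)) @\<^sub>v (0\<^sub>m n 1 *\<^sub>v (C *\<^sub>v \<xi> i t))"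
        unfolding Bc_def by (rule mat_mult_append[OF Kn zero_carrier_mat C\<xi>])
      moreover have "- K *\<^sub>v (C *\<^sub>v \<xi> i t) = - ?kc"
        unfolding assoc_mult_mat_vec[OF K C \<xi>c] using K carrier_vecD[OF C\<xi>] by (intro uminus_mult_mat_vec) auto
      moreover have "0\<^sub>m n 1 *\<^sub>v (C *\<^sub>v \<xi> i t) = 0\<^sub>v n" by (rule zero_mat_mult_vec[OF C\<xi>])
      ultimately have 2: "Bc *\<^sub>v (C *\<^sub>v \<xi> i t) = (- ?kc) @\<^sub>v 0\<^sub>v n" by simp
      have "Ec *\<^sub>v \<eta> i t = ?b @\<^sub>v (- A *\<^sub>v \<eta> i t)"
        unfolding Ec_def by (rule mat_mult_append[OF BF An \<eta>c])
      moreover have "- A *\<^sub>v \<eta> i t = - ?ae" using A carrier_vecD[OF \<eta>c] by (intro uminus_mult_mat_vec) auto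
      ultimately have 3: "Ec *\<^sub>v \<eta> i t = ?b @\<^sub>v (- ?ae)" by simp
      have "xc i (Suc t) = Ac *\<^sub>v xc i t + Bc *\<^sub>v (C *\<^sub>v \<xi> i t) + Ec *\<^sub>v \<eta> i t"
        by (rule dyn[rule_format, OF i, of t, THEN conjunct2, unfolded zeta[OF i] zh[OF i]])
      also have "\<dots> = (?p + - ?kc + ?b) @\<^sub>v (?a + ?q + 0\<^sub>v n + - ?ae)"
        unfolding 1 2 3 using v
        by (simp add: append_vec_add[of _ n _ _ n])
      finally have eq: "xh i (Suc t) @\<^sub>v \<chi> i (Suc t) = (?p + - ?kc + ?b) @\<^sub>v (?a + ?q + 0\<^sub>v n + - ?ae)"
        unfolding split[OF i] .
      have "?p + - ?kc + ?b \<in> carrier_vec n" using v by simp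
      from eq[unfolded append_vec_eq[OF xh this]]
      have "xh i (Suc t) = ?p + - ?kc + ?b" "\<chi> i (Suc t) = ?a + ?q + 0\<^sub>v n + - ?ae" by auto
      moreover have "?p + - ?kc = ?p - ?kc" "?a + ?q + 0\<^sub>v n + - ?ae = ?a + ?q - ?ae"
        using v by (auto intro!: eq_vecI simp del: index_mult_mat_vec dim_mult_mat_vec)
      ultimately show ?thesis by simp
    qed
    show ?thesis
      by (rule observer_protocol_synchronizes[where xh = xh and \<chi> = \<chi> and \<xi> = \<xi> and \<eta> = \<eta>,
            OF A B C F schurF K schurK ev graph tree q d x xh \<chi> \<xi>_def \<eta>_def xS _ _ ijk])
        (use xcS in auto)
  qed
  show ?thesis
    unfolding scale_free_collab_solvable_def
  proof (intro exI conjI allI impI)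
    show "Ac \<in> carrier_mat (n + n) (n + n)" "Bc \<in> carrier_mat (n + n) 1" "Ec \<in> carrier_mat (n + n) n"
      "Fc \<in> carrier_mat 1 (n + n)" "Hc \<in> carrier_mat n (n + n)" by (rule carriers)+
    show "0\<^sub>m 1 1 \<in> carrier_mat 1 1" "0\<^sub>m 1 n \<in> carrier_mat 1 n" by simp_all
    fix N :: nat and a :: "nat \<Rightarrow> nat \<Rightarrow> real" and q :: "nat \<Rightarrow> real"
    assume "weighted_graph N a \<and> has_spanning_tree N a \<and> (\<forall>i<N. q i \<ge> (\<Sum>j<N. a i j))"
    then have h: "weighted_graph N a" "has_spanning_tree N a" "\<forall>i<N. q i \<ge> (\<Sum>j<N. a i j)" by auto
    show "let d = (\<lambda>i j. a i j / (1 + q i)) in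
          \<forall>(x :: nat \<Rightarrow> nat \<Rightarrow> real vec) (xc :: nat \<Rightarrow> nat \<Rightarrow> real vec).
            (\<forall>i<N. x i 0 \<in> carrier_vec n \<and> xc i 0 \<in> carrier_vec (n + n)) \<and>
            (\<forall>i<N. \<forall>t.
               (let zeta = coupling N d i (\<lambda>j. C *\<^sub>v x j t) 1;
                    zh = coupling N d i (\<lambda>j. Hc *\<^sub>v xc j t) n;
                    u = Fc *\<^sub>v xc i t + 0\<^sub>m 1 1 *\<^sub>v zeta + 0\<^sub>m 1 n *\<^sub>v zh
                in x i (Suc t) = A *\<^sub>v x i t + B *\<^sub>v u \<and>
                   xc i (Suc t) = Ac *\<^sub>v xc i t + Bc *\<^sub>v zeta + Ec *\<^sub>v zh))
            \<longrightarrow> (\<forall>i<N. \<forall>j<N. \<forall>k<n. (\<lambda>t. x i t $ k - x j t $ k) \<longlonglongrightarrow> 0)"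
      unfolding Let_def
    proof (intro allI impI, elim conjE)
      fix x xc :: "nat \<Rightarrow> nat \<Rightarrow> real vec" and i j k
      assume tr: "\<forall>i<N. x i 0 \<in> carrier_vec n \<and> xc i 0 \<in> carrier_vec (n + n)"
        "\<forall>i<N. \<forall>t. x i (Suc t) = A *\<^sub>v x i t + B *\<^sub>v (Fc *\<^sub>v xc i t
           + 0\<^sub>m 1 1 *\<^sub>v coupling N (\<lambda>i j. a i j / (1 + q i)) i (\<lambda>j. C *\<^sub>v x j t) 1
           + 0\<^sub>m 1 n *\<^sub>v coupling N (\<lambda>i j. a i j / (1 + q i)) i (\<lambda>j. Hc *\<^sub>v xc j t) n) \<and>
         xc i (Suc t) = Ac *\<^sub>v xc i t + Bc *\<^sub>v coupling N (\<lambda>i j. a i j / (1 + q i)) i (\<lambda>j. C *\<^sub>v x j t) 1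
           + Ec *\<^sub>v coupling N (\<lambda>i j. a i j / (1 + q i)) i (\<lambda>j. Hc *\<^sub>v xc j t) n"
        and ijk: "i < N" "j < N" "k < n"
      show "(\<lambda>t. x i t $ k - x j t $ k) \<longlonglongrightarrow> 0" by (rule sync[OF h refl tr ijk])
    qed
  qed
qed

theorem theorem7:
  fixes A B C :: "real mat" and n :: nat
  assumes "A \<in> carrier_mat n n" and "B \<in> carrier_mat n 1" and "C \<in> carrier_mat 1 n"
  shows "scale_free_collab_solvable n A B C \<longleftrightarrow>
         schur_stable A \<or>
         (stabilizable A B \<and> detectable C A \<and>
          (\<forall>z. eigenvalue (map_mat complex_of_real A) z \<longrightarrow> cmod z \<le> 1))"
proof
  assume "scale_free_collab_solvable n A B C"
  from solvable_imp_conditions[OF assms this]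
  show "schur_stable A \<or> (stabilizable A B \<and> detectable C A \<and>
          (\<forall>z. eigenvalue (map_mat complex_of_real A) z \<longrightarrow> cmod z \<le> 1))" by blast
next
  assume rhs: "schur_stable A \<or> (stabilizable A B \<and> detectable C A \<and>
          (\<forall>z. eigenvalue (map_mat complex_of_real A) z \<longrightarrow> cmod z \<le> 1))"
  have "stabilizable A B \<and> detectable C A \<and>
          (\<forall>z. eigenvalue (map_mat complex_of_real A) z \<longrightarrow> cmod z \<le> 1)" if schur: "schur_stable A"
  proof (intro conjI allI impI)
    \<comment> \<open>Zero feedback and zero output injection are the witnesses.\<close>
    have "A + B * 0\<^sub>m 1 n = A" "A + 0\<^sub>m n 1 * C = A" using assms by auto
    with schur have "schur_stable (A + B * 0\<^sub>m 1 n)" "schur_stable (A + 0\<^sub>m n 1 * C)" by simp_all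
    moreover have "0\<^sub>m 1 n \<in> carrier_mat (dim_col B) (dim_row A)" "0\<^sub>m n 1 \<in> carrier_mat (dim_col A) (dim_row C)"
      using assms by auto
    ultimately show "stabilizable A B" "detectable C A"
      unfolding stabilizable_def detectable_def by blast+
    show "cmod z \<le> 1" if "eigenvalue (map_mat complex_of_real A) z" for z
      using schur that unfolding schur_stable_def by force
  qed
  with rhs show "scale_free_collab_solvable n A B C" using conditions_imp_solvable[OF assms] by blast
qed

end
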